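(* The $R$-algebras $A$ and $\mathsf{H}$ are isomorphic: there is an isomorphism of $R$-algebras $\mathsf{H}\to A$ which is the identity on the copies of $R[\Gamma]$ in the two algebras and which sends $$x_i\mapsto \chi_i\,\sigma\,\upsilon_i^{-1},\qquad y_i\mapsto \upsilon_i\,\tau\,\chi_i^{-1},\qquad \mathsf{u}_i\mapsto u_i\qquad (1\le i\le n),$$ where $\chi_i=(i,i-1,\dots,1)$ and $\upsilon_i=(i,i+1,\dots,n)$ in $S_n\subset\Gamma$ (cycle notation: $\chi_i$ sends $i\mapsto i-1\mapsto\cdots\mapsto 1\mapsto i$, and $\upsilon_i$ sends $i\mapsto i+1\mapsto\cdots\mapsto n\mapsto i$).
   Context: Let $\ell,n\ge 1$, let $\mathbf{k}$ be a field of characteristic coprime to $\ell$ containing a primitive $\ell$-th root of unity $\zeta$, and let $R=\mathbf{k}[\hbar]$. Let $\Gamma$ be the group of $n\times n$ monomial matrices whose nonzero entries are $\ell$-th roots of unity. It is generated by the permutation matrices $S_n$ and by the diagonal matrices $t_j$ with $(t_j)_{jj}=\zeta$ and other diagonal entries $1$; thus $wt_jw^{-1}=t_{w(j)}$ for $w\in S_n$. Write $r_j=(j,j+1)$ for $1\le j\le n-1$. Fix parameters $k,h_1,\dots,h_{\ell-1}\in R$, and set $h_0=h_\ell=0$ and $p(v)=\sum_{s=1}^{\ell-1}\sum_{r=1}^{\ell-1}\zeta^{-rs}h_rv^s$. **The cyclotomic rational Cherednik algebra $\mathsf{H}$** is the $R$-algebra generated by $R[\Gamma]$ and $x_1,\dots,x_n,y_1,\dots,y_n$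 subject to: the $x_i$ commute with each other; the $y_i$ commute with each other; $wx_i=x_{w(i)}w$ and $wy_i=y_{w(i)}w$ for $w\in S_n$; $t_ix_j=\zeta^{\delta_{ij}}x_jt_i$ and $t_iy_j=\zeta^{-\delta_{ij}}y_jt_i$; and $$[x_i,y_i]=\hbar+k\sum_{j\ne i}\sum_{a=0}^{\ell-1}t_i^at_j^{-a}(ij)+p(t_i)-p(\zeta^{-1}t_i),\qquad [x_i,y_j]=-k\sum_{a=0}^{\ell-1}\zeta^{-a}t_i^at_j^{-a}(ij)\quad(i\neq j).$$ In $\mathsf{H}$ define the (modified) Dunkl–Opdam operators $\mathsf{u}_i=y_ix_i+k\sum_{j>i}\sum_{a=0}^{\ell-1}t_i^at_j^{-a}(ij)+p(t_i)$. **The algebra $A$** is the $R$-algebra generated by $R[\Gamma]$ and symbols $\sigma,\tau,u_1,\dots,u_n$, where one defines $u_i,t_i$ for all $i\in\mathbb{Z}$ by $u_i=u_{i-n}+\hbar$ and $t_i=\zeta^{-1}t_{i-n}$, subject to the following relations (those involving transpositions are imposed for $n\ge2$), where $\pi_{j,j+1}=\frac1\ell\sum_{a=0}^{\ell-1}t_j^at_{j+1}^{-a}$: - $u_{j+1}r_j-r_ju_j=-k\ell\,\pi_{j,j+1}$, $\;u_jr_j-r_ju_{j+1}=k\ell\,\pi_{j,j+1}$, and $u_ir_j=r_ju_i$ for $i\in\{1,\dots,n\}\setminus\{j,j+1\}$; - $u_it_j=t_ju_i$ and $u_iu_j=u_ju_i$ for $i,j\in\mathbb{Z}$; - $\sigma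 r_{j-1}=r_j\sigma$ and $\tau r_j=r_{j-1}\tau$ for $2\le j\le n-1$; - $\sigma^2r_{n-1}=r_1\sigma^2$ and $\tau^2r_1=r_{n-1}\tau^2$; - $\sigma\tau=u_1-p(\zeta^{-1}t_1)+\hbar$ and $\tau\sigma=u_n-p(t_n)$; - $u_i\sigma=\sigma u_{i-1}$, $u_i\tau=\tau u_{i+1}$, $t_i\sigma=\sigma t_{i-1}$, $t_i\tau=\tau t_{i+1}$ for $i\in\mathbb{Z}$; - $\tau\,(1,2)\,\sigma=\sigma\,(n-1,n)\,\tau+k\sum_{a=0}^{\ell-1}\zeta^at_n^at_1^{-a}$. *)

theory Defs
  imports
    "HOL-Algebra.QuotRing"
    "HOL-Library.Poly_Mapping"
    "HOL-Combinatorics.Cycles"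
    "HOL-Computational_Algebra.Polynomial"
    "Jordan_Normal_Form.Matrix"
begin

section \<open>Algebras given by generators and relations\<close>

text \<open>The free monoid, written additively so that the monoid ring construction of
  Poly_Mapping applies to it.\<close>

datatype 'x word = Word (letters: "'x list")

instantiation word :: (type) monoid_add
begin

definition zero_word :: "'x word" where "zero_word = Word []"

definition plus_word :: "'x word \<Rightarrow> 'x word \<Rightarrow> 'x word"
  where "plus_word v w = Word (letters v @ letters w)"

instance by standard (simp_all add: zero_word_def plus_word_def)

end

text \<open>Noncommutative polynomials: finitely supported functions from words to the commutative
  ring of coefficients, with the convolution product.\<close>

type_synonym ('x, 'r) ncpoly = "'x word \<Rightarrow>\<^sub>0 'r"

definition gen :: "'x \<Rightarrow> ('x, 'r::comm_ring_1) ncpoly"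
  where "gen x = Poly_Mapping.single (Word [x]) 1"

definition scal :: "'r \<Rightarrow> ('x, 'r::comm_ring_1) ncpoly"
  where "scal c = Poly_Mapping.single 0 c"

definition free_alg :: "'x set \<Rightarrow> ('x, 'r::comm_ring_1) ncpoly ring"
  where "free_alg X =
    \<lparr>carrier = {f. \<forall>w \<in> Poly_Mapping.keys f. set (letters w) \<subseteq> X},
     monoid.mult = (*), one = 1, ring.zero = 0, add = (+)\<rparr>"

text \<open>A relation is a pair of noncommutative polynomials, its left and right hand sides.\<close>

definition rel_ideal ::
    "'x set \<Rightarrow> (('x, 'r::comm_ring_1) ncpoly \<times> ('x, 'r) ncpoly) set \<Rightarrow> ('x, 'r) ncpoly set"
  where "rel_ideal X S = Idl\<^bsub>free_alg X\<^esub> ((\<lambda>(a, b). a - b) ` S)"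

definition pres_alg ::
    "'x set \<Rightarrow> (('x, 'r::comm_ring_1) ncpoly \<times> ('x, 'r) ncpoly) set \<Rightarrow> ('x, 'r) ncpoly set ring"
  where "pres_alg X S = free_alg X Quot rel_ideal X S"

definition pres_class ::
    "'x set \<Rightarrow> (('x, 'r::comm_ring_1) ncpoly \<times> ('x, 'r) ncpoly) set
      \<Rightarrow> ('x, 'r) ncpoly \<Rightarrow> ('x, 'r) ncpoly set"
  where "pres_class X S f = rel_ideal X S +>\<^bsub>free_alg X\<^esub> f"

text \<open>An isomorphism of algebras over the coefficient ring is a ring isomorphism compatible
  with the two structure maps.\<close>

definition pres_alg_iso ::
    "'x set \<Rightarrow> (('x, 'r::comm_ring_1) ncpoly \<times> ('x, 'r) ncpoly) set
      \<Rightarrow> 'y set \<Rightarrow> (('y, 'r) ncpoly \<times> ('y, 'r) ncpoly) set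
      \<Rightarrow> (('x, 'r) ncpoly set \<Rightarrow> ('y, 'r) ncpoly set) set"
  where "pres_alg_iso X S Y T =
    {\<phi> \<in> ring_iso (pres_alg X S) (pres_alg Y T).
       \<forall>c. \<phi> (pres_class X S (scal c)) = pres_class Y T (scal c)}"


section \<open>The group of monomial matrices\<close>

definition primitive_root_of_unity :: "nat \<Rightarrow> 'k::field \<Rightarrow> bool"
  where "primitive_root_of_unity l \<zeta> \<longleftrightarrow> \<zeta> ^ l = 1 \<and> (\<forall>m. 0 < m \<and> m < l \<longrightarrow> \<zeta> ^ m \<noteq> 1)"

definition monomial_group :: "nat \<Rightarrow> nat \<Rightarrow> 'k::field mat monoid"
  where "monomial_group n l =
    \<lparr>carrier = {g \<in> carrier_mat n n.
        (\<forall>a<n. \<exists>!b. b < n \<and> g $$ (a, b) \<noteq> 0) \<and>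
        (\<forall>b<n. \<exists>!a. a < n \<and> g $$ (a, b) \<noteq> 0) \<and>
        (\<forall>a<n. \<forall>b<n. g $$ (a, b) \<noteq> 0 \<longrightarrow> g $$ (a, b) ^ l = 1)},
     monoid.mult = (*), one = 1\<^sub>m n\<rparr>"

text \<open>Matrix entries are indexed from 0, whereas permutations act on \<open>{1..n}\<close> and the generators
  below are numbered from 1. The matrix of \<open>w\<close> sends the \<open>j\<close>-th basis vector to the
  \<open>w j\<close>-th one.\<close>

definition perm_mat :: "nat \<Rightarrow> (nat \<Rightarrow> nat) \<Rightarrow> 'k::field mat"
  where "perm_mat n w = mat n n (\<lambda>(a, b). if a + 1 = w (b + 1) then 1 else 0)"

definition t_mat :: "nat \<Rightarrow> 'k::field \<Rightarrow> nat \<Rightarrow> 'k mat"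
  where "t_mat n \<zeta> j =
    mat n n (\<lambda>(a, b). if a = b then if a + 1 = j then \<zeta> else 1 else 0)"

definition tt_mat :: "nat \<Rightarrow> nat \<Rightarrow> 'k::field \<Rightarrow> nat \<Rightarrow> nat \<Rightarrow> nat \<Rightarrow> 'k mat"
  where "tt_mat n l \<zeta> i j a =
    (t_mat n \<zeta> i [^]\<^bsub>monomial_group n l\<^esub> int a)
      \<otimes>\<^bsub>monomial_group n l\<^esub> (t_mat n \<zeta> j [^]\<^bsub>monomial_group n l\<^esub> (- int a))"

definition chi_cycle :: "nat \<Rightarrow> nat \<Rightarrow> nat"
  where "chi_cycle i = cycle_of_list (rev [1..<Suc i])"

definition upsilon_cycle :: "nat \<Rightarrow> nat \<Rightarrow> nat \<Rightarrow> nat"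
  where "upsilon_cycle n i = cycle_of_list [i..<Suc n]"

text \<open>Adjoining a group algebra \<open>R[G]\<close> to a presentation amounts to adjoining a generator \<open>e g\<close>
  for every group element \<open>g\<close>, subject to the multiplication table of \<open>G\<close>.
  For finite \<open>G\<close>, the element of \<open>R[G]\<close> with coefficient function \<open>f\<close> then becomes
  \<open>group_alg_elem G e f\<close>.\<close>

definition group_rels :: "('g, 'm) monoid_scheme \<Rightarrow> ('g \<Rightarrow> 'x)
    \<Rightarrow> (('x, 'r::comm_ring_1) ncpoly \<times> ('x, 'r) ncpoly) set"
  where "group_rels G e =
    {(gen (e g) * gen (e g'), gen (e (g \<otimes>\<^bsub>G\<^esub> g'))) | g g'. g \<in> carrier G \<and> g' \<in> carrier G}
    \<union> {(gen (e \<one>\<^bsub>G\<^esub>), 1)}"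

definition group_alg_elem :: "('g, 'm) monoid_scheme \<Rightarrow> ('g \<Rightarrow> 'x) \<Rightarrow> ('g \<Rightarrow> 'r)
    \<Rightarrow> ('x, 'r::comm_ring_1) ncpoly"
  where "group_alg_elem G e f = (\<Sum>g\<in>carrier G. scal (f g) * gen (e g))"


section \<open>Parameters\<close>

text \<open>The base ring is \<open>'k poly\<close>, its indeterminate being \<open>\<hbar>\<close>. Only the values \<open>h 1, \<dots>, h (l - 1)\<close>
  of \<open>h\<close> are used.\<close>

definition hbar :: "'k::field poly"
  where "hbar = [:0, 1:]"

definition p_eval :: "nat \<Rightarrow> 'k::field \<Rightarrow> (nat \<Rightarrow> 'k poly) \<Rightarrow> ('x, 'k poly) ncpoly
    \<Rightarrow> ('x, 'k poly) ncpoly"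
  where "p_eval l \<zeta> h v =
    (\<Sum>s=1..l-1. \<Sum>r=1..l-1. scal ([:inverse \<zeta> ^ (r * s):] * h r) * v ^ s)"


section \<open>The cyclotomic rational Cherednik algebra\<close>

datatype 'g cher_gen = HG 'g | HX nat | HY nat

definition cher_gens :: "nat \<Rightarrow> nat \<Rightarrow> 'k::field mat cher_gen set"
  where "cher_gens n l = HG ` carrier (monomial_group n l) \<union> HX ` {1..n} \<union> HY ` {1..n}"

context
  fixes n l :: nat and \<zeta> :: "'k::field" and k :: "'k poly" and h :: "nat \<Rightarrow> 'k poly"
begin

definition h_w :: "(nat \<Rightarrow> nat) \<Rightarrow> ('k mat cher_gen, 'k poly) ncpoly"
  where "h_w w = gen (HG (perm_mat n w))"

definition h_t :: "nat \<Rightarrow> ('k mat cher_gen, 'k poly) ncpoly"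
  where "h_t j = gen (HG (t_mat n \<zeta> j))"

definition h_tt :: "nat \<Rightarrow> nat \<Rightarrow> nat \<Rightarrow> ('k mat cher_gen, 'k poly) ncpoly"
  where "h_tt i j a = gen (HG (tt_mat n l \<zeta> i j a))"

definition h_x :: "nat \<Rightarrow> ('k mat cher_gen, 'k poly) ncpoly"
  where "h_x i = gen (HX i)"

definition h_y :: "nat \<Rightarrow> ('k mat cher_gen, 'k poly) ncpoly"
  where "h_y i = gen (HY i)"

definition cher_rels ::
    "(('k mat cher_gen, 'k poly) ncpoly \<times> ('k mat cher_gen, 'k poly) ncpoly) set"
  where "cher_rels =
    group_rels (monomial_group n l) HG
    \<union> {(h_x i * h_x j, h_x j * h_x i) | i j. i \<in> {1..n} \<and> j \<in> {1..n}}
    \<union> {(h_y i * h_y j, h_y j * h_y i) | i j. i \<in> {1..n} \<and> j \<in> {1..n}}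
    \<union> {(h_w w * h_x i, h_x (w i) * h_w w) | w i. w permutes {1..n} \<and> i \<in> {1..n}}
    \<union> {(h_w w * h_y i, h_y (w i) * h_w w) | w i. w permutes {1..n} \<and> i \<in> {1..n}}
    \<union> {(h_t i * h_x j, scal [:if i = j then \<zeta> else 1:] * h_x j * h_t i) | i j.
         i \<in> {1..n} \<and> j \<in> {1..n}}
    \<union> {(h_t i * h_y j, scal [:if i = j then inverse \<zeta> else 1:] * h_y j * h_t i) | i j.
         i \<in> {1..n} \<and> j \<in> {1..n}}
    \<union> {(h_x i * h_y i - h_y i * h_x i,
          scal hbar
          + scal k * (\<Sum>j\<in>{1..n}-{i}. \<Sum>a=0..l-1. h_tt i j a * h_w (transpose i j))
          + p_eval l \<zeta> h (h_t i) - p_eval l \<zeta> h (scal [:inverse \<zeta>:] * h_t i)) | i.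
         i \<in> {1..n}}
    \<union> {(h_x i * h_y j - h_y j * h_x i,
          - (scal k * (\<Sum>a=0..l-1. scal [:inverse \<zeta> ^ a:] * h_tt i j a * h_w (transpose i j)))) | i j.
         i \<in> {1..n} \<and> j \<in> {1..n} \<and> i \<noteq> j}"

definition cher_class ::
    "('k mat cher_gen, 'k poly) ncpoly \<Rightarrow> ('k mat cher_gen, 'k poly) ncpoly set"
  where "cher_class = pres_class (cher_gens n l) cher_rels"

definition dunkl_opdam :: "nat \<Rightarrow> ('k mat cher_gen, 'k poly) ncpoly"
  where "dunkl_opdam i =
    h_y i * h_x i
    + scal k * (\<Sum>j\<in>{i<..n}. \<Sum>a=0..l-1. h_tt i j a * h_w (transpose i j))
    + p_eval l \<zeta> h (h_t i)"

end


section \<open>The algebra A\<close>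

datatype 'g a_gen = AG 'g | ASigma | ATau | AU nat

definition a_gens :: "nat \<Rightarrow> nat \<Rightarrow> 'k::field mat a_gen set"
  where "a_gens n l = AG ` carrier (monomial_group n l) \<union> {ASigma, ATau} \<union> AU ` {1..n}"

context
  fixes n l :: nat and \<zeta> :: "'k::field" and k :: "'k poly" and h :: "nat \<Rightarrow> 'k poly"
begin

definition a_w :: "(nat \<Rightarrow> nat) \<Rightarrow> ('k mat a_gen, 'k poly) ncpoly"
  where "a_w w = gen (AG (perm_mat n w))"

definition a_r :: "nat \<Rightarrow> ('k mat a_gen, 'k poly) ncpoly"
  where "a_r j = a_w (transpose j (j + 1))"

definition a_tt :: "nat \<Rightarrow> nat \<Rightarrow> nat \<Rightarrow> ('k mat a_gen, 'k poly) ncpoly"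
  where "a_tt i j a = gen (AG (tt_mat n l \<zeta> i j a))"

definition a_sigma :: "('k mat a_gen, 'k poly) ncpoly"
  where "a_sigma = gen ASigma"

definition a_tau :: "('k mat a_gen, 'k poly) ncpoly"
  where "a_tau = gen ATau"

text \<open>The elements \<open>u\<^sub>i\<close> and \<open>t\<^sub>i\<close> for all integers \<open>i\<close>. Writing \<open>i = m + q n\<close> with \<open>m\<close> in
  \<open>{1..n}\<close>, the rules \<open>u\<^sub>i = u\<^sub>i\<^sub>-\<^sub>n + \<hbar>\<close> and \<open>t\<^sub>i = \<zeta>\<^sup>-\<^sup>1 t\<^sub>i\<^sub>-\<^sub>n\<close> amount to
  \<open>u\<^sub>i = u\<^sub>m + q \<hbar>\<close> and \<open>t\<^sub>i = \<zeta>\<^sup>-\<^sup>q t\<^sub>m\<close>; see the lemmas after this block.\<close>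

definition res_ix :: "int \<Rightarrow> nat"
  where "res_ix i = nat ((i - 1) mod int n) + 1"

definition quot_ix :: "int \<Rightarrow> int"
  where "quot_ix i = (i - 1) div int n"

definition a_u :: "int \<Rightarrow> ('k mat a_gen, 'k poly) ncpoly"
  where "a_u i = gen (AU (res_ix i)) + scal (of_int (quot_ix i) * hbar)"

definition a_t :: "int \<Rightarrow> ('k mat a_gen, 'k poly) ncpoly"
  where "a_t i = scal [:\<zeta> powi (- quot_ix i):] * gen (AG (t_mat n \<zeta> (res_ix i)))"

definition a_pi :: "nat \<Rightarrow> ('k mat a_gen, 'k poly) ncpoly"
  where "a_pi j = scal [:inverse (of_nat l):] * (\<Sum>a=0..l-1. a_tt j (j + 1) a)"

definition a_rels ::
    "(('k mat a_gen, 'k poly) ncpoly \<times> ('k mat a_gen, 'k poly) ncpoly) set"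
  where "a_rels =
    group_rels (monomial_group n l) AG
    \<union> {(a_u (int j + 1) * a_r j - a_r j * a_u (int j), - (scal (k * of_nat l) * a_pi j)) | j.
         1 \<le> j \<and> j \<le> n - 1}
    \<union> {(a_u (int j) * a_r j - a_r j * a_u (int j + 1), scal (k * of_nat l) * a_pi j) | j.
         1 \<le> j \<and> j \<le> n - 1}
    \<union> {(a_u (int i) * a_r j, a_r j * a_u (int i)) | i j.
         1 \<le> j \<and> j \<le> n - 1 \<and> i \<in> {1..n} - {j, j + 1}}
    \<union> {(a_u i * a_t j, a_t j * a_u i) | i j. True}
    \<union> {(a_u i * a_u j, a_u j * a_u i) | i j. True}
    \<union> {(a_sigma * a_r (j - 1), a_r j * a_sigma) | j. 2 \<le> j \<and> j \<le> n - 1}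
    \<union> {(a_tau * a_r j, a_r (j - 1) * a_tau) | j. 2 \<le> j \<and> j \<le> n - 1}
    \<union> (if n \<ge> 2 then
         {(a_sigma ^ 2 * a_r (n - 1), a_r 1 * a_sigma ^ 2),
          (a_tau ^ 2 * a_r 1, a_r (n - 1) * a_tau ^ 2)}
       else {})
    \<union> {(a_sigma * a_tau, a_u 1 - p_eval l \<zeta> h (scal [:inverse \<zeta>:] * a_t 1) + scal hbar),
       (a_tau * a_sigma, a_u (int n) - p_eval l \<zeta> h (a_t (int n)))}
    \<union> {(a_u i * a_sigma, a_sigma * a_u (i - 1)) | i. True}
    \<union> {(a_u i * a_tau, a_tau * a_u (i + 1)) | i. True}
    \<union> {(a_t i * a_sigma, a_sigma * a_t (i - 1)) | i. True}
    \<union> {(a_t i * a_tau, a_tau * a_t (i + 1)) | i. True}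
    \<union> (if n \<ge> 2 then
         {(a_tau * a_w (transpose 1 2) * a_sigma,
           a_sigma * a_w (transpose (n - 1) n) * a_tau
           + scal k * (\<Sum>a=0..l-1. scal [:\<zeta> ^ a:] * a_tt n 1 a))}
       else {})"

definition a_class ::
    "('k mat a_gen, 'k poly) ncpoly \<Rightarrow> ('k mat a_gen, 'k poly) ncpoly set"
  where "a_class = pres_class (a_gens n l) a_rels"

end

lemma ix_in_range:
  assumes "i \<in> {1..n}"
  shows "res_ix n (int i) = i" and "quot_ix n (int i) = 0"
  using assms by (auto simp: res_ix_def quot_ix_def nat_diff_distrib div_pos_pos_trivial)

lemma ix_shift:
  assumes "n \<ge> 1"
  shows "res_ix n (i - int n) = res_ix n i" and "quot_ix n (i - int n) = quot_ix n i - 1"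
proof -
  have *: "i - int n - 1 = (i - 1) + (-1) * int n" by simp
  show "res_ix n (i - int n) = res_ix n i"
    unfolding res_ix_def * by (subst mod_mult_self1) simp
  show "quot_ix n (i - int n) = quot_ix n i - 1"
    unfolding quot_ix_def * using assms by (subst div_mult_self1) auto
qed

lemma scal_add: "scal (c + d) = scal c + scal d"
  by (simp add: scal_def single_add)

lemma scal_mult: "scal (c * d) = scal c * scal d"
  by (simp add: scal_def mult_single)

lemma a_u_base: "i \<in> {1..n} \<Longrightarrow> a_u n (int i) = gen (AU i)"
  by (simp add: a_u_def ix_in_range scal_def)

lemma a_u_shift: "n \<ge> 1 \<Longrightarrow> a_u n i = a_u n (i - int n) + scal hbar"
  by (simp add: a_u_def ix_shift add.assoc flip: scal_add) (simp add: algebra_simps)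

lemma a_t_base: "i \<in> {1..n} \<Longrightarrow> a_t n \<zeta> (int i) = gen (AG (t_mat n \<zeta> i))"
  by (simp add: a_t_def ix_in_range scal_def flip: one_pCons)

lemma a_t_shift:
  "n \<ge> 1 \<Longrightarrow> \<zeta> \<noteq> 0 \<Longrightarrow> a_t n \<zeta> i = scal [:inverse \<zeta>:] * a_t n \<zeta> (i - int n)"
  by (simp add: a_t_def ix_shift power_int_diff power_int_minus field_simps
      flip: mult.assoc scal_mult)

end

theory Submission
  imports Defs
begin

text \<open>
  The two assignments on generators are mutually inverse: with \<open>\<omega> = \<upsilon>\<^sub>1 = (1, \<dots>, n)\<close> one sends
  \<open>\<sigma>\<close> to \<open>x\<^sub>1 \<omega>\<close>, \<open>\<tau>\<close> to \<open>\<omega>\<^sup>-\<^sup>1 y\<^sub>1\<close> and \<open>u\<^sub>i\<close> to the Dunkl-Opdam operator, so it only remains to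
  check that each set of relations implies the other. In \<open>H\<close>, the operator \<open>u\<^sub>i\<close> commutes with
  \<open>x\<^sub>1\<close> and \<open>y\<^sub>1\<close> up to a single summand of the reflection sum, hence with \<open>x\<^sub>1 y\<^sub>1\<close> and with \<open>u\<^sub>1\<close>;
  the relations between \<open>u\<^sub>j\<close> and \<open>r\<^sub>j\<close> propagate this to the commutativity of all \<open>u\<^sub>i\<close>.
  In \<open>A\<close>, the elements \<open>\<sigma> \<omega>\<^sup>-\<^sup>1\<close> and \<open>\<omega> \<tau>\<close> commute with the stabilizer of 1 in the symmetric group, so
  that \<open>x\<^sub>i\<close> and \<open>y\<^sub>i\<close> are their conjugates, and every relation of \<open>H\<close> follows by conjugation from
  a single instance of it.
\<close>

section \<open>Substitution homomorphisms\<close>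

text \<open>Both directions use one dictionary, proved in \<open>wreath_xy\<close> from the
  equivariance of x and y alone. For n \<ge> 2, \<sigma>^2 r_{n-1} and r_1 \<sigma>^2 are x_1 x_2
  and x_2 x_1 followed by the same permutation, similarly for \<tau>, while \<tau> r_1 \<sigma> and
  \<sigma> r_{n-1} \<tau> are y_n x_1 and x_1 y_n followed by (1,n). Permutations can be cancelled,
  so each of these relations of A is equivalent to one relation of H, for one pair of indices;
  double transitivity of S_n gives the other pairs. The asymmetric sum over j > i in the Dunkl-Opdam
  element explains \<sigma> \<tau> and \<tau> \<sigma>. For i = n it is empty, so y_n x_n = u_n -
  p(t_n). For i = 1 it is the whole reflection sum of [x_1, y_1], so x_1 y_1 = u_1 + \<hbar> -
  p(\<zeta>^{-1} t_1). With u_{n+1} = u_1 + \<hbar> and t_{n+1} = \<zeta>^{-1} t_1, the products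
  \<tau> \<sigma> and \<sigma> \<tau> are thus u_i - p(t_i) for i = n and i = n + 1.\<close>

lemma single_eq_scal_word:
  "Poly_Mapping.single w c = scal c * prod_list (map gen (letters w))"
proof -
  have "Poly_Mapping.single (Word xs) (1::'b) = prod_list (map gen xs)" for xs :: "'a list"
  proof (induction xs)
    case Nil
    then show ?case by (simp flip: zero_word_def)
  next
    case (Cons x xs)
    have "Word (x # xs) = Word [x] + Word xs" by (simp add: plus_word_def)
    then have "Poly_Mapping.single (Word (x # xs)) (1::'b) = gen x * Poly_Mapping.single (Word xs) 1"
      by (simp add: gen_def mult_single)
    with Cons.IH show ?case by simp
  qed
  from this[of "letters w", symmetric] show ?thesis by (simp add: scal_def mult_single)
qed

lemma ncpoly_eq_sum:
  "f = (\<Sum>w\<in>Poly_Mapping.keys f. scal (Poly_Mapping.lookup f w) * prod_list (map gen (letters w)))"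
proof -
  have "f = (\<Sum>w\<in>Poly_Mapping.keys f. Poly_Mapping.single w (Poly_Mapping.lookup f w))"
    by (rule poly_mapping_eqI) (simp add: lookup_sum lookup_single in_keys_iff when_def)
  then show ?thesis by (simp only: single_eq_scal_word)
qed

lemma scal_commute: "scal c * f = f * scal c"
proof -
  have single: "scal c * Poly_Mapping.single w a = Poly_Mapping.single w a * scal c"
    for w :: "'a word" and a :: 'b
    by (simp add: scal_def mult_single mult.commute)
  show ?thesis
    by (subst (1 2) ncpoly_eq_sum)
      (simp only: sum_distrib_left sum_distrib_right single flip: single_eq_scal_word)
qed

lemma scal_1 [simp]: "scal 1 = 1"
  by (simp add: scal_def)

lemma scal_0 [simp]: "scal 0 = 0"
  by (simp add: scal_def)

text \<open>The homomorphism that the universal property of the free algebra assigns to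
  \<open>v\<close>, written out on the support.\<close>

definition subst :: "('x \<Rightarrow> ('y, 'r) ncpoly) \<Rightarrow> ('x, 'r::comm_ring_1) ncpoly \<Rightarrow> ('y, 'r) ncpoly"
  where "subst v f =
    (\<Sum>w\<in>Poly_Mapping.keys f. scal (Poly_Mapping.lookup f w) * prod_list (map v (letters w)))"

text \<open>Supports can shrink under addition by cancellation; summing over a common larger set
  makes additivity a termwise matter.\<close>

lemma subst_superset:
  assumes "finite A" "Poly_Mapping.keys f \<subseteq> A"
  shows "subst v f = (\<Sum>w\<in>A. scal (Poly_Mapping.lookup f w) * prod_list (map v (letters w)))"
  unfolding subst_def using assms by (intro sum.mono_neutral_left) (auto simp: in_keys_iff)

lemma subst_add [simp]: "subst v (f + g) = subst v f + subst v g"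
proof -
  let ?A = "Poly_Mapping.keys f \<union> Poly_Mapping.keys g"
  have "Poly_Mapping.keys (f + g) \<subseteq> ?A" by (rule keys_add)
  then show ?thesis
    by (simp add: subst_superset[of ?A] lookup_add scal_add distrib_right sum.distrib)
qed

lemma subst_0 [simp]: "subst v 0 = 0"
  by (simp add: subst_def)

lemma subst_sum [simp]: "subst v (sum f A) = (\<Sum>a\<in>A. subst v (f a))"
  by (induction A rule: infinite_finite_induct) auto

lemma subst_uminus [simp]: "subst v (- f) = - subst v f"
  using subst_add[of v f "- f"] by (simp add: eq_neg_iff_add_eq_0 add.commute)

lemma subst_diff [simp]: "subst v (f - g) = subst v f - subst v g"
  using subst_add[of v f "- g"] by simp

lemma subst_single: "subst v (Poly_Mapping.single w c) = scal c * prod_list (map v (letters w))"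
  by (subst subst_superset[of "{w}"]) (auto simp: lookup_single)

lemma subst_mult [simp]: "subst v (f * g) = subst v f * subst v g"
proof -
  have single: "subst v (Poly_Mapping.single w c * Poly_Mapping.single w' c')
      = subst v (Poly_Mapping.single w c) * subst v (Poly_Mapping.single w' c')"
    for w w' and c c' :: 'b
    by (simp add: subst_single mult_single scal_mult plus_word_def mult.assoc)
      (metis (no_types) mult.assoc scal_commute)
  show ?thesis
    by (subst (1 2) ncpoly_eq_sum, subst (3 4) ncpoly_eq_sum)
      (simp only: sum_distrib_left sum_distrib_right subst_sum single flip: single_eq_scal_word)
qed

lemma subst_scal [simp]: "subst v (scal c) = scal c"
  by (simp add: scal_def subst_single) (simp add: scal_def zero_word_def)

lemma subst_1 [simp]: "subst v 1 = 1"
  using subst_scal[of v 1] by simp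

lemma subst_power [simp]: "subst v (f ^ m) = subst v f ^ m"
  by (induction m) auto

lemma subst_gen [simp]: "subst v (gen x) = v x"
  by (simp add: gen_def subst_single)

lemma subst_p_eval [simp]: "subst v (p_eval l \<zeta> h f) = p_eval l \<zeta> h (subst v f)"
  by (simp add: p_eval_def)

section \<open>The free algebra on a subset of the generators\<close>

abbreviation poly_in :: "'x set \<Rightarrow> ('x, 'r::comm_ring_1) ncpoly set"
  where "poly_in X \<equiv> carrier (free_alg X)"

lemma free_alg_simps [simp]:
  "f \<otimes>\<^bsub>free_alg X\<^esub> g = f * g" "f \<oplus>\<^bsub>free_alg X\<^esub> g = f + g"
  "\<one>\<^bsub>free_alg X\<^esub> = 1" "\<zero>\<^bsub>free_alg X\<^esub> = 0"
  by (simp_all add: free_alg_def)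

lemma poly_in_0 [intro, simp]: "0 \<in> poly_in X"
  by (simp add: free_alg_def)

lemma poly_in_add [intro, simp]: "f \<in> poly_in X \<Longrightarrow> g \<in> poly_in X \<Longrightarrow> f + g \<in> poly_in X"
  using keys_add[of f g] by (fastforce simp: free_alg_def)

lemma poly_in_uminus [intro, simp]: "f \<in> poly_in X \<Longrightarrow> - f \<in> poly_in X"
  by (auto simp: free_alg_def in_keys_iff)

lemma poly_in_diff [intro, simp]: "f \<in> poly_in X \<Longrightarrow> g \<in> poly_in X \<Longrightarrow> f - g \<in> poly_in X"
  using poly_in_add[of f X "- g"] by simp

lemma poly_in_mult [intro, simp]: "f \<in> poly_in X \<Longrightarrow> g \<in> poly_in X \<Longrightarrow> f * g \<in> poly_in X"
  using keys_mult[of f g] by (fastforce simp: free_alg_def plus_word_def)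

lemma poly_in_scal [intro, simp]: "scal c \<in> poly_in X"
  by (simp add: free_alg_def scal_def zero_word_def)

lemma poly_in_1 [intro, simp]: "1 \<in> poly_in X"
  using poly_in_scal[of 1 X] by simp

lemma poly_in_gen [intro, simp]: "x \<in> X \<Longrightarrow> gen x \<in> poly_in X"
  by (simp add: free_alg_def gen_def)

lemma poly_in_sum [intro, simp]: "(\<And>a. a \<in> A \<Longrightarrow> f a \<in> poly_in X) \<Longrightarrow> sum f A \<in> poly_in X"
  by (induction A rule: infinite_finite_induct) auto

lemma poly_in_prod_list [intro, simp]: "set fs \<subseteq> poly_in X \<Longrightarrow> prod_list fs \<in> poly_in X"
  by (induction fs) auto

lemma poly_in_power [intro, simp]: "f \<in> poly_in X \<Longrightarrow> f ^ m \<in> poly_in X"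
  by (induction m) auto

lemma poly_in_p_eval [intro, simp]: "f \<in> poly_in X \<Longrightarrow> p_eval l \<zeta> h f \<in> poly_in X"
  by (simp add: p_eval_def)

lemma poly_in_subst:
  assumes "f \<in> poly_in X" "\<forall>x\<in>X. v x \<in> poly_in Y"
  shows "subst v f \<in> poly_in Y"
  unfolding subst_def
proof (intro poly_in_sum poly_in_mult poly_in_scal poly_in_prod_list)
  fix w assume "w \<in> Poly_Mapping.keys f"
  with assms(1) have "set (letters w) \<subseteq> X" by (auto simp: free_alg_def)
  with assms(2) show "set (map v (letters w)) \<subseteq> poly_in Y" by auto
qed

lemma ring_free_alg: "ring (free_alg X)"
proof (rule ringI)
  show "abelian_group (free_alg X)"
    by (rule abelian_groupI) (auto simp: add.assoc add.commute intro: bexI[of _ "- _"])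
  show "monoid (free_alg X)"
    by (rule monoidI) (auto simp: mult.assoc)
qed (auto simp: algebra_simps)

lemma free_alg_minus:
  assumes "f \<in> poly_in X" "g \<in> poly_in X"
  shows "f \<ominus>\<^bsub>free_alg X\<^esub> g = f - g"
proof -
  interpret ring "free_alg X" by (rule ring_free_alg)
  have "\<ominus>\<^bsub>free_alg X\<^esub> g = - g"
    using assms by (intro minus_equality) auto
  then show ?thesis by (simp add: a_minus_def)
qed

section \<open>Presented algebras inside a type\<close>

definition two_sided :: "'a::ring_1 set \<Rightarrow> bool"
  where "two_sided I \<longleftrightarrow> 0 \<in> I \<and> (\<forall>a\<in>I. \<forall>b\<in>I. a - b \<in> I) \<and> (\<forall>a\<in>I. \<forall>x. a * x \<in> I \<and> x * a \<in> I)"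

lemma two_sided_0: "two_sided I \<Longrightarrow> 0 \<in> I"
  and two_sided_diff: "two_sided I \<Longrightarrow> a \<in> I \<Longrightarrow> b \<in> I \<Longrightarrow> a - b \<in> I"
  and two_sided_mult: "two_sided I \<Longrightarrow> a \<in> I \<Longrightarrow> a * x \<in> I" "two_sided I \<Longrightarrow> a \<in> I \<Longrightarrow> x * a \<in> I"
  unfolding two_sided_def by blast+

lemma two_sided_uminus: "two_sided I \<Longrightarrow> a \<in> I \<Longrightarrow> - a \<in> I"
  using two_sided_diff[of I 0 a] by (simp add: two_sided_0)

lemma two_sided_add: "two_sided I \<Longrightarrow> a \<in> I \<Longrightarrow> b \<in> I \<Longrightarrow> a + b \<in> I"
  using two_sided_diff[of I a "- b"] by (simp add: two_sided_uminus)

lemma two_sided_trans: "two_sided I \<Longrightarrow> a - b \<in> I \<Longrightarrow> b - c \<in> I \<Longrightarrow> a - c \<in> I"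
  using two_sided_add[of I "a - b" "b - c"] by simp

lemma two_sided_eqI: "two_sided I \<Longrightarrow> a = b \<Longrightarrow> a - b \<in> I"
  by (simp add: two_sided_0)

text \<open>The quotient by a parameter-dependent ideal is not a type, but the product of the quotients by
  all ideals is. Each quotient embeds into it as one factor, through the map \<open>proj\<close> below, which
  preserves sums and products but not the unit. Identities in a presented algebra can thus be
  proved in a type of class \<open>ring_1\<close>.\<close>

quotient_type (overloaded) 'a quotients = "'a::ring_1 set \<Rightarrow> 'a"
  / "\<lambda>F G. \<forall>I. two_sided I \<longrightarrow> F I - G I \<in> I"
proof (rule equivpI)
  show "reflp (\<lambda>F G. \<forall>I. two_sided I \<longrightarrow> F I - G I \<in> I)"
    by (simp add: reflp_def two_sided_0)
  show "symp (\<lambda>F G. \<forall>I. two_sided I \<longrightarrow> F I - G I \<in> I)"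
    by (simp add: symp_def) (metis minus_diff_eq two_sided_uminus)
  show "transp (\<lambda>F G. \<forall>I. two_sided I \<longrightarrow> F I - G I \<in> I)"
    by (simp add: transp_def) (metis two_sided_trans)
qed

instantiation quotients :: (ring_1) ring_1
begin

lift_definition zero_quotients :: "'a quotients" is "\<lambda>_. 0" .
lift_definition one_quotients :: "'a quotients" is "\<lambda>_. 1" .

lift_definition plus_quotients :: "'a quotients \<Rightarrow> 'a quotients \<Rightarrow> 'a quotients"
  is "\<lambda>F G I. F I + G I"
  by (simp add: add_diff_add two_sided_add)

lift_definition uminus_quotients :: "'a quotients \<Rightarrow> 'a quotients" is "\<lambda>F I. - F I"
proof -
  fix F G :: "'a set \<Rightarrow> 'a" and I :: "'a set"
  assume "\<And>I. two_sided I \<Longrightarrow> F I - G I \<in> I" "two_sided I"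
  then show "- F I - - G I \<in> I"
    using two_sided_uminus[of I "F I - G I"] by simp
qed

lift_definition minus_quotients :: "'a quotients \<Rightarrow> 'a quotients \<Rightarrow> 'a quotients"
  is "\<lambda>F G I. F I - G I"
proof -
  fix F F' G G' :: "'a set \<Rightarrow> 'a" and I :: "'a set"
  assume "\<And>I. two_sided I \<Longrightarrow> F I - F' I \<in> I" "\<And>I. two_sided I \<Longrightarrow> G I - G' I \<in> I" "two_sided I"
  then have "(F I - F' I) - (G I - G' I) \<in> I" by (metis two_sided_diff)
  then show "F I - G I - (F' I - G' I) \<in> I" by (simp add: algebra_simps)
qed

lift_definition times_quotients :: "'a quotients \<Rightarrow> 'a quotients \<Rightarrow> 'a quotients"
  is "\<lambda>F G I. F I * G I"
proof -
  fix F F' G G' :: "'a set \<Rightarrow> 'a" and I :: "'a set"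
  assume "\<And>I. two_sided I \<Longrightarrow> F I - F' I \<in> I" "\<And>I. two_sided I \<Longrightarrow> G I - G' I \<in> I" "two_sided I"
  then have "(F I - F' I) * G I + F' I * (G I - G' I) \<in> I"
    by (intro two_sided_add two_sided_mult) auto
  then show "F I * G I - F' I * G' I \<in> I" by (simp add: algebra_simps)
qed

instance
proof
  show "(0::'a quotients) \<noteq> 1"
  proof transfer
    \<comment> \<open>The factor at the zero ideal is the ring itself, where 0 and 1 differ.\<close>
    have "two_sided {0::'a}" by (simp add: two_sided_def)
    then show "\<not> (\<forall>I. two_sided I \<longrightarrow> (0::'a) - 1 \<in> I)" 
      by (auto intro!: exI[of _ "{0}"])
  qed
  fix a b c :: "'a quotients"
  show "a * b * c = a * (b * c)"
    by transfer (intro allI impI two_sided_eqI mult.assoc)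
  show "a + b + c = a + (b + c)"
    by transfer (intro allI impI two_sided_eqI add.assoc)
  show "a + b = b + a"
    by transfer (intro allI impI two_sided_eqI add.commute)
  show "(a + b) * c = a * c + b * c"
    by transfer (intro allI impI two_sided_eqI distrib_right)
  show "a * (b + c) = a * b + a * c"
    by transfer (intro allI impI two_sided_eqI distrib_left)
  show "0 + a = a"
    by transfer (intro allI impI two_sided_eqI add_0_left)
  show "1 * a = a"
    by transfer (intro allI impI two_sided_eqI mult_1_left)
  show "a * 1 = a"
    by transfer (intro allI impI two_sided_eqI mult_1_right)
  show "- a + a = 0"
    by transfer (intro allI impI two_sided_eqI left_minus)
  show "a - b = a + - b"
    by transfer (intro allI impI two_sided_eqI diff_conv_add_uminus)
qed

end

lift_definition proj :: "'a::ring_1 set \<Rightarrow> 'a \<Rightarrow> 'a quotients"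
  is "\<lambda>I a J. if J = I then a else 0" .

lemma proj_eq_iff: "two_sided I \<Longrightarrow> proj I a = proj I b \<longleftrightarrow> a - b \<in> I"
  by transfer (auto simp: two_sided_0)

lemma proj_0 [simp]: "proj I 0 = 0"
  by transfer (simp add: two_sided_0)

lemma proj_add [simp]: "proj I (a + b) = proj I a + proj I b"
  by transfer (simp add: two_sided_0)

lemma proj_uminus [simp]: "proj I (- a) = - proj I a"
  by transfer (simp add: two_sided_0)

lemma proj_diff [simp]: "proj I (a - b) = proj I a - proj I b"
  by transfer (simp add: two_sided_0)

lemma proj_mult [simp]: "proj I (a * b) = proj I a * proj I b"
  by transfer (simp add: two_sided_0)

lemma proj_sum [simp]: "proj I (sum f A) = (\<Sum>a\<in>A. proj I (f a))"
  by (induction A rule: infinite_finite_induct) auto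

text \<open>For \<open>m = 0\<close> the claim would identify \<open>proj I 1\<close> with the unit
  of the whole product. The same obstruction explains why exponents are kept positive
  throughout.\<close>

lemma proj_power: "m > 0 \<Longrightarrow> proj I (a ^ m) = proj I a ^ m"
proof (induction m)
  case (Suc m)
  then show ?case by (cases "m = 0") auto
qed simp

text \<open>The retraction onto the free algebra on \<open>X\<close> that kills all other
  generators.\<close>

definition restrict_gens :: "'x set \<Rightarrow> ('x, 'r::comm_ring_1) ncpoly \<Rightarrow> ('x, 'r) ncpoly"
  where "restrict_gens X = subst (\<lambda>x. if x \<in> X then gen x else 0)"

lemma restrict_gens_in: "restrict_gens X f \<in> poly_in X"
proof -
  have "subst (\<lambda>x. if x \<in> X then gen x else 0) f \<in> poly_in X"
    by (rule poly_in_subst[of _ UNIV]) (auto simp: free_alg_def gen_def)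
  then show ?thesis by (simp add: restrict_gens_def)
qed

lemma restrict_gens_id:
  assumes "f \<in> poly_in X"
  shows "restrict_gens X f = f"
proof -
  have words: "map (\<lambda>x. if x \<in> X then gen x else 0) (letters w) = map gen (letters w)"
    if "w \<in> Poly_Mapping.keys f" for w
    using assms that by (auto simp: free_alg_def)
  have "restrict_gens X f = (\<Sum>w\<in>Poly_Mapping.keys f.
      scal (Poly_Mapping.lookup f w) * prod_list (map gen (letters w)))"
    unfolding restrict_gens_def subst_def by (rule sum.cong) (simp_all only: words)
  then show ?thesis by (simp only: ncpoly_eq_sum[of f, symmetric])
qed

text \<open>In contrast to \<open>rel_ideal X S\<close>, this is an ideal of the whole type of noncommutative
  polynomials, as \<open>proj\<close> requires.\<close>

definition full_ideal ::
    "'x set \<Rightarrow> (('x, 'r::comm_ring_1) ncpoly \<times> ('x, 'r) ncpoly) set \<Rightarrow> ('x, 'r) ncpoly set"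
  where "full_ideal X S = {f. restrict_gens X f \<in> rel_ideal X S}"

locale presentation =
  fixes X :: "'x set" and S :: "(('x, 'r::comm_ring_1) ncpoly \<times> ('x, 'r) ncpoly) set"
  assumes rels_in: "S \<subseteq> poly_in X \<times> poly_in X"
begin

sublocale free: ring "free_alg X"
  by (rule ring_free_alg)

sublocale rel: ideal "rel_ideal X S" "free_alg X"
  unfolding rel_ideal_def using rels_in by (intro free.genideal_ideal) auto

lemma rel_ideal_memI: "(a, b) \<in> S \<Longrightarrow> a - b \<in> rel_ideal X S"
  unfolding rel_ideal_def using rels_in
  by (intro subsetD[OF free.genideal_self]) auto

text \<open>It is the preimage of an ideal of the free algebra on \<open>X\<close> under a ring
  homomorphism with values in that algebra.\<close>

lemma two_sided_full_ideal: "two_sided (full_ideal X S)"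
proof -
  have diff: "f - g \<in> rel_ideal X S" if "f \<in> rel_ideal X S" "g \<in> rel_ideal X S" for f g
  proof -
    have "f \<ominus>\<^bsub>free_alg X\<^esub> g \<in> rel_ideal X S"
      using rel.a_closed[OF that(1) rel.a_inv_closed[OF that(2)]] by (simp add: a_minus_def)
    with that show ?thesis by (simp add: free_alg_minus rel.Icarr)
  qed
  then show ?thesis
    using rel.zero_closed rel.I_l_closed[OF _ restrict_gens_in] rel.I_r_closed[OF _ restrict_gens_in]
    by (simp add: two_sided_def full_ideal_def restrict_gens_def)
qed

lemma pres_class_eq_iff:
  assumes "f \<in> poly_in X" "g \<in> poly_in X"
  shows "pres_class X S f = pres_class X S g \<longleftrightarrow> f - g \<in> rel_ideal X S"
proof -
  have "f - g \<in> rel_ideal X S \<longleftrightarrow> f \<in> rel_ideal X S +>\<^bsub>free_alg X\<^esub> g"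
    using rel.a_rcos_module_minus[OF ring_free_alg assms(2,1)] assms by (simp add: free_alg_minus)
  then show ?thesis
    unfolding pres_class_def
    using rel.a_repr_independence' rel.a_rcos_self assms by metis
qed

text \<open>The bridge between cosets and the type \<open>quotients\<close>: every identity in a
  presented algebra is proved on the right-hand side and carried back by this equivalence.\<close>

lemma pres_class_eq_proj:
  assumes "f \<in> poly_in X" "g \<in> poly_in X"
  shows "pres_class X S f = pres_class X S g
    \<longleftrightarrow> proj (full_ideal X S) f = proj (full_ideal X S) g"
  unfolding pres_class_eq_iff[OF assms] proj_eq_iff[OF two_sided_full_ideal]
  using assms by (simp add: full_ideal_def restrict_gens_id)

lemma proj_rel: "(a, b) \<in> S \<Longrightarrow> proj (full_ideal X S) a = proj (full_ideal X S) b"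
  using rels_in rel_ideal_memI[of a b]
  by (subst proj_eq_iff[OF two_sided_full_ideal]) (auto simp: full_ideal_def restrict_gens_id)

end

context presentation
begin

lemma pres_class_mult:
  "f \<in> poly_in X \<Longrightarrow> g \<in> poly_in X
    \<Longrightarrow> pres_class X S (f * g) = pres_class X S f \<otimes>\<^bsub>pres_alg X S\<^esub> pres_class X S g"
  using ring_hom_mult[OF rel.rcos_ring_hom] by (simp add: pres_class_def pres_alg_def)

lemma pres_class_add:
  "f \<in> poly_in X \<Longrightarrow> g \<in> poly_in X
    \<Longrightarrow> pres_class X S (f + g) = pres_class X S f \<oplus>\<^bsub>pres_alg X S\<^esub> pres_class X S g"
  using ring_hom_add[OF rel.rcos_ring_hom] by (simp add: pres_class_def pres_alg_def)

lemma pres_class_1: "pres_class X S 1 = \<one>\<^bsub>pres_alg X S\<^esub>"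
  using ring_hom_one[OF rel.rcos_ring_hom] by (simp add: pres_class_def pres_alg_def)

lemma pres_class_in: "f \<in> poly_in X \<Longrightarrow> pres_class X S f \<in> carrier (pres_alg X S)"
  using ring_hom_closed[OF rel.rcos_ring_hom] by (simp add: pres_class_def pres_alg_def)

lemma pres_algE:
  assumes "c \<in> carrier (pres_alg X S)"
  obtains f where "f \<in> poly_in X" "c = pres_class X S f"
  using assms by (auto simp: pres_alg_def pres_class_def FactRing_def A_RCOSETS_def')

lemma ring_pres_alg: "ring (pres_alg X S)"
  unfolding pres_alg_def by (rule rel.quotient_is_ring)

lemma pres_class_zero_iff:
  "f \<in> poly_in X \<Longrightarrow> pres_class X S f = \<zero>\<^bsub>pres_alg X S\<^esub> \<longleftrightarrow> f \<in> rel_ideal X S"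
  using pres_class_eq_iff[of f 0] rel.a_rcos_const[OF rel.zero_closed]
  by (simp add: pres_class_def pres_alg_def FactRing_def)

end

section \<open>Homomorphisms and isomorphisms out of a presentation\<close>

text \<open>The first isomorphism theorem together with the values on cosets, since the isomorphism
  sought must have prescribed values.\<close>

lemma (in ring_hom_ring) quotient_iso:
  assumes "a_kernel R S h = I" "h ` carrier R = carrier S"
  shows "(\<lambda>C. the_elem (h ` C)) \<in> ring_iso (R Quot I) S"
    and "x \<in> carrier R \<Longrightarrow> the_elem (h ` (I +> x)) = h x"
  using FactRing_iso_set[OF assms(2)] the_elem_simp assms(1) by auto

context
  fixes X :: "'x set" and S :: "(('x, 'r::comm_ring_1) ncpoly \<times> ('x, 'r) ncpoly) set"
    and Y :: "'y set" and T :: "(('y, 'r) ncpoly \<times> ('y, 'r) ncpoly) set"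
    and v :: "'x \<Rightarrow> ('y, 'r) ncpoly"
  assumes S: "presentation X S" and T: "presentation Y T"
    and v: "\<forall>x\<in>X. v x \<in> poly_in Y"
begin

interpretation S: presentation X S by (rule S)
interpretation T: presentation Y T by (rule T)

lemma subst_in: "f \<in> poly_in X \<Longrightarrow> subst v f \<in> poly_in Y"
  by (rule poly_in_subst[OF _ v])

lemma subst_class_hom:
  "ring_hom_ring (free_alg X) (pres_alg Y T) (\<lambda>f. pres_class Y T (subst v f))"
  by (rule ring_hom_ringI[OF ring_free_alg T.ring_pres_alg])
    (simp_all add: subst_in T.pres_class_in T.pres_class_mult T.pres_class_add T.pres_class_1)

text \<open>The kernel is an ideal, so it suffices that it contains the differences generating
  \<open>rel_ideal\<close>.\<close>

lemma rel_ideal_subset_kernel: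
  assumes rel: "\<forall>(a, b)\<in>S. pres_class Y T (subst v a) = pres_class Y T (subst v b)"
  shows "rel_ideal X S \<subseteq> a_kernel (free_alg X) (pres_alg Y T) (\<lambda>f. pres_class Y T (subst v f))"
    (is "_ \<subseteq> ?K")
proof -
  have "a - b \<in> ?K" if ab: "(a, b) \<in> S" for a b
  proof -
    have in_X: "a \<in> poly_in X" "b \<in> poly_in X" using S.rels_in ab by auto
    have "subst v a - subst v b \<in> rel_ideal Y T"
      using rel ab T.pres_class_eq_iff[OF subst_in[OF in_X(1)] subst_in[OF in_X(2)]] by auto
    then have "pres_class Y T (subst v (a - b)) = \<zero>\<^bsub>pres_alg Y T\<^esub>"
      using T.pres_class_zero_iff[OF subst_in[OF poly_in_diff[OF in_X]]] by simp
    with in_X show ?thesis by (simp add: a_kernel_def')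
  qed
  then have "(\<lambda>(a, b). a - b) ` S \<subseteq> ?K" by auto
  then show ?thesis
    unfolding rel_ideal_def by (rule S.free.genideal_minimal[OF ring_hom_ring.kernel_is_ideal[OF subst_class_hom]])
qed

text \<open>Agreement with the identity on generators extends to words by multiplicativity and to
  polynomials by linearity; both are carried out after applying \<open>proj\<close>.\<close>

lemma subst_class_inverse:
  assumes v': "\<forall>y\<in>Y. v' y \<in> poly_in X"
    and inv: "\<forall>x\<in>X. pres_class X S (subst v' (v x)) = pres_class X S (gen x)"
    and f: "f \<in> poly_in X"
  shows "pres_class X S (subst v' (subst v f)) = pres_class X S f"
proof -
  let ?p = "proj (full_ideal X S)"
  have gen: "?p (subst v' (v x)) = ?p (gen x)" if "x \<in> X" for x
    using inv that v S.pres_class_eq_proj[OF poly_in_subst[OF _ v'] poly_in_gen]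
    by blast
  have "?p (subst v' (prod_list (map v xs))) = ?p (prod_list (map gen xs))"
    if "set xs \<subseteq> X" for xs
    using that by (induction xs) (simp_all add: gen)
  moreover have "set (letters u) \<subseteq> X" if "u \<in> Poly_Mapping.keys f" for u
    using f that by (simp add: free_alg_def)
  ultimately have words: "?p (subst v' (prod_list (map v (letters u))))
      = ?p (prod_list (map gen (letters u)))" if "u \<in> Poly_Mapping.keys f" for u
    using that by blast
  have "?p (subst v' (subst v f)) = ?p (\<Sum>u\<in>Poly_Mapping.keys f.
      scal (Poly_Mapping.lookup f u) * prod_list (map gen (letters u)))"
    unfolding subst_def[of v f] subst_sum proj_sum
    by (rule sum.cong) (simp_all only: subst_mult subst_scal proj_mult words)
  then have "?p (subst v' (subst v f)) = ?p f"
    by (simp only: ncpoly_eq_sum[of f, symmetric])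
  then show ?thesis
    using S.pres_class_eq_proj[OF poly_in_subst[OF subst_in[OF f] v'] f] by blast
qed

end

text \<open>An element killed after \<open>v\<close> is also killed when \<open>v'\<close> is
  applied next; by \<open>inv\<close> that composite fixes its class, so the kernel is exactly the
  relation ideal. The other composite gives surjectivity.\<close>

lemma pres_alg_iso_subst:
  fixes X :: "'x set" and S :: "(('x, 'r::comm_ring_1) ncpoly \<times> ('x, 'r) ncpoly) set"
    and Y :: "'y set" and T :: "(('y, 'r) ncpoly \<times> ('y, 'r) ncpoly) set"
  assumes S: "presentation X S" and T: "presentation Y T"
    and v: "\<forall>x\<in>X. v x \<in> poly_in Y" and v': "\<forall>y\<in>Y. v' y \<in> poly_in X"
    and rel: "\<forall>(a, b)\<in>S. pres_class Y T (subst v a) = pres_class Y T (subst v b)"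
    and rel': "\<forall>(a, b)\<in>T. pres_class X S (subst v' a) = pres_class X S (subst v' b)"
    and inv: "\<forall>x\<in>X. pres_class X S (subst v' (v x)) = pres_class X S (gen x)"
    and inv': "\<forall>y\<in>Y. pres_class Y T (subst v (v' y)) = pres_class Y T (gen y)"
  shows "\<exists>\<phi>\<in>pres_alg_iso X S Y T. \<forall>f\<in>poly_in X. \<phi> (pres_class X S f) = pres_class Y T (subst v f)"
proof -
  interpret S: presentation X S by fact
  interpret T: presentation Y T by fact
  let ?h = "\<lambda>f. pres_class Y T (subst v f)"
  note hom = subst_class_hom[OF S T v]
  have ker: "a_kernel (free_alg X) (pres_alg Y T) ?h = rel_ideal X S"
  proof (intro equalityI subsetI)
    fix f assume "f \<in> a_kernel (free_alg X) (pres_alg Y T) ?h"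
    then have f: "f \<in> poly_in X" "pres_class Y T (subst v f) = \<zero>\<^bsub>pres_alg Y T\<^esub>"
      by (simp_all add: a_kernel_def')
    then have "subst v f \<in> rel_ideal Y T"
      using T.pres_class_zero_iff[OF poly_in_subst[OF f(1) v]] f(2) by simp
    then have "pres_class X S (subst v' (subst v f)) = \<zero>\<^bsub>pres_alg X S\<^esub>"
      using subsetD[OF rel_ideal_subset_kernel[OF T S v' rel']] by (simp add: a_kernel_def')
    with f subst_class_inverse[OF S T v v' inv f(1)] show "f \<in> rel_ideal X S"
      using S.pres_class_zero_iff[OF f(1)] by simp
  next
    show "f \<in> a_kernel (free_alg X) (pres_alg Y T) ?h" if "f \<in> rel_ideal X S" for f
      by (rule subsetD[OF rel_ideal_subset_kernel[OF S T v rel] that])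
  qed
  have surj: "?h ` poly_in X = carrier (pres_alg Y T)"
  proof (intro equalityI subsetI)
    fix c assume "c \<in> carrier (pres_alg Y T)"
    then obtain g where "g \<in> poly_in Y" "c = pres_class Y T g" by (rule T.pres_algE)
    then have "c = ?h (subst v' g)"
      using subst_class_inverse[OF T S v' v inv' \<open>g \<in> poly_in Y\<close>] \<open>c = _\<close> by simp
    moreover have "subst v' g \<in> poly_in X"
      using \<open>g \<in> poly_in Y\<close> v' by (rule poly_in_subst)
    ultimately show "c \<in> ?h ` poly_in X" by (rule image_eqI)
  next
    show "c \<in> carrier (pres_alg Y T)" if "c \<in> ?h ` poly_in X" for c
    proof -
      from that obtain f where "c = ?h f" "f \<in> poly_in X" by (rule imageE)
      then show ?thesis using T.pres_class_in[OF subst_in[OF S T v]] by simp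
    qed
  qed
  note iso = ring_hom_ring.quotient_iso[OF hom ker surj, folded pres_alg_def pres_class_def]
  show ?thesis
  proof (rule bexI)
    show "\<forall>f\<in>poly_in X. the_elem (?h ` pres_class X S f) = ?h f"
      by (rule ballI) (rule iso(2))
    show "(\<lambda>C. the_elem (?h ` C)) \<in> pres_alg_iso X S Y T"
      unfolding pres_alg_iso_def mem_Collect_eq
      using iso(1) iso(2)[OF poly_in_scal] unfolding subst_scal by (rule conjI[OF _ allI])
  qed
qed

section \<open>The group of monomial matrices\<close>

text \<open>The product of the permutation matrix of \<open>w\<close> and the diagonal matrix of
  \<open>d\<close>. The scalar belongs to the source index, which is why \<open>d (w' b)\<close>
  appears in products.\<close>

definition mono_mat :: "nat \<Rightarrow> (nat \<Rightarrow> nat) \<Rightarrow> (nat \<Rightarrow> 'k) \<Rightarrow> 'k::field mat"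
  where "mono_mat n w d = mat n n (\<lambda>(a, b). if a + 1 = w (b + 1) then d (b + 1) else 0)"

lemma mono_mat_carrier [simp]: "mono_mat n w d \<in> carrier_mat n n"
  by (simp add: mono_mat_def)

lemma mono_mat_index:
  "a < n \<Longrightarrow> b < n \<Longrightarrow> mono_mat n w d $$ (a, b) = (if a + 1 = w (b + 1) then d (b + 1) else 0)"
  by (simp add: mono_mat_def)

lemma mono_mat_cong:
  assumes "\<And>b. b \<in> {1..n} \<Longrightarrow> w b = w' b" "\<And>b. b \<in> {1..n} \<Longrightarrow> d b = d' b"
  shows "mono_mat n w d = mono_mat n w' d'"
  by (rule eq_matI) (use assms in \<open>auto simp: mono_mat_def\<close>)

lemma mono_mat_one: "mono_mat n id (\<lambda>_. 1) = 1\<^sub>m n"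
  by (rule eq_matI) (auto simp: mono_mat_def)

lemma mono_mat_mult:
  assumes "w' permutes {1..n}"
  shows "mono_mat n w d * mono_mat n w' d' = mono_mat n (w \<circ> w') (\<lambda>b. d (w' b) * d' b)"
proof (rule eq_matI)
  fix a b assume "a < dim_row (mono_mat n (w \<circ> w') (\<lambda>b. d (w' b) * d' b))"
    "b < dim_col (mono_mat n (w \<circ> w') (\<lambda>b. d (w' b) * d' b))"
  then have ab: "a < n" "b < n" by (auto simp: mono_mat_def)
  let ?c = "w' (b + 1) - 1"
  have "w' (b + 1) \<in> {1..n}" using permutes_in_image[OF assms] ab by simp
  then have c: "?c < n" "\<And>c. c + 1 = w' (b + 1) \<longleftrightarrow> c = ?c" by auto
  have "(mono_mat n w d * mono_mat n w' d') $$ (a, b)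
      = (\<Sum>c<n. mono_mat n w d $$ (a, c) * mono_mat n w' d' $$ (c, b))"
    using ab by (simp add: mono_mat_def scalar_prod_def lessThan_atLeast0)
  also have "\<dots> = (\<Sum>c<n. if c = ?c then mono_mat n w d $$ (a, ?c) * d' (b + 1) else 0)"
    using ab c by (intro sum.cong) (auto simp: mono_mat_index)
  also have "\<dots> = mono_mat n (w \<circ> w') (\<lambda>b. d (w' b) * d' b) $$ (a, b)"
    using ab c \<open>w' (b + 1) \<in> {1..n}\<close> by (simp add: mono_mat_index)
  finally show "(mono_mat n w d * mono_mat n w' d') $$ (a, b)
      = mono_mat n (w \<circ> w') (\<lambda>b. d (w' b) * d' b) $$ (a, b)" .
qed (auto simp: mono_mat_def)

lemma monomial_group_simps [simp]:
  "x \<otimes>\<^bsub>monomial_group n l\<^esub> y = x * y" "\<one>\<^bsub>monomial_group n l\<^esub> = 1\<^sub>m n"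
  by (simp_all add: monomial_group_def)

lemma root_of_unity_nonzero: "x ^ l = 1 \<Longrightarrow> l \<ge> 1 \<Longrightarrow> (x :: 'k::field) \<noteq> 0"
  by (cases l) auto

lemma mono_mat_in:
  assumes w: "w permutes {1..n}" and d: "\<forall>b\<in>{1..n}. d b ^ l = 1" and "l \<ge> 1"
  shows "mono_mat n w d \<in> carrier (monomial_group n l)"
proof -
  have nz: "d b \<noteq> 0" if "b \<in> {1..n}" for b using that d \<open>l \<ge> 1\<close> by (metis root_of_unity_nonzero)
  have entry: "mono_mat n w d $$ (a, b) \<noteq> 0 \<longleftrightarrow> a + 1 = w (b + 1)" if "a < n" "b < n" for a b
    using that nz[of "b + 1"] by (simp add: mono_mat_index)
  have w_in: "w b \<in> {1..n} \<longleftrightarrow> b \<in> {1..n}" for b using permutes_in_image[OF w] .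
  have 1: "\<exists>!b. b < n \<and> mono_mat n w d $$ (a, b) \<noteq> 0" if a: "a < n" for a
  proof -
    obtain b where b: "w b = a + 1" using permutes_surj[OF w] by (metis surjD)
    with a w_in[of b] have "b \<in> {1..n}" by simp
    then have b': "b - 1 < n" "b - 1 + 1 = b" by auto
    show ?thesis
    proof (rule ex1I)
      show "b - 1 < n \<and> mono_mat n w d $$ (a, b - 1) \<noteq> 0"
        using entry[OF a b'(1)] b b' by simp
    next
      fix c assume c: "c < n \<and> mono_mat n w d $$ (a, c) \<noteq> 0"
      have "w (c + 1) = w b" using entry[OF a conjunct1[OF c]] c b by simp
      then have "c + 1 = b" by (simp only: inj_eq[OF permutes_inj[OF w]])
      then show "c = b - 1" by simp
    qed
  qed
  have 2: "\<exists>!a. a < n \<and> mono_mat n w d $$ (a, b) \<noteq> 0" if b: "b < n" for b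
  proof (rule ex1I)
    have "w (b + 1) \<in> {1..n}" using w_in[of "b + 1"] b by simp
    then have b': "w (b + 1) - 1 < n" "w (b + 1) - 1 + 1 = w (b + 1)" by auto
    then show "w (b + 1) - 1 < n \<and> mono_mat n w d $$ (w (b + 1) - 1, b) \<noteq> 0"
      using entry[OF b'(1) b] by simp
    show "a = w (b + 1) - 1" if "a < n \<and> mono_mat n w d $$ (a, b) \<noteq> 0" for a
      using that entry[OF _ b, of a] by simp
  qed
  have 3: "mono_mat n w d $$ (a, b) ^ l = 1"
    if "a < n" "b < n" "mono_mat n w d $$ (a, b) \<noteq> 0" for a b
    using that entry[OF that(1,2)] bspec[OF d, of "b + 1"] by (simp add: mono_mat_index)
  show ?thesis
    unfolding monomial_group_def using 1 2 3 by simp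
qed

text \<open>The nonzero row of each column defines \<open>w\<close>. Uniqueness of the nonzero entry
  in each row makes \<open>w\<close> injective, hence bijective on a finite set.\<close>

lemma mono_matE:
  assumes "g \<in> carrier (monomial_group n l)"
  obtains w d where "w permutes {1..n}" "\<forall>b\<in>{1..n}. d b ^ l = 1" "g = mono_mat n w d"
proof -
  have g: "g \<in> carrier_mat n n"
    and col: "\<And>a. a < n \<Longrightarrow> \<exists>!b. b < n \<and> g $$ (a, b) \<noteq> 0"
    and row: "\<And>b. b < n \<Longrightarrow> \<exists>!a. a < n \<and> g $$ (a, b) \<noteq> 0"
    and root: "\<And>a b. a < n \<Longrightarrow> b < n \<Longrightarrow> g $$ (a, b) \<noteq> 0 \<Longrightarrow> g $$ (a, b) ^ l = 1"
    using assms by (auto simp: monomial_group_def)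
  define r where "r b = (THE a. a < n \<and> g $$ (a, b) \<noteq> 0)" for b
  have r: "r b < n" "g $$ (r b, b) \<noteq> 0" if "b < n" for b
    using theI'[OF row[OF that]] by (auto simp: r_def)
  have r_eq: "a = r b" if "a < n" "b < n" "g $$ (a, b) \<noteq> 0" for a b
    using row[OF that(2)] r[OF that(2)] that by blast
  \<comment> \<open>Matrix indices start at 0, hence the shifts by 1; outside \<open>{1..n}\<close>
    the map is the identity, as \<open>permutes\<close> demands.\<close>
  define w where "w b = (if b \<in> {1..n} then r (b - 1) + 1 else b)" for b
  define d where "d b = g $$ (r (b - 1), b - 1)" for b
  have inj: "inj_on w {1..n}"
  proof (rule inj_onI)
    fix b b' assume b: "b \<in> {1..n}" "b' \<in> {1..n}" "w b = w b'"
    then have "b - 1 < n" "b' - 1 < n" "r (b - 1) = r (b' - 1)" by (auto simp: w_def)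
    moreover from this have "g $$ (r (b - 1), b - 1) \<noteq> 0" "g $$ (r (b - 1), b' - 1) \<noteq> 0"
      using r(2)[of "b - 1"] r(2)[of "b' - 1"] by simp_all
    ultimately have "b - 1 = b' - 1" using col[OF r(1)[of "b - 1"]] by blast
    with b show "b = b'" by auto
  qed
  moreover have "w ` {1..n} \<subseteq> {1..n}"
  proof
    fix x assume "x \<in> w ` {1..n}"
    then obtain b where "b \<in> {1..n}" "x = r (b - 1) + 1" by (auto simp: w_def)
    moreover from this have "b - 1 < n" by auto
    ultimately show "x \<in> {1..n}" using r(1)[of "b - 1"] by simp
  qed
  ultimately have "bij_betw w {1..n} {1..n}"
    by (simp add: bij_betw_def endo_inj_surj)
  then have "w permutes {1..n}"
    by (rule bij_imp_permutes) (auto simp: w_def)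
  moreover have "\<forall>b\<in>{1..n}. d b ^ l = 1"
  proof
    fix b assume "b \<in> {1..n}"
    then have b: "b - 1 < n" by auto
    show "d b ^ l = 1" unfolding d_def by (rule root[OF r(1)[OF b] b r(2)[OF b]])
  qed
  moreover have "g = mono_mat n w d"
  proof (rule eq_matI)
    fix a b assume "a < dim_row (mono_mat n w d)" "b < dim_col (mono_mat n w d)"
    then have "a < n" "b < n" by (auto simp: mono_mat_def)
    then show "g $$ (a, b) = mono_mat n w d $$ (a, b)"
      using r_eq[of a b] by (auto simp: mono_mat_index w_def d_def)
  qed (use g in \<open>auto simp: mono_mat_def\<close>)
  ultimately show ?thesis by (rule that)
qed

lemma mono_mat_inverse:
  assumes w: "w permutes {1..n}" and d: "\<forall>b\<in>{1..n}. d b ^ l = 1" and "l \<ge> 1"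
  shows "mono_mat n (Hilbert_Choice.inv w) (\<lambda>b. inverse (d (Hilbert_Choice.inv w b))) * mono_mat n w d = 1\<^sub>m n"
proof -
  have "inverse (d (Hilbert_Choice.inv w (w b))) * d b = 1" if "b \<in> {1..n}" for b
    using that d \<open>l \<ge> 1\<close> root_of_unity_nonzero[of "d b" l] by (simp add: permutes_inverses[OF w])
  then have "mono_mat n (Hilbert_Choice.inv w) (\<lambda>b. inverse (d (Hilbert_Choice.inv w b))) * mono_mat n w d = mono_mat n id (\<lambda>_. 1)"
    unfolding mono_mat_mult[OF w]
    by (intro mono_mat_cong) (simp_all add: permutes_inverses[OF w])
  then show ?thesis by (simp add: mono_mat_one)
qed

lemma group_monomial_group:
  assumes "l \<ge> 1"
  shows "group (monomial_group n l :: 'k::field mat monoid)"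
proof (rule groupI)
  fix x y z :: "'k mat"
  assume "x \<in> carrier (monomial_group n l)" "y \<in> carrier (monomial_group n l)"
    "z \<in> carrier (monomial_group n l)"
  then show "x \<otimes>\<^bsub>monomial_group n l\<^esub> y \<otimes>\<^bsub>monomial_group n l\<^esub> z
      = x \<otimes>\<^bsub>monomial_group n l\<^esub> (y \<otimes>\<^bsub>monomial_group n l\<^esub> z)"
    using assoc_mult_mat[of x n n y n z n] by (simp add: monomial_group_def)
next
  fix x y :: "'k mat"
  assume "x \<in> carrier (monomial_group n l)" "y \<in> carrier (monomial_group n l)"
  then obtain w d w' d' where w: "w permutes {1..n}" "\<forall>b\<in>{1..n}. d b ^ l = 1" "x = mono_mat n w d"
      and w': "w' permutes {1..n}" "\<forall>b\<in>{1..n}. d' b ^ l = 1" "y = mono_mat n w' d'"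
    by (elim mono_matE)
  have "w' b \<in> {1..n}" if "b \<in> {1..n}" for b
    using that permutes_in_image[OF w'(1)] by blast
  then show "x \<otimes>\<^bsub>monomial_group n l\<^esub> y \<in> carrier (monomial_group n l)"
    using w w' assms
    by (simp add: mono_mat_mult mono_mat_in permutes_compose power_mult_distrib)
next
  show "\<one>\<^bsub>monomial_group n l\<^esub> \<in> carrier (monomial_group n l :: 'k mat monoid)"
    using mono_mat_in[of id n "\<lambda>_. 1" l] assms by (simp add: mono_mat_one permutes_id)
next
  fix x assume "x \<in> carrier (monomial_group n l :: 'k mat monoid)"
  then show "\<one>\<^bsub>monomial_group n l\<^esub> \<otimes>\<^bsub>monomial_group n l\<^esub> x = x"
    by (auto simp: monomial_group_def)
next
  fix x assume "x \<in> carrier (monomial_group n l :: 'k mat monoid)"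
  then obtain w d where w: "w permutes {1..n}" "\<forall>b\<in>{1..n}. d b ^ l = 1" "x = mono_mat n w d"
    by (rule mono_matE)
  have "\<forall>b\<in>{1..n}. inverse (d (Hilbert_Choice.inv w b)) ^ l = 1"
    using w(2) permutes_in_image[OF permutes_inv[OF w(1)]] by (simp add: power_inverse)
  then have "mono_mat n (Hilbert_Choice.inv w) (\<lambda>b. inverse (d (Hilbert_Choice.inv w b))) \<in> carrier (monomial_group n l)"
    using w assms by (intro mono_mat_in permutes_inv)
  with mono_mat_inverse[OF w(1,2) assms] w(3)
  show "\<exists>y\<in>carrier (monomial_group n l). y \<otimes>\<^bsub>monomial_group n l\<^esub> x = \<one>\<^bsub>monomial_group n l\<^esub>"
    by auto
qed

section \<open>Permutation matrices and the diagonal generators\<close>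

lemma perm_mat_eq: "perm_mat n w = mono_mat n w (\<lambda>_. 1)"
  by (simp add: perm_mat_def mono_mat_def)

lemma t_mat_eq: "t_mat n \<zeta> j = mono_mat n id (\<lambda>b. if b = j then \<zeta> else 1)"
  by (rule eq_matI) (auto simp: t_mat_def mono_mat_def)

lemma perm_mat_in: "l \<ge> 1 \<Longrightarrow> w permutes {1..n} \<Longrightarrow> perm_mat n w \<in> carrier (monomial_group n l)"
  by (simp add: perm_mat_eq mono_mat_in)

lemma t_mat_in: "l \<ge> 1 \<Longrightarrow> \<zeta> ^ l = 1 \<Longrightarrow> t_mat n \<zeta> j \<in> carrier (monomial_group n l)"
  by (simp add: t_mat_eq mono_mat_in permutes_id)

lemma perm_mat_mult:
  "w' permutes {1..n} \<Longrightarrow> perm_mat n w * perm_mat n w' = perm_mat n (w \<circ> w')"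
  by (simp add: perm_mat_eq mono_mat_mult)

lemma perm_mat_id: "perm_mat n id = 1\<^sub>m n"
  by (simp add: perm_mat_eq mono_mat_one)

lemma perm_mat_t_mat:
  assumes "w permutes {1..n}"
  shows "perm_mat n w * t_mat n \<zeta> j = t_mat n \<zeta> (w j) * perm_mat n w"
  using assms inj_eq[OF permutes_inj[OF assms]]
  by (simp add: perm_mat_eq t_mat_eq mono_mat_mult permutes_id)

lemma t_mat_commute: "t_mat n \<zeta> i * t_mat n \<zeta> j = t_mat n \<zeta> j * t_mat n \<zeta> i"
  by (simp add: t_mat_eq mono_mat_mult permutes_id mult.commute)

lemma t_mat_pow:
  "t_mat n \<zeta> j [^]\<^bsub>monomial_group n l\<^esub> (a::nat) = mono_mat n id (\<lambda>b. if b = j then \<zeta> ^ a else 1)"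
proof (induction a)
  case 0
  show ?case by (auto simp: nat_pow_def simp flip: mono_mat_one intro: mono_mat_cong)
next
  case (Suc a)
  then show ?case
    by (simp add: nat_pow_def t_mat_eq mono_mat_mult permutes_id mult.commute) (auto intro: mono_mat_cong)
qed

lemma t_mat_pow_l: "\<zeta> ^ l = 1 \<Longrightarrow> t_mat n \<zeta> j [^]\<^bsub>monomial_group n l\<^esub> l = 1\<^sub>m n"
  by (auto simp: t_mat_pow simp flip: mono_mat_one intro: mono_mat_cong)

text \<open>Natural powers replace the negative one because \<open>proj\<close> turns group elements
  into elements that are invertible only relative to \<open>sc 1\<close>, not in the ambient
  ring.\<close>

lemma tt_mat_eq:
  assumes "l \<ge> 1" "\<zeta> ^ l = 1" "a \<le> l"
  shows "tt_mat n l \<zeta> i j a = t_mat n \<zeta> i [^]\<^bsub>monomial_group n l\<^esub> a * t_mat n \<zeta> j [^]\<^bsub>monomial_group n l\<^esub> (l - a)"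
proof -
  interpret G: group "monomial_group n l" using assms(1) by (rule group_monomial_group)
  have t: "t_mat n \<zeta> j \<in> carrier (monomial_group n l)" using assms by (rule_tac t_mat_in)
  have "inv\<^bsub>monomial_group n l\<^esub> (t_mat n \<zeta> j [^]\<^bsub>monomial_group n l\<^esub> a) = t_mat n \<zeta> j [^]\<^bsub>monomial_group n l\<^esub> (l - a)"
  proof (rule G.inv_equality)
    show "t_mat n \<zeta> j [^]\<^bsub>monomial_group n l\<^esub> (l - a) \<otimes>\<^bsub>monomial_group n l\<^esub> t_mat n \<zeta> j [^]\<^bsub>monomial_group n l\<^esub> a
        = \<one>\<^bsub>monomial_group n l\<^esub>"
      using assms t by (simp only: G.nat_pow_mult) (simp add: t_mat_pow_l)
  qed (use t in simp_all)
  then show ?thesis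
    unfolding tt_mat_def using t by (simp add: G.int_pow_neg_int int_pow_int)
qed

lemma inv_perm_mat:
  assumes "l \<ge> 1" "w permutes {1..n}"
  shows "inv\<^bsub>monomial_group n l\<^esub> (perm_mat n w) = (perm_mat n (Hilbert_Choice.inv w) :: 'k::field mat)"
proof -
  interpret G: group "monomial_group n l :: 'k mat monoid" using assms(1) by (rule group_monomial_group)
  show ?thesis
    using assms permutes_inv_o[OF assms(2)]
    by (intro G.inv_equality) (simp_all add: perm_mat_in perm_mat_mult perm_mat_id permutes_inv)
qed

section \<open>Cycles and the group algebra\<close>

text \<open>Lets a rule for a product of two factors act inside a right-nested product.\<close>

lemma mult_left_assoc: "a * b = c \<Longrightarrow> a * (b * z) = c * z" for a b c :: "'a::semigroup_mult"
  by (simp flip: mult.assoc)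

lemma comp_transpose: "inj w \<Longrightarrow> w \<circ> transpose i j = transpose (w i) (w j) \<circ> w"
  by (auto simp: fun_eq_iff transpose_def inj_eq)

lemma transpose_permutes: "i \<in> A \<Longrightarrow> j \<in> A \<Longrightarrow> transpose i j permutes A"
  by (rule permutes_swap_id)

lemma intertwine_power:
  fixes a :: "'a::monoid_mult"
  assumes "a * v = v' * a"
  shows "a * v ^ s = v' ^ s * a"
proof (induction s)
  case (Suc s)
  have "a * v ^ Suc s = v' * (a * v ^ s)"
    using assms by (simp flip: mult.assoc)
  also have "\<dots> = v' ^ Suc s * a" by (simp add: Suc mult.assoc)
  finally show ?case .
qed simp

lemma upsilon_cycle_n: "upsilon_cycle n n = id"
  by (simp add: upsilon_cycle_def)

lemma upsilon_cycle_rec: "i < n \<Longrightarrow> upsilon_cycle n i = transpose i (i + 1) \<circ> upsilon_cycle n (i + 1)"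
  by (simp add: upsilon_cycle_def upt_conv_Cons del: upt_Suc)

lemma chi_cycle_1: "chi_cycle 1 = id"
  by (simp add: chi_cycle_def)

lemma chi_cycle_rec: "i \<ge> 1 \<Longrightarrow> chi_cycle (i + 1) = transpose i (i + 1) \<circ> chi_cycle i"
  by (cases i) (simp_all add: chi_cycle_def transpose_commute)

lemma upsilon_cycle_apply:
  assumes "i \<le> n"
  shows "upsilon_cycle n i m = (if m < i \<or> n < m then m else if m = n then i else m + 1)"
  using assms
proof (induction i arbitrary: m rule: inc_induct)
  case base
  then show ?case by (simp add: upsilon_cycle_n)
next
  case (step i)
  then show ?case by (auto simp: upsilon_cycle_rec transpose_def)
qed

lemma upsilon_cycle_permutes: "i \<ge> 1 \<Longrightarrow> upsilon_cycle n i permutes {1..n}"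
  unfolding upsilon_cycle_def by (rule permutes_subset[OF cycle_permutes]) auto

lemma chi_cycle_permutes: "i \<le> n \<Longrightarrow> chi_cycle i permutes {1..n}"
  unfolding chi_cycle_def by (rule permutes_subset[OF cycle_permutes]) auto

text \<open>Since \<open>chi_cycle (i + 1)\<close> is r_i times \<open>chi_cycle i\<close> and
  \<open>upsilon_cycle n i\<close> is r_i times \<open>upsilon_cycle n (i + 1)\<close>, the
  involution r_i carries the case i to the case i + 1. This identity turns \<chi>_i \<sigma>
  \<upsilon>_i^{-1} into the conjugate of \<sigma> \<omega>^{-1} by \<chi>_i.\<close>

lemma chi_upsilon:
  assumes "i \<ge> 1" "i \<le> n"
  shows "chi_cycle i \<circ> upsilon_cycle n 1 = upsilon_cycle n i"
  using assms
proof (induction i rule: dec_induct)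
  case base
  show ?case by (simp only: chi_cycle_1 id_comp)
next
  case (step i)
  then have "chi_cycle i \<circ> upsilon_cycle n 1 = upsilon_cycle n i" by (intro step.IH) simp
  also have "\<dots> = transpose i (i + 1) \<circ> upsilon_cycle n (i + 1)"
    using step by (intro upsilon_cycle_rec) simp
  finally have "transpose i (i + 1) \<circ> (chi_cycle i \<circ> upsilon_cycle n 1) = upsilon_cycle n (i + 1)"
    by (simp add: fun_eq_iff)
  then show ?case
    using chi_cycle_rec[OF step.hyps(1)] by (simp only: comp_assoc Suc_eq_plus1)
qed

text \<open>The image of R[\<Gamma>] in some ring, recorded through its scalars, permutations and
  diagonal generators. Both algebras are instances, so the calculus of reflections is developed
  once.\<close>

locale wreath =
  fixes n l :: nat and \<zeta> :: "'k::field" and k :: "'k poly" and h :: "nat \<Rightarrow> 'k poly"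
    and sc :: "'k poly \<Rightarrow> 'b::ring_1" and W :: "(nat \<Rightarrow> nat) \<Rightarrow> 'b" and T :: "nat \<Rightarrow> 'b"
  assumes n_pos: "n \<ge> 1" and l_pos: "l \<ge> 1" and zeta: "\<zeta> ^ l = 1"
    and sc_add: "sc (c + d) = sc c + sc d" and sc_mult: "sc (c * d) = sc c * sc d"
    and W_id: "W id = sc 1"
    and W_comp: "w permutes {1..n} \<Longrightarrow> w' permutes {1..n} \<Longrightarrow> W w * W w' = W (w \<circ> w')"
    and W_T: "w permutes {1..n} \<Longrightarrow> i \<in> {1..n} \<Longrightarrow> W w * T i = T (w i) * W w"
    and T_comm: "i \<in> {1..n} \<Longrightarrow> j \<in> {1..n} \<Longrightarrow> T i * T j = T j * T i"
    and T_pow_l: "i \<in> {1..n} \<Longrightarrow> T i ^ l = sc 1"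
    and sc_W: "w permutes {1..n} \<Longrightarrow> sc c * W w = W w * sc c"
    and sc_T: "i \<in> {1..n} \<Longrightarrow> sc c * T i = T i * sc c"
    and sc_1_T: "i \<in> {1..n} \<Longrightarrow> sc 1 * T i = T i"
begin

text \<open>The unit \<open>sc 1\<close> of the algebra may differ from the unit of the ambient ring.\<close>

definition alg :: "'b \<Rightarrow> bool"
  where "alg a \<longleftrightarrow> sc 1 * a = a \<and> (\<forall>c. sc c * a = a * sc c)"

lemma alg_unit: "alg a \<Longrightarrow> sc 1 * a = a" "alg a \<Longrightarrow> a * sc 1 = a"
  by (metis alg_def)+

lemma alg_comm: "alg a \<Longrightarrow> sc c * a = a * sc c"
  by (simp add: alg_def)

lemma sc_left: "alg a \<Longrightarrow> a * (sc c * z) = sc c * (a * z)"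
  by (simp add: alg_comm flip: mult.assoc)

lemma alg_mult [simp]:
  assumes "alg a" "alg b"
  shows "alg (a * b)"
proof -
  have "sc 1 * (a * b) = a * b" using assms(1) by (simp add: alg_unit flip: mult.assoc)
  moreover have "sc c * (a * b) = a * b * sc c" for c
    by (simp add: sc_left[OF assms(1), symmetric] alg_comm[OF assms(2)] mult.assoc)
  ultimately show ?thesis by (simp add: alg_def)
qed

lemma alg_add [simp]: "alg a \<Longrightarrow> alg b \<Longrightarrow> alg (a + b)"
  unfolding alg_def by (metis distrib_left distrib_right)

lemma alg_diff [simp]: "alg a \<Longrightarrow> alg b \<Longrightarrow> alg (a - b)"
  unfolding alg_def by (metis left_diff_distrib right_diff_distrib)

lemma alg_0 [simp]: "alg 0"
  by (simp add: alg_def)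

lemma alg_sum [simp]: "(\<And>x. x \<in> A \<Longrightarrow> alg (f x)) \<Longrightarrow> alg (sum f A)"
  by (induction A rule: infinite_finite_induct) auto

lemma alg_sc [simp]: "alg (sc c)"
  by (simp add: alg_def mult.commute flip: sc_mult)

lemma alg_W [simp]: "w permutes {1..n} \<Longrightarrow> alg (W w)"
  using W_comp[of id w] by (simp add: alg_def sc_W W_id permutes_id)

lemma alg_T [simp]: "i \<in> {1..n} \<Longrightarrow> alg (T i)"
  unfolding alg_def using sc_T sc_1_T by blast

lemma alg_power [simp]: "alg a \<Longrightarrow> m \<ge> 1 \<Longrightarrow> alg (a ^ m)"
proof (induction m)
  case (Suc m)
  then show ?case by (cases "m = 0") auto
qed simp

lemma sc_0 [simp]: "sc 0 = 0"
  using sc_add[of 0 0] by simp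

text \<open>For \<open>a = 0\<close> the first factor is the ambient unit instead of
  \<open>sc 1\<close>; this is harmless because \<open>a < l\<close> leaves a positive power of
  \<open>T j\<close>.\<close>

lemma T_mixed_alg [simp]:
  assumes "i \<in> {1..n}" "j \<in> {1..n}" "a < l"
  shows "alg (T i ^ a * T j ^ (l - a))"
  using assms by (cases "a = 0") auto

lemma T_mixed_comm:
  assumes "i \<in> {1..n}" "j \<in> {1..n}"
  shows "T i ^ a * T j ^ b = T j ^ b * T i ^ a"
  by (rule intertwine_power, rule intertwine_power[symmetric], rule T_comm[symmetric]) (use assms in auto)

text \<open>Since \<open>T j ^ l\<close> is the unit, the power \<open>T j ^ (l - a)\<close> stands for \<open>T j\<close> to the power \<open>- a\<close>;
  thus \<open>Pi i j\<close> is \<open>l\<close> times the paper's \<open>\<pi>\<close>, and \<open>Pz\<close> is its variant twisted by powers of \<open>\<zeta>\<close>.\<close>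

definition Pi :: "nat \<Rightarrow> nat \<Rightarrow> 'b"
  where "Pi i j = (\<Sum>a=0..l-1. T i ^ a * T j ^ (l - a))"

definition Pz :: "nat \<Rightarrow> nat \<Rightarrow> 'b"
  where "Pz i j = (\<Sum>a=0..l-1. sc [:inverse \<zeta> ^ a:] * (T i ^ a * T j ^ (l - a)))"

text \<open>The sum of the l reflections that exchange the coordinate lines i and j.\<close>

definition S :: "nat \<Rightarrow> nat \<Rightarrow> 'b"
  where "S i j = Pi i j * W (transpose i j)"

text \<open>The counterpart of \<open>p_eval\<close>. Both sums start at exponent 1, so
  \<open>v ^ 0\<close>, on which the two units would disagree, never occurs.\<close>

definition pe :: "'b \<Rightarrow> 'b"
  where "pe v = (\<Sum>s=1..l-1. \<Sum>r=1..l-1. sc ([:inverse \<zeta> ^ (r * s):] * h r) * v ^ s)"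

lemma alg_Pi [simp]: "i \<in> {1..n} \<Longrightarrow> j \<in> {1..n} \<Longrightarrow> alg (Pi i j)"
  unfolding Pi_def using l_pos by (intro alg_sum) auto

lemma alg_Pz [simp]: "i \<in> {1..n} \<Longrightarrow> j \<in> {1..n} \<Longrightarrow> alg (Pz i j)"
  unfolding Pz_def using l_pos by (intro alg_sum) auto

lemma alg_S [simp]: "i \<in> {1..n} \<Longrightarrow> j \<in> {1..n} \<Longrightarrow> alg (S i j)"
  by (simp add: S_def transpose_permutes)

lemma alg_pe [simp]: "alg v \<Longrightarrow> alg (pe v)"
  unfolding pe_def by (intro alg_sum alg_mult) auto

lemma W_inverse:
  assumes "w permutes {1..n}"
  shows "W w * W (Hilbert_Choice.inv w) = sc 1" "W (Hilbert_Choice.inv w) * W w = sc 1"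
  using assms by (simp_all add: W_comp permutes_inv permutes_inv_o W_id)

lemma W_transpose_square: "i \<in> {1..n} \<Longrightarrow> j \<in> {1..n} \<Longrightarrow> W (transpose i j) * W (transpose i j) = sc 1"
  by (simp add: W_comp transpose_permutes W_id)

lemma pe_intertwine:
  assumes "alg a" "a * v = v' * a"
  shows "a * pe v = pe v' * a"
  unfolding pe_def sum_distrib_left sum_distrib_right
  by (intro sum.cong refl) (simp add: sc_left[OF assms(1)] intertwine_power[OF assms(2)] mult.assoc)

lemma T_mixed_intertwine:
  assumes "a * T i = T i' * a" "a * T j = T j' * a"
  shows "a * (T i ^ p * T j ^ q) = T i' ^ p * T j' ^ q * a"
proof -
  have "a * (T i ^ p * T j ^ q) = T i' ^ p * (a * T j ^ q)"
    by (simp only: intertwine_power[OF assms(1), of p] flip: mult.assoc)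
  then show ?thesis
    by (simp only: intertwine_power[OF assms(2), of q] mult.assoc)
qed

lemma Pi_intertwine:
  assumes "a * T i = T i' * a" "a * T j = T j' * a"
  shows "a * Pi i j = Pi i' j' * a"
  unfolding Pi_def sum_distrib_left sum_distrib_right
  by (intro sum.cong refl T_mixed_intertwine assms)

lemma Pz_intertwine:
  assumes "alg a" "a * T i = T i' * a" "a * T j = T j' * a"
  shows "a * Pz i j = Pz i' j' * a"
  unfolding Pz_def sum_distrib_left sum_distrib_right
  by (intro sum.cong refl) (simp add: sc_left[OF assms(1)] T_mixed_intertwine[OF assms(2,3)] mult.assoc)

text \<open>The substitution of -a for a modulo l exchanges the two generators. It fixes a = 0,
  where both l-th powers are \<open>sc 1\<close>.\<close>

lemma T_mixed_sym:
  assumes "i \<in> {1..n}" "j \<in> {1..n}"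
  shows "(\<Sum>a=0..l-1. sc (f a) * (T i ^ a * T j ^ (l - a)))
    = (\<Sum>a=0..l-1. sc (f ((l - a) mod l)) * (T j ^ a * T i ^ (l - a)))"
proof (rule sum.reindex_bij_witness[of _ "\<lambda>a. (l - a) mod l" "\<lambda>a. (l - a) mod l"])
  fix a assume a: "a \<in> {0..l-1}"
  then have "a < l" using l_pos by auto
  then have *: "(l - a) mod l = (if a = 0 then 0 else l - a)" by simp
  show "(l - (l - a) mod l) mod l = a" "(l - a) mod l \<in> {0..l-1}"
    using \<open>a < l\<close> by (auto simp: *)
  show "(l - (l - a) mod l) mod l = a" by fact
  show "(l - a) mod l \<in> {0..l-1}" by fact
  show "sc (f ((l - (l - a) mod l) mod l)) * (T j ^ ((l - a) mod l) * T i ^ (l - (l - a) mod l))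
      = sc (f a) * (T i ^ a * T j ^ (l - a))"
    using \<open>a < l\<close> assms by (auto simp: * T_pow_l T_mixed_comm)
qed

lemma Pi_unit:
  assumes "i \<in> {1..n}" "j \<in> {1..n}"
  shows "(\<Sum>a=0..l-1. sc 1 * (T i ^ a * T j ^ (l - a))) = Pi i j"
  unfolding Pi_def using l_pos assms by (intro sum.cong refl alg_unit T_mixed_alg) auto

lemma Pi_sym: "i \<in> {1..n} \<Longrightarrow> j \<in> {1..n} \<Longrightarrow> Pi i j = Pi j i"
  using T_mixed_sym[of i j "\<lambda>_. 1"] by (simp only: Pi_unit)

text \<open>Replacing a by -a inverts the weight \<zeta>^{-a}. With i = 1 and j = n the result is
  the sum in the relation of A for \<tau> r_1 \<sigma>.\<close>

lemma Pz_sym: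
  assumes "i \<in> {1..n}" "j \<in> {1..n}"
  shows "Pz i j = (\<Sum>a=0..l-1. sc [:\<zeta> ^ a:] * (T j ^ a * T i ^ (l - a)))"
proof -
  have "inverse \<zeta> ^ ((l - a) mod l) = \<zeta> ^ a" if "a \<in> {0..l-1}" for a
  proof -
    have nz: "\<zeta> \<noteq> 0" using zeta l_pos by (rule root_of_unity_nonzero)
    have "\<zeta> ^ a * \<zeta> ^ (l - a) = 1" using that l_pos zeta by (simp flip: power_add)
    then have "inverse (\<zeta> ^ (l - a)) = \<zeta> ^ a" by (rule inverse_unique[OF trans[OF mult.commute]])
    with that show ?thesis by (cases "a = 0") (auto simp: power_inverse)
  qed
  then show ?thesis
    unfolding Pz_def T_mixed_sym[OF assms, of "\<lambda>a. [:inverse \<zeta> ^ a:]"]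
    by (intro sum.cong refl) simp
qed

text \<open>Multiplication by \<open>T i\<close> or by \<open>T j\<close> shifts the summation index cyclically.\<close>

lemma T_Pi:
  assumes "i \<in> {1..n}" "j \<in> {1..n}"
  shows "T i * Pi i j = T j * Pi i j"
proof -
  obtain m where m: "l = Suc m" using l_pos by (cases l) auto
  let ?f = "\<lambda>a. T i ^ a * T j ^ (Suc l - a)"
  have "T i * Pi i j = (\<Sum>a=0..m. ?f (Suc a))"
    unfolding Pi_def sum_distrib_left unfolding m by (simp add: mult.assoc)
  also have "\<dots> = (\<Sum>a=0..m. ?f a)"
  proof -
    \<comment> \<open>The two ends of the shifted range agree because both l-th powers are the unit
      \<open>sc 1\<close>.\<close>
    have "?f 0 = T j ^ l * T j" by (simp only: power_0 mult_1 diff_zero power_Suc2)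
    also have "\<dots> = T i ^ l * T j" by (simp only: T_pow_l[OF assms(1)] T_pow_l[OF assms(2)])
    also have "\<dots> = ?f (Suc m)" by (simp add: m)
    finally have "?f 0 = ?f (Suc m)" .
    moreover have "?f 0 + (\<Sum>a=0..m. ?f (Suc a)) = (\<Sum>a=0..m. ?f a) + ?f (Suc m)"
      by (rule trans[OF sum.atLeast0_atMost_Suc_shift[of ?f m, unfolded comp_def, symmetric]
            sum.atLeast0_atMost_Suc[of ?f m]])
    moreover have "c = b" if "x = y" "x + c = b + y" for x y b c :: 'b
      using that by (simp add: add.commute)
    ultimately show ?thesis by blast
  qed
  also have "\<dots> = (\<Sum>a=0..m. T j * (T i ^ a * T j ^ (l - a)))"
  proof (intro sum.cong refl)
    fix a assume "a \<in> {0..m}"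
    then have "?f a = (T i ^ a * T j ^ 1) * T j ^ (l - a)"
      by (simp add: m Suc_diff_le mult.assoc)
    then show "?f a = T j * (T i ^ a * T j ^ (l - a))"
      unfolding T_mixed_comm[OF assms, of a 1] by (simp add: mult.assoc)
  qed
  also have "\<dots> = T j * Pi i j" unfolding Pi_def sum_distrib_left unfolding m by simp
  finally show ?thesis .
qed

lemma T_Pi_comm: "i \<in> {1..n} \<Longrightarrow> j \<in> {1..n} \<Longrightarrow> m \<in> {1..n} \<Longrightarrow> T m * Pi i j = Pi i j * T m"
  by (intro Pi_intertwine T_comm)

lemma W_Pi:
  "w permutes {1..n} \<Longrightarrow> i \<in> {1..n} \<Longrightarrow> j \<in> {1..n} \<Longrightarrow> W w * Pi i j = Pi (w i) (w j) * W w"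
  by (intro Pi_intertwine W_T)

lemma W_Pz:
  "w permutes {1..n} \<Longrightarrow> i \<in> {1..n} \<Longrightarrow> j \<in> {1..n} \<Longrightarrow> W w * Pz i j = Pz (w i) (w j) * W w"
  by (intro Pz_intertwine W_T alg_W)

lemma W_transpose:
  assumes "w permutes {1..n}" "i \<in> {1..n}" "j \<in> {1..n}"
  shows "W w * W (transpose i j) = W (transpose (w i) (w j)) * W w"
  using assms permutes_in_image[OF assms(1)]
  by (simp add: W_comp transpose_permutes comp_transpose[OF permutes_inj[OF assms(1)]])

lemma W_S:
  assumes "w permutes {1..n}" "i \<in> {1..n}" "j \<in> {1..n}"
  shows "W w * S i j = S (w i) (w j) * W w"
proof -
  have "W w * S i j = Pi (w i) (w j) * (W w * W (transpose i j))"
    using W_Pi[OF assms] by (simp add: S_def flip: mult.assoc)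
  then show ?thesis by (simp add: W_transpose[OF assms] S_def mult.assoc)
qed

lemma S_sym: "i \<in> {1..n} \<Longrightarrow> j \<in> {1..n} \<Longrightarrow> S i j = S j i"
  by (simp add: S_def Pi_sym transpose_commute)

text \<open>The transposition may turn \<open>T m\<close> into the other of \<open>T i\<close> and
  \<open>T j\<close>, but by \<open>T_Pi\<close> these two act identically on
  \<open>Pi i j\<close>.\<close>

lemma T_S:
  assumes "i \<in> {1..n}" "j \<in> {1..n}" "m \<in> {1..n}"
  shows "T m * S i j = S i j * T m"
proof -
  have m': "transpose i j m \<in> {1..n}" using assms by (auto simp: transpose_def)
  have "S i j * T m = (Pi i j * T (transpose i j m)) * W (transpose i j)"
    using W_T[OF transpose_permutes[OF assms(1,2)] assms(3)] by (simp add: S_def mult.assoc)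
  also have "\<dots> = (T (transpose i j m) * Pi i j) * W (transpose i j)"
    by (simp only: T_Pi_comm[OF assms(1,2) m'])
  also have "T (transpose i j m) * Pi i j = T m * Pi i j"
    using T_Pi[OF assms(1,2)] by (auto simp: transpose_def)
  finally show ?thesis by (simp add: S_def mult.assoc)
qed

lemma W_pe:
  "w permutes {1..n} \<Longrightarrow> i \<in> {1..n} \<Longrightarrow> W w * pe (T i) = pe (T (w i)) * W w"
  by (intro pe_intertwine W_T alg_W)

end

section \<open>The relations of A in the Cherednik algebra\<close>

text \<open>Equations of the shape \<open>a * u = u' * a\<close> are closed under sums, products,
  powers and scalars. Most commutation proofs below assemble such an equation along the structure of
  u.\<close>

lemma intertwine_add: "a * u = u' * a \<Longrightarrow> a * v = v' * a \<Longrightarrow> a * (u + v) = (u' + v') * a"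
  for a :: "'b::ring_1"
  by (simp add: ring_distribs)

lemma intertwine_mult:
  fixes a :: "'b::ring_1"
  assumes "a * u = u' * a" "a * v = v' * a"
  shows "a * (u * v) = (u' * v') * a"
  by (simp only: mult_left_assoc[OF assms(1)] assms(2) mult.assoc)

lemma intertwine_sum:
  fixes a :: "'b::ring_1"
  assumes "\<And>i. i \<in> A \<Longrightarrow> a * f i = g i * a"
  shows "a * sum f A = sum g A * a"
  unfolding sum_distrib_left sum_distrib_right by (intro sum.cong refl assms)

context wreath
begin

lemma intertwine_sc: "alg a \<Longrightarrow> a * u = u' * a \<Longrightarrow> a * (sc c * u) = (sc c * u') * a"
  by (simp add: sc_left mult.assoc)

lemma sc_T_power:
  assumes "i \<in> {1..n}" "j \<in> {1..n}" "a < l"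
  shows "(sc [:c:] * T i) ^ a * T j ^ (l - a) = sc [:c ^ a:] * (T i ^ a * T j ^ (l - a))"
proof (cases "a = 0")
  case True
  then show ?thesis using assms alg_unit(1)[OF T_mixed_alg[OF assms]] by (simp add: one_pCons)
next
  case False
  have "(sc [:c:] * T i) ^ Suc b = sc [:c ^ Suc b:] * T i ^ Suc b" for b
  proof (induction b)
    case (Suc b)
    have "(sc [:c:] * T i) ^ Suc (Suc b) = sc [:c:] * (T i * (sc [:c ^ Suc b:] * T i ^ Suc b))"
      by (simp add: Suc mult.assoc power_Suc[of "sc [:c:] * T i" "Suc b"] del: power_Suc)
    also have "\<dots> = sc [:c:] * (sc [:c ^ Suc b:] * (T i * T i ^ Suc b))"
      by (simp only: sc_left[OF alg_T[OF assms(1)]])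
    also have "\<dots> = sc ([:c:] * [:c ^ Suc b:]) * T i ^ Suc (Suc b)"
      by (simp only: sc_mult mult.assoc power_Suc)
    finally show ?case by (simp add: mult.commute mult.left_commute)
  qed simp
  from this[of "a - 1"] False show ?thesis by (simp add: mult.assoc)
qed

text \<open>\<open>Pz\<close> is \<open>Pi\<close> with \<zeta>^{-1} \<open>T i\<close> in place of
  \<open>T i\<close>, the very change caused by moving \<open>x i\<close> past \<open>T i\<close>;
  hence \<open>x i\<close> turns \<open>Pi\<close> into \<open>Pz\<close>, and \<open>y i\<close>
  turns it back.\<close>

lemma Pz_eq:
  assumes "i \<in> {1..n}" "j \<in> {1..n}"
  shows "Pz i j = (\<Sum>a=0..l-1. (sc [:inverse \<zeta>:] * T i) ^ a * T j ^ (l - a))"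
  unfolding Pz_def using l_pos assms by (intro sum.cong refl sc_T_power[symmetric]) auto

end

text \<open>Commutators are left out on purpose: the candidates for x and y in A are equivariant by
  construction, so everything proved here is available there before their commutators are
  known.\<close>

locale wreath_xy = wreath +
  fixes x y :: "nat \<Rightarrow> 'b"
  assumes alg_x [simp]: "i \<in> {1..n} \<Longrightarrow> alg (x i)" and alg_y [simp]: "i \<in> {1..n} \<Longrightarrow> alg (y i)"
    and W_x: "w permutes {1..n} \<Longrightarrow> i \<in> {1..n} \<Longrightarrow> W w * x i = x (w i) * W w"
    and W_y: "w permutes {1..n} \<Longrightarrow> i \<in> {1..n} \<Longrightarrow> W w * y i = y (w i) * W w"

locale cher_presented = wreath_xy +
  assumes x_comm: "i \<in> {1..n} \<Longrightarrow> j \<in> {1..n} \<Longrightarrow> x i * x j = x j * x i"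
    and y_comm: "i \<in> {1..n} \<Longrightarrow> j \<in> {1..n} \<Longrightarrow> y i * y j = y j * y i"
    and T_x: "i \<in> {1..n} \<Longrightarrow> j \<in> {1..n} \<Longrightarrow> T i * x j = sc [:if i = j then \<zeta> else 1:] * x j * T i"
    and T_y: "i \<in> {1..n} \<Longrightarrow> j \<in> {1..n} \<Longrightarrow> T i * y j = sc [:if i = j then inverse \<zeta> else 1:] * y j * T i"
    and xy_same: "i \<in> {1..n} \<Longrightarrow> x i * y i - y i * x i
      = sc hbar + sc k * (\<Sum>j\<in>{1..n}-{i}. S i j) + pe (T i) - pe (sc [:inverse \<zeta>:] * T i)"
    and xy_diff: "i \<in> {1..n} \<Longrightarrow> j \<in> {1..n} \<Longrightarrow> i \<noteq> j
      \<Longrightarrow> x i * y j - y j * x i = - (sc k * (Pz i j * W (transpose i j)))"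
begin

lemma zeta_inverse: "inverse \<zeta> * \<zeta> = 1"
  using root_of_unity_nonzero[OF zeta l_pos] by simp

lemma sc_inverse: "sc [:inverse \<zeta>:] * (sc [:\<zeta>:] * z) = sc 1 * z"
proof -
  have "[:inverse \<zeta>:] * [:\<zeta>:] = 1" using zeta_inverse by (simp add: one_pCons mult.commute)
  then have "sc [:inverse \<zeta>:] * sc [:\<zeta>:] = sc 1" by (simp only: flip: sc_mult)
  then show ?thesis by (rule mult_left_assoc)
qed

lemma x_T:
  "i \<in> {1..n} \<Longrightarrow> x i * T i = sc [:inverse \<zeta>:] * T i * x i"
  "i \<in> {1..n} \<Longrightarrow> j \<in> {1..n} \<Longrightarrow> i \<noteq> j \<Longrightarrow> x i * T j = T j * x i"
  using T_x[of i i] T_x[of j i] alg_unit(1)[of "x i * T j"] alg_unit(1)[of "x i * T i"]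
  by (simp_all add: mult.assoc sc_inverse flip: one_pCons)

lemma y_T:
  "i \<in> {1..n} \<Longrightarrow> y i * (sc [:inverse \<zeta>:] * T i) = T i * y i"
  "i \<in> {1..n} \<Longrightarrow> j \<in> {1..n} \<Longrightarrow> i \<noteq> j \<Longrightarrow> y i * T j = T j * y i"
  using T_y[of i i] T_y[of j i] alg_unit(1)[of "y i * T j"]
  by (simp_all add: mult.assoc sc_left flip: one_pCons)

lemma x_Pi:
  assumes "i \<in> {1..n}" "j \<in> {1..n}" "i \<noteq> j"
  shows "x i * Pi i j = Pz i j * x i"
  unfolding Pz_eq[OF assms(1,2)] Pi_def
  by (intro intertwine_sum intertwine_mult intertwine_power x_T assms)

lemma y_Pz:
  assumes "i \<in> {1..n}" "j \<in> {1..n}" "i \<noteq> j"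
  shows "y i * Pz i j = Pi i j * y i"
  unfolding Pz_eq[OF assms(1,2)] Pi_def
  by (intro intertwine_sum intertwine_mult intertwine_power y_T assms)

lemma x_S:
  assumes "i \<in> {1..n}" "j \<in> {1..n}" "m \<in> {1..n}" "m \<noteq> i" "m \<noteq> j"
  shows "x m * S i j = S i j * x m"
  unfolding S_def using assms W_x[OF transpose_permutes, of i j m]
  by (intro intertwine_mult Pi_intertwine x_T) (simp_all add: transpose_def)

lemma y_S:
  assumes "i \<in> {1..n}" "j \<in> {1..n}" "m \<in> {1..n}" "m \<noteq> i" "m \<noteq> j"
  shows "y m * S i j = S i j * y m"
  unfolding S_def using assms W_y[OF transpose_permutes, of i j m]
  by (intro intertwine_mult Pi_intertwine y_T) (simp_all add: transpose_def)

definition U :: "nat \<Rightarrow> 'b"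
  where "U i = y i * x i + sc k * (\<Sum>j\<in>{i<..n}. S i j) + pe (T i)"

lemma alg_U [simp]: "i \<in> {1..n} \<Longrightarrow> alg (U i)"
  unfolding U_def by (intro alg_add alg_mult alg_sum alg_pe alg_sc alg_x alg_y alg_S alg_T) auto

text \<open>The sum still runs over j > i before \<open>w\<close> is applied. Its difference from
  the sum over indices above \<open>w i\<close> is the source of the correction terms in the
  following lemmas.\<close>

lemma W_U:
  assumes w: "w permutes {1..n}" and i: "i \<in> {1..n}"
  shows "W w * U i = (y (w i) * x (w i) + sc k * (\<Sum>j\<in>{i<..n}. S (w i) (w j)) + pe (T (w i))) * W w"
  unfolding U_def using w i
  by (intro intertwine_add intertwine_mult intertwine_sc intertwine_sum W_x W_y W_S W_pe alg_W) auto

text \<open>In \<open>y i * x i\<close> the factors \<zeta> and \<zeta>^{-1} cancel; the reflection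
  sums commute with every \<open>T j\<close> by \<open>T_S\<close>.\<close>

lemma U_T:
  assumes i: "i \<in> {1..n}" and j: "j \<in> {1..n}"
  shows "T j * U i = U i * T j"
proof -
  have "T j * (y i * x i) = (y i * x i) * T j"
  proof (cases "i = j")
    case True
    have Ty: "T i * y i = sc [:inverse \<zeta>:] * (y i * T i)" and Tx: "T i * x i = sc [:\<zeta>:] * (x i * T i)"
      using T_y[OF i i] T_x[OF i i] by (simp_all add: mult.assoc)
    have "T i * (y i * x i) = sc [:inverse \<zeta>:] * (y i * (T i * x i))"
      by (simp only: mult_left_assoc[OF Ty] mult.assoc)
    also have "\<dots> = sc 1 * (y i * (x i * T i))"
      by (simp only: Tx sc_left[OF alg_y[OF i]] sc_inverse)
    also have "\<dots> = y i * x i * T i"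
      using i by (simp add: alg_unit mult.assoc)
    finally show ?thesis using True by simp
  next
    case False
    then show ?thesis using x_T(2)[of i j] y_T(2)[of i j] i j by (intro intertwine_mult) auto
  qed
  moreover have "T j * (\<Sum>m\<in>{i<..n}. S i m) = (\<Sum>m\<in>{i<..n}. S i m) * T j"
    using i j by (intro intertwine_sum T_S) auto
  ultimately show ?thesis
    unfolding U_def using i j
    by (intro intertwine_add intertwine_sc pe_intertwine T_comm alg_T)
qed

text \<open>Conjugation by r_j sends the reflections with m > j to those of j + 1 with m > j + 1 and
  one more, between j + 1 and j. This extra reflection sum times r_j is
  \<open>Pi j (Suc j)\<close>.\<close>

lemma W_r_U:
  assumes "1 \<le> j" "j < n"
  shows "W (transpose j (Suc j)) * U j = U (Suc j) * W (transpose j (Suc j)) + sc k * Pi j (Suc j)"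
proof -
  let ?r = "transpose j (Suc j)"
  have j: "j \<in> {1..n}" "Suc j \<in> {1..n}" using assms by auto
  have "{j<..n} = insert (Suc j) {Suc j<..n}" using assms by auto
  moreover have "(\<Sum>m\<in>{Suc j<..n}. S (Suc j) (?r m)) = (\<Sum>m\<in>{Suc j<..n}. S (Suc j) m)"
    by (intro sum.cong refl) (simp add: transpose_def)
  ultimately have "(\<Sum>m\<in>{j<..n}. S (?r j) (?r m)) = S (Suc j) j + (\<Sum>m\<in>{Suc j<..n}. S (Suc j) m)"
    by simp
  then have "W ?r * U j = (U (Suc j) + sc k * S (Suc j) j) * W ?r"
    unfolding W_U[OF transpose_permutes[OF j] j(1)] unfolding U_def
    by (simp add: distrib_left add.commute add.left_commute)
  also have "S (Suc j) j * W ?r = Pi j (Suc j)"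
    using alg_unit(2)[OF alg_Pi[OF j]] W_transpose_square[OF j]
    unfolding S_sym[OF j(2,1)] unfolding S_def by (simp add: mult.assoc)
  then have "(U (Suc j) + sc k * S (Suc j) j) * W ?r = U (Suc j) * W ?r + sc k * Pi j (Suc j)"
    by (simp add: distrib_right mult.assoc)
  finally show ?thesis .
qed

text \<open>Obtained from \<open>W_r_U\<close> by multiplying with r_j on both sides; the correction
  survives because \<open>Pi\<close> is symmetric.\<close>

lemma U_W_r:
  assumes "1 \<le> j" "j < n"
  shows "U j * W (transpose j (Suc j)) = W (transpose j (Suc j)) * U (Suc j) + sc k * Pi j (Suc j)"
proof -
  let ?r = "transpose j (Suc j)"
  have j: "j \<in> {1..n}" "Suc j \<in> {1..n}" using assms by auto
  have rr: "W ?r * W ?r = sc 1" using W_transpose_square[OF j] .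
  have "U j * W ?r = W ?r * (W ?r * U j) * W ?r"
    using alg_unit[OF alg_U[OF j(1)]] by (simp only: rr flip: mult.assoc)
  also have "\<dots> = W ?r * U (Suc j) * (W ?r * W ?r) + sc k * (W ?r * Pi j (Suc j) * W ?r)"
    unfolding W_r_U[OF assms] using sc_left[OF alg_W[OF transpose_permutes[OF j]]]
    by (simp add: ring_distribs mult.assoc)
  also have "W ?r * Pi j (Suc j) * W ?r = Pi (Suc j) j * (W ?r * W ?r)"
    using W_Pi[OF transpose_permutes[OF j] j] by (simp add: mult.assoc)
  also have "\<dots> = Pi j (Suc j)"
    unfolding Pi_sym[OF j(2,1)] rr by (rule alg_unit(2)[OF alg_Pi[OF j]])
  also have "W ?r * U (Suc j) * (W ?r * W ?r) = W ?r * U (Suc j)"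
    unfolding mult.assoc rr alg_unit(2)[OF alg_U[OF j(2)]] ..
  finally show ?thesis .
qed

text \<open>For i < j the transposition permutes the index range \<open>{i<..n}\<close>, and for i >
  j + 1 it fixes it pointwise.\<close>

lemma U_W_r_other:
  assumes "1 \<le> j" "j < n" "i \<in> {1..n}" "i \<noteq> j" "i \<noteq> Suc j"
  shows "W (transpose j (Suc j)) * U i = U i * W (transpose j (Suc j))"
proof -
  let ?r = "transpose j (Suc j)"
  have j: "j \<in> {1..n}" "Suc j \<in> {1..n}" using assms by auto
  have "(\<Sum>m\<in>{i<..n}. S i (?r m)) = (\<Sum>m\<in>{i<..n}. S i m)"
  proof (cases "i < j")
    case True
    then have "?r permutes {i<..n}" using j by (intro transpose_permutes) auto
    from sum.permute[OF this, of "S i"] show ?thesis by (simp add: comp_def)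
  next
    case False
    then show ?thesis using assms by (intro sum.cong refl) (simp add: transpose_def)
  qed
  moreover have "?r i = i" using assms by (simp add: transpose_def)
  ultimately show ?thesis
    unfolding W_U[OF transpose_permutes[OF j] assms(3)] by (simp add: U_def)
qed

end

section \<open>The long cycle and the elements sigma and tau\<close>

context wreath
begin

abbreviation om :: "nat \<Rightarrow> nat" where "om \<equiv> upsilon_cycle n 1"
abbreviation om' :: "nat \<Rightarrow> nat" where "om' \<equiv> Hilbert_Choice.inv om"

lemma om_permutes [simp]: "om permutes {1..n}" "om' permutes {1..n}"
  by (intro upsilon_cycle_permutes permutes_inv order_refl)+

lemma om_n: "om n = 1" and om_Suc: "1 \<le> i \<Longrightarrow> i < n \<Longrightarrow> om i = Suc i"
  using n_pos by (simp_all add: upsilon_cycle_apply)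

lemma om'_1: "om' 1 = n" and om'_Suc: "1 \<le> i \<Longrightarrow> i < n \<Longrightarrow> om' (Suc i) = i"
  using om_n om_Suc permutes_inv_eq[OF om_permutes(1)] by auto

lemma in_range: "1 \<in> {1..n}" "n \<in> {1..n}"
  using n_pos by auto

text \<open>\<open>W w\<close> is invertible only relative to \<open>sc 1\<close>, so cancellation
  needs both elements to absorb \<open>sc 1\<close>.\<close>

lemma W_cancel:
  assumes "w permutes {1..n}" "alg a" "alg b" "a * W w = b * W w"
  shows "a = b"
proof -
  have "a * (W w * W (Hilbert_Choice.inv w)) = b * (W w * W (Hilbert_Choice.inv w))"
    using assms(4) by (simp only: flip: mult.assoc)
  then show ?thesis by (simp only: W_inverse[OF assms(1)] alg_unit(2)[OF assms(2)] alg_unit(2)[OF assms(3)])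
qed

text \<open>Turns a rule for passing \<omega> into one for \<omega>^{-1}, as needed for \<tau> =
  \<omega>^{-1} y_1.\<close>

lemma W_flip:
  assumes "w permutes {1..n}" "alg a" "alg b" "W w * a = b * W w"
  shows "a * W (Hilbert_Choice.inv w) = W (Hilbert_Choice.inv w) * b"
proof -
  let ?v = "Hilbert_Choice.inv w"
  have "a * W ?v = W ?v * (W w * a) * W ?v"
    by (simp only: W_inverse[OF assms(1)] alg_unit(1)[OF assms(2)] flip: mult.assoc)
  also have "\<dots> = W ?v * b"
    by (simp only: assms(4) mult.assoc W_inverse[OF assms(1)] alg_unit(2)[OF assms(3)])
  finally show ?thesis .
qed

end

context wreath_xy
begin

definition sigma :: 'b where "sigma = x 1 * W om"
definition tau :: 'b where "tau = W om' * y 1"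

lemma alg_sigma: "alg sigma" and alg_tau: "alg tau"
  unfolding sigma_def tau_def by (intro alg_mult alg_x alg_y alg_W om_permutes in_range)+

lemma sigma_eq: "sigma = W om * x n"
  using W_x[OF om_permutes(1) in_range(2)] by (simp only: om_n sigma_def)

lemma tau_eq: "tau = y n * W om'"
  using W_y[OF om_permutes(2) in_range(1)] by (simp only: om'_1 tau_def)

end

context cher_presented
begin

text \<open>The cycle raises the indices below n by one but wraps n to 1, so one reflection sum,
  between i + 1 and 1, is left over beyond \<open>U (Suc i)\<close>.\<close>

lemma W_om_U:
  assumes i: "1 \<le> i" "i < n"
  shows "W om * U i = (U (Suc i) + sc k * S (Suc i) 1) * W om"
proof -
  have i': "i \<in> {1..n}" using i by auto
  have "(\<Sum>j\<in>{i<..<n}. S (Suc i) (om j)) = (\<Sum>m\<in>{Suc i<..n}. S (Suc i) m)"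
    by (rule sum.reindex_bij_witness[of _ "\<lambda>m. m - 1" Suc]) (use i in \<open>auto simp: om_Suc[unfolded One_nat_def]\<close>)
  moreover have "{i<..n} = insert n {i<..<n}" using i by auto
  ultimately have "(\<Sum>j\<in>{i<..n}. S (Suc i) (om j)) = S (Suc i) 1 + (\<Sum>m\<in>{Suc i<..n}. S (Suc i) m)"
    using om_n by simp
  then show ?thesis
    unfolding W_U[OF om_permutes(1) i'] om_Suc[OF i] unfolding U_def
    by (simp only: distrib_left distrib_right add.assoc add.commute add.left_commute)
qed

lemma W_om_U_n: "W om * U n = (y 1 * x 1 + pe (T 1)) * W om"
  using W_U[OF om_permutes(1) in_range(2)] by (simp only: om_n greaterThanAtMost_empty_iff greaterThanAtMost_empty sum.empty order_refl mult_zero_right add_0_right)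

text \<open>Moving x_1 past y_m costs the commutator term with \<open>Pz 1 m\<close>. Passing x_m
  through the transposition produces an x_1, and pulling it to the left turns \<open>Pz\<close> into
  \<open>Pi\<close>; the cost is then exactly the reflection sum \<open>S m 1\<close>.\<close>

lemma x_1_U:
  assumes m: "m \<in> {1..n}" "m \<noteq> 1"
  shows "x 1 * (U m + sc k * S m 1) = U m * x 1"
proof -
  note I = in_range(1) m(1)
  have ne: "1 \<noteq> m" using m(2) by simp
  have "x 1 * (y m * x m) = (x 1 * y m) * x m" by (simp only: mult.assoc)
  also have "x 1 * y m = y m * x 1 - sc k * (Pz 1 m * W (transpose 1 m))"
    using xy_diff[OF I ne] by (simp add: algebra_simps)
  also have "(y m * x 1 - sc k * (Pz 1 m * W (transpose 1 m))) * x m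
      = y m * (x 1 * x m) - sc k * (Pz 1 m * (W (transpose 1 m) * x m))"
    by (simp only: left_diff_distrib mult.assoc)
  also have "W (transpose 1 m) * x m = x 1 * W (transpose 1 m)"
    using W_x[OF transpose_permutes[OF I] m(1)] by (simp only: transpose_apply_second)
  also have "Pz 1 m * (x 1 * W (transpose 1 m)) = x 1 * S m 1"
    unfolding S_sym[OF m(1) in_range(1)] unfolding S_def
    by (simp only: x_Pi[OF I ne] flip: mult.assoc)
  also have "y m * (x 1 * x m) = y m * x m * x 1"
    by (simp only: x_comm[OF I] mult.assoc)
  finally have 1: "x 1 * (y m * x m) = y m * x m * x 1 - sc k * (x 1 * S m 1)" .
  have 2: "x 1 * (\<Sum>j\<in>{m<..n}. S m j) = (\<Sum>j\<in>{m<..n}. S m j) * x 1"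
    using m by (intro intertwine_sum x_S) auto
  have 3: "x 1 * pe (T m) = pe (T m) * x 1"
    using m ne by (intro pe_intertwine x_T(2) alg_x in_range) auto
  show ?thesis
    unfolding U_def
    by (simp only: distrib_left distrib_right 1 intertwine_sc[OF alg_x[OF in_range(1)] 2] 3
        sc_left[OF alg_x[OF in_range(1)], of k "S m 1"]) (simp add: algebra_simps)
qed

text \<open>The mirror image of \<open>x_1_U\<close>, with [x_m, y_1] and with \<open>y_Pz\<close>
  turning \<open>Pz\<close> into \<open>Pi\<close>.\<close>

lemma U_y_1:
  assumes m: "m \<in> {1..n}" "m \<noteq> 1"
  shows "(U m + sc k * S m 1) * y 1 = y 1 * U m"
proof -
  note I = m(1) in_range(1)
  have "y m * x m * y 1 = y m * (x m * y 1)" by (simp only: mult.assoc)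
  also have "x m * y 1 = y 1 * x m - sc k * (Pz m 1 * W (transpose m 1))"
    using xy_diff[OF I m(2)] by (simp add: algebra_simps)
  also have "y m * (y 1 * x m - sc k * (Pz m 1 * W (transpose m 1)))
      = (y m * y 1) * x m - sc k * ((y m * Pz m 1) * W (transpose m 1))"
    by (simp only: right_diff_distrib mult.assoc sc_left[OF alg_y[OF m(1)]])
  also have "y m * Pz m 1 = Pi m 1 * y m" by (rule y_Pz[OF I m(2)])
  also have "Pi m 1 * y m * W (transpose m 1) = S m 1 * y 1"
    using W_y[OF transpose_permutes[OF I] in_range(1)]
    by (simp only: S_def mult.assoc transpose_apply_second)
  also have "(y m * y 1) * x m = y 1 * (y m * x m)"
    by (simp only: y_comm[OF I] mult.assoc)
  finally have 1: "y m * x m * y 1 = y 1 * (y m * x m) - sc k * (S m 1 * y 1)" .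
  have 2: "y 1 * (\<Sum>j\<in>{m<..n}. S m j) = (\<Sum>j\<in>{m<..n}. S m j) * y 1"
    using m by (intro intertwine_sum y_S) auto
  have 3: "y 1 * pe (T m) = pe (T m) * y 1"
    using m by (intro pe_intertwine y_T(2) alg_y in_range) auto
  show ?thesis
    unfolding U_def
    by (simp only: distrib_left distrib_right 1 intertwine_sc[OF alg_y[OF in_range(1)] 2] 3
        mult.assoc[of "sc k" "S m 1"]) (simp add: algebra_simps)
qed

text \<open>For i = 1 the indices j > i are all the indices different from i, so the commutator
  [x_1, y_1] absorbs the whole sum.\<close>

lemma U_1: "U 1 + sc hbar = x 1 * y 1 + pe (sc [:inverse \<zeta>:] * T 1)"
proof -
  have "{1..n} - {1} = {1<..n}" by auto
  then show ?thesis using xy_same[OF in_range(1)] by (simp add: U_def algebra_simps)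
qed

lemma U_1_x_1: "(U 1 + sc hbar) * x 1 = x 1 * (y 1 * x 1 + pe (T 1))"
  using pe_intertwine[OF alg_x x_T(1), OF in_range(1) in_range(1)]
  by (simp only: U_1 distrib_left distrib_right mult.assoc)

lemma y_1_U_1: "y 1 * (U 1 + sc hbar) = (y 1 * x 1 + pe (T 1)) * y 1"
  using pe_intertwine[OF alg_y y_T(1), OF in_range(1) in_range(1)]
  by (simp only: U_1 distrib_left distrib_right mult.assoc)

text \<open>By \<open>U_1\<close>, the product x_1 y_1 may stand in for u_1. In passing it, u_i
  gains the term \<open>S i 1\<close> at x_1 and loses it again at y_1.\<close>

lemma U_U_1:
  assumes i: "i \<in> {1..n}"
  shows "U i * U 1 = U 1 * U i"
proof (cases "i = 1")
  case False
  have "U i * (x 1 * y 1) = x 1 * ((U i + sc k * S i 1) * y 1)"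
    by (simp only: x_1_U[OF i False] flip: mult.assoc)
  also have "\<dots> = (x 1 * y 1) * U i"
    by (simp only: U_y_1[OF i False] mult.assoc)
  moreover have "U i * pe (sc [:inverse \<zeta>:] * T 1) = pe (sc [:inverse \<zeta>:] * T 1) * U i"
    by (intro pe_intertwine intertwine_sc U_T[symmetric] alg_U i in_range)
  ultimately have "U i * (U 1 + sc hbar) = (U 1 + sc hbar) * U i"
    unfolding U_1 by (intro intertwine_add) simp_all
  then show ?thesis using alg_comm[OF alg_U[OF i], of hbar] by (simp add: distrib_left distrib_right)
qed simp

text \<open>Induction on the smaller index j. For i > j + 1, u_i commutes with r_j, u_j and
  \<open>Pi j (Suc j)\<close>, hence with u_{j+1} r_j = r_j u_j - k \<open>Pi j (Suc j)\<close>, and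
  a further factor r_j leaves u_{j+1}.\<close>

lemma U_U:
  assumes "i \<in> {1..n}" "j \<in> {1..n}"
  shows "U i * U j = U j * U i"
proof -
  have *: "\<forall>i\<in>{j..n}. U i * U j = U j * U i" if "1 \<le> j" "j \<le> n" for j
    using that
  proof (induction j rule: dec_induct)
    case base
    then show ?case using U_U_1 by blast
  next
    case (step j)
    show ?case
    proof
      fix i assume i: "i \<in> {Suc j..n}"
      let ?r = "transpose j (Suc j)"
      have j: "1 \<le> j" "j < n" "j \<in> {1..n}" "Suc j \<in> {1..n}" using step by auto
      have i': "i \<in> {1..n}" using i j by auto
      show "U i * U (Suc j) = U (Suc j) * U i"
      proof (cases "i = Suc j")
        case False
        have r: "U i * W ?r = W ?r * U i"
          using i False by (intro U_W_r_other[symmetric] j i') auto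
        have "U i * U j = U j * U i" using step.IH i j by auto
        then have "U i * (W ?r * U j - sc k * Pi j (Suc j)) = (W ?r * U j - sc k * Pi j (Suc j)) * U i"
          using intertwine_mult[OF r, of "U j" "U j"]
            intertwine_sc[OF alg_U[OF i'], OF Pi_intertwine[OF U_T[symmetric] U_T[symmetric], OF i' j(3) i' j(4)], of k]
          by (simp only: right_diff_distrib left_diff_distrib)
        from intertwine_mult[OF this r]
        have "U i * (U (Suc j) * (W ?r * W ?r)) = U (Suc j) * (W ?r * W ?r) * U i"
          unfolding W_r_U[OF j(1,2)] by (simp add: mult.assoc)
        then show ?thesis
          by (simp only: W_transpose_square[OF j(3,4)] alg_unit(2)[OF alg_U[OF j(4)]])
      qed simp
    qed
  qed
  show ?thesis
  proof (cases "j \<le> i")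
    case True
    with *[of j] assms show ?thesis by simp
  next
    case False
    with *[of i] assms show ?thesis by simp
  qed
qed

lemma sigma_tau: "sigma * tau = U 1 - pe (sc [:inverse \<zeta>:] * T 1) + sc hbar"
proof -
  have "sigma * tau = x 1 * (W om * W om') * y 1" by (simp only: sigma_def tau_def mult.assoc)
  also have "\<dots> = x 1 * y 1"
    by (simp only: W_inverse om_permutes alg_unit(2)[OF alg_x[OF in_range(1)]])
  also have "\<dots> = U 1 - pe (sc [:inverse \<zeta>:] * T 1) + sc hbar"
    using U_1 by (simp add: algebra_simps)
  finally show ?thesis .
qed

lemma tau_sigma: "tau * sigma = U n - pe (T n)"
proof -
  have "tau * sigma = y n * (W om' * W om) * x n" by (simp only: sigma_eq tau_eq mult.assoc)
  also have "\<dots> = y n * x n"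
    by (simp only: W_inverse om_permutes alg_unit(2)[OF alg_y[OF in_range(2)]])
  also have "\<dots> = U n - pe (T n)" by (simp add: U_def)
  finally show ?thesis .
qed

text \<open>The reflection left over when \<omega> passes u_i in \<open>W_om_U\<close> is the one
  that \<open>x_1_U\<close> absorbs.\<close>

lemma U_sigma:
  assumes i: "1 \<le> i" "i < n"
  shows "U (Suc i) * sigma = sigma * U i"
  using W_om_U[OF i] x_1_U[of "Suc i"] i unfolding sigma_def
  by (simp only: mult.assoc) (simp add: flip: mult.assoc)

lemma U_1_sigma: "(U 1 + sc hbar) * sigma = sigma * U n"
  by (simp only: sigma_def mult.assoc W_om_U_n) (simp only: U_1_x_1 flip: mult.assoc)

lemma U_tau:
  assumes i: "1 \<le> i" "i < n"
  shows "U i * tau = tau * U (Suc i)"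
proof -
  have i': "i \<in> {1..n}" "Suc i \<in> {1..n}" using i by auto
  have "U i * tau = (U i * W om') * y 1" by (simp only: tau_def mult.assoc)
  also have "U i * W om' = W om' * (U (Suc i) + sc k * S (Suc i) 1)"
    using i' in_range by (intro W_flip W_om_U i om_permutes alg_add alg_mult alg_sc alg_U alg_S)
  also have "\<dots> * y 1 = tau * U (Suc i)"
    using i by (simp only: mult.assoc U_y_1[OF i'(2)] tau_def)
  finally show ?thesis .
qed

lemma U_n_tau: "U n * tau = tau * (U 1 + sc hbar)"
proof -
  have "U n * tau = (U n * W om') * y 1" by (simp only: tau_def mult.assoc)
  also have "U n * W om' = W om' * (y 1 * x 1 + pe (T 1))"
    by (intro W_flip W_om_U_n om_permutes alg_add alg_mult alg_x alg_y alg_U alg_pe alg_T in_range)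
  also have "\<dots> * y 1 = tau * (U 1 + sc hbar)"
    by (simp only: mult.assoc y_1_U_1 tau_def)
  finally show ?thesis .
qed

end

section \<open>Families indexed by all integers\<close>

context wreath
begin

definition uu :: "(nat \<Rightarrow> 'b) \<Rightarrow> int \<Rightarrow> 'b"
  where "uu V i = V (res_ix n i) + sc (of_int (quot_ix n i) * hbar)"

definition tt :: "int \<Rightarrow> 'b"
  where "tt i = sc [:\<zeta> powi (- quot_ix n i):] * T (res_ix n i)"

lemma res_ix_in: "res_ix n i \<in> {1..n}"
proof -
  have "(i - 1) mod int n < int n" "0 \<le> (i - 1) mod int n" using n_pos by simp_all
  then show ?thesis by (simp add: res_ix_def nat_less_iff Suc_le_eq)
qed

text \<open>Reduces the relations for all integers to n - 1 cases inside a period and one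
  wrap-around case, in which the quotient drops by one.\<close>

lemma ix_pred_cases:
  obtains (inner) m where "1 \<le> m" "m < n" "res_ix n i = Suc m" "res_ix n (i - 1) = m"
      "quot_ix n (i - 1) = quot_ix n i"
  | (wrap) "res_ix n i = 1" "res_ix n (i - 1) = n" "quot_ix n (i - 1) = quot_ix n i - 1"
proof -
  define q m where "q = quot_ix n i" and "m = (i - 1) mod int n"
  have m: "0 \<le> m" "m < int n" using n_pos by (simp_all add: m_def)
  have i: "i - 1 = m + q * int n" by (simp add: m_def q_def quot_ix_def)
  have res: "res_ix n i = nat m + 1" by (simp add: res_ix_def m_def)
  show ?thesis
  proof (cases "m = 0")
    case True
    \<comment> \<open>Borrowing one period: the remainder becomes n - 1 and the quotient q -
      1.\<close>
    have eq: "i - 1 - 1 = (int n - 1) + (q - 1) * int n" using i True by (simp add: algebra_simps)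
    have "(i - 1 - 1) mod int n = int n - 1"
      unfolding eq mod_mult_self1 using n_pos by (intro mod_pos_pos_trivial) auto
    moreover have "(i - 1 - 1) div int n = q - 1 + (int n - 1) div int n"
      unfolding eq using n_pos by (intro div_mult_self1) simp
    moreover have "(int n - 1) div int n = 0"
      using n_pos by (intro div_pos_pos_trivial) auto
    ultimately have "(i - 1 - 1) mod int n = int n - 1" "(i - 1 - 1) div int n = q - 1" by simp_all
    then show ?thesis
      using n_pos True res by (intro wrap) (simp_all add: res_ix_def quot_ix_def q_def nat_diff_distrib)
  next
    case False
    have eq: "i - 1 - 1 = (m - 1) + q * int n" using i by simp
    have "(i - 1 - 1) mod int n = m - 1" "(i - 1 - 1) div int n = q"
      unfolding eq using n_pos m False by (simp_all add: div_pos_pos_trivial mod_pos_pos_trivial)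
    then show ?thesis
      using m False res by (intro inner[of "nat m"]) (auto simp: res_ix_def quot_ix_def q_def)
  qed
qed

text \<open>The hypothesis \<open>wrap\<close> is the relation at index n + 1, where u_{n+1} = u_1 +
  \<hbar>; other periods differ from these cases by central multiples of \<hbar>.\<close>

lemma uu_right:
  assumes s: "alg s" and inner: "\<And>i. 1 \<le> i \<Longrightarrow> i < n \<Longrightarrow> V (Suc i) * s = s * V i"
    and wrap: "(V 1 + sc hbar) * s = s * V n"
  shows "uu V i * s = s * uu V (i - 1)"
proof (cases rule: ix_pred_cases[of i])
  case (inner m)
  then show ?thesis
    using assms(2)[of m] alg_comm[OF s] by (simp add: uu_def distrib_left distrib_right)
next
  case wrap': wrap
  have "uu V i = (V 1 + sc hbar) + sc (of_int (quot_ix n (i - 1)) * hbar)"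
    unfolding uu_def wrap' by (simp add: algebra_simps flip: sc_add)
  then have "uu V i * s = s * V n + s * sc (of_int (quot_ix n (i - 1)) * hbar)"
    by (simp only: distrib_right[of "V 1 + sc hbar"] wrap
        alg_comm[OF s, of "of_int (quot_ix n (i - 1)) * hbar"])
  then show ?thesis by (simp only: uu_def wrap' distrib_left)
qed

lemma uu_left:
  assumes s: "alg s" and inner: "\<And>i. 1 \<le> i \<Longrightarrow> i < n \<Longrightarrow> V i * s = s * V (Suc i)"
    and wrap: "V n * s = s * (V 1 + sc hbar)"
  shows "uu V i * s = s * uu V (i + 1)"
proof (cases rule: ix_pred_cases[of "i + 1"])
  case (inner m)
  then show ?thesis
    using assms(2)[of m] alg_comm[OF s] by (simp add: uu_def distrib_left distrib_right)
next
  case wrap': wrap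
  have "uu V (i + 1) = (V 1 + sc hbar) + sc (of_int (quot_ix n (i + 1 - 1)) * hbar)"
    unfolding uu_def wrap' by (simp add: algebra_simps flip: sc_add)
  then have "s * uu V (i + 1) = V n * s + sc (of_int (quot_ix n (i + 1 - 1)) * hbar) * s"
    by (simp only: distrib_left[of s "V 1 + sc hbar"] wrap[symmetric]
        alg_comm[OF s, of "of_int (quot_ix n (i + 1 - 1)) * hbar"])
  moreover have "uu V i = V n + sc (of_int (quot_ix n (i + 1 - 1)) * hbar)"
    using wrap' by (simp add: uu_def)
  ultimately show ?thesis by (simp only: distrib_right)
qed

lemma uu_comm:
  assumes "\<And>i. i \<in> {1..n} \<Longrightarrow> alg (V i)" "alg a" "\<And>i. i \<in> {1..n} \<Longrightarrow> V i * a = a * V i"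
  shows "uu V i * a = a * uu V i"
  using assms res_ix_in[of i] by (simp add: uu_def distrib_left distrib_right alg_comm)

lemma alg_uu: "(\<And>i. i \<in> {1..n} \<Longrightarrow> alg (V i)) \<Longrightarrow> alg (uu V i)"
  using res_ix_in[of i] by (simp add: uu_def)

lemma alg_tt: "alg (tt i)"
  using res_ix_in[of i] by (simp add: tt_def)

lemma tt_intertwine:
  assumes "alg a" "T (res_ix n i) * a = a * T (res_ix n i)"
  shows "a * tt i = tt i * a"
  unfolding tt_def using assms by (intro intertwine_sc) simp_all

lemma sc_powi: "sc [:\<zeta> powi a:] * (sc [:\<zeta> powi b:] * z) = sc [:\<zeta> powi (a + b):] * z"
  using root_of_unity_nonzero[OF zeta l_pos]
  by (simp add: power_int_add mult.commute flip: mult.assoc sc_mult)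

text \<open>Here \<open>wrap\<close> is the relation at index 1, because t_0 = \<zeta> t_n.\<close>

lemma tt_right:
  assumes s: "alg s" and inner: "\<And>i. 1 \<le> i \<Longrightarrow> i < n \<Longrightarrow> T (Suc i) * s = s * T i"
    and wrap: "T 1 * s = sc [:\<zeta>:] * (s * T n)"
  shows "tt i * s = s * tt (i - 1)"
proof (cases rule: ix_pred_cases[of i])
  case (inner m)
  then show ?thesis
    using assms(2)[of m] by (simp add: tt_def mult.assoc sc_left[OF s])
next
  case wrap': wrap
  have "tt i * s = sc [:\<zeta> powi (- quot_ix n i):] * (sc [:\<zeta> powi 1:] * (s * T n))"
    using wrap by (simp only: tt_def wrap' mult.assoc power_int_1_right)
  also have "\<dots> = s * tt (i - 1)"
    by (simp only: sc_powi tt_def wrap' sc_left[OF s]) (simp add: algebra_simps)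
  finally show ?thesis .
qed

text \<open>Here \<open>wrap\<close> is the relation at index n, where t_{n+1} = \<zeta>^{-1} t_1,
  with the scalar moved to the other side.\<close>

lemma tt_left:
  assumes s: "alg s" and inner: "\<And>i. 1 \<le> i \<Longrightarrow> i < n \<Longrightarrow> T i * s = s * T (Suc i)"
    and wrap: "s * T 1 = sc [:\<zeta>:] * (T n * s)"
  shows "tt i * s = s * tt (i + 1)"
proof (cases rule: ix_pred_cases[of "i + 1"])
  case (inner m)
  then show ?thesis
    using assms(2)[of m] by (simp add: tt_def mult.assoc sc_left[OF s])
next
  case wrap': wrap
  have "s * tt (i + 1) = sc [:\<zeta> powi (- quot_ix n (i + 1)):] * (sc [:\<zeta> powi 1:] * (T n * s))"
    using wrap by (simp only: tt_def wrap' sc_left[OF s] power_int_1_right)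
  also have "\<dots> = tt i * s"
    using wrap' by (simp only: sc_powi) (simp add: tt_def mult.assoc)
  finally show ?thesis by simp
qed

end

context wreath
begin

lemma range2:
  assumes "n \<ge> 2"
  shows "2 \<in> {1..n}" "n - 1 \<in> {1..n}"
  using assms by auto

lemma om_2:
  assumes "n \<ge> 2"
  shows "om 1 = 2" "om (n - 1) = n" "om' 2 = 1" "om' n = n - 1"
proof -
  show "om 1 = 2" "om (n - 1) = n" using assms om_Suc[of 1] om_Suc[of "n - 1"] by simp_all
  then show "om' 2 = 1" "om' n = n - 1" using permutes_inv_eq[OF om_permutes(1)] by simp_all
qed

lemma W_om_r:
  assumes "n \<ge> 2"
  shows "W om * W (transpose (n - 1) n) = W (transpose n 1) * W om"
    and "W om * W (transpose n 1) = W (transpose 1 2) * W om"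
    and "W om' * W (transpose 1 2) = W (transpose n 1) * W om'"
    and "W om' * W (transpose n 1) = W (transpose (n - 1) n) * W om'"
  using W_transpose[OF om_permutes(1) range2(2) in_range(2), OF assms]
    W_transpose[OF om_permutes(1) in_range(2,1)]
    W_transpose[OF om_permutes(2) in_range(1) range2(1), OF assms]
    W_transpose[OF om_permutes(2) in_range(2,1)]
  by (simp_all only: om_2[OF assms] om_n om'_1)

end

section \<open>Words in sigma and tau as words in x and y\<close>

context wreath_xy
begin

context
  assumes n2: "n \<ge> 2"
begin

lemma sigma_sq: "sigma ^ 2 = x 1 * x 2 * (W om * W om)"
proof -
  have "sigma ^ 2 = x 1 * (W om * x 1) * W om" by (simp only: power2_eq_square sigma_def mult.assoc)
  also have "W om * x 1 = x 2 * W om" using W_x[OF om_permutes(1) in_range(1)] by (simp only: om_2[OF n2])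
  finally show ?thesis by (simp only: mult.assoc)
qed

text \<open>This word and the one in \<open>W_sigma_sq\<close> end in the same permutation, so
  comparing them amounts to comparing x_1 x_2 with x_2 x_1. The same holds for the two words in
  \<open>tau_sq_W\<close> and \<open>W_tau_sq\<close>.\<close>

lemma sigma_sq_W: "sigma ^ 2 * W (transpose (n - 1) n) = x 1 * x 2 * (W (transpose 1 2) * (W om * W om))"
  by (simp only: sigma_sq mult.assoc W_om_r[OF n2] mult_left_assoc[OF W_om_r(2)[OF n2]])

lemma W_sigma_sq: "W (transpose 1 2) * sigma ^ 2 = x 2 * x 1 * (W (transpose 1 2) * (W om * W om))"
proof -
  have "W (transpose 1 2) * (x 1 * x 2) = (x 2 * x 1) * W (transpose 1 2)"
    using W_x[OF transpose_permutes[OF in_range(1) range2(1)[OF n2]]] in_range(1) range2(1)[OF n2]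
    by (intro intertwine_mult) (simp_all only: transpose_apply_first transpose_apply_second)
  from mult_left_assoc[OF this, of "W om * W om"] show ?thesis by (simp only: sigma_sq mult.assoc)
qed

lemma tau_sq: "tau ^ 2 = y n * y (n - 1) * (W om' * W om')"
proof -
  have "tau ^ 2 = y n * (W om' * y n) * W om'" by (simp only: power2_eq_square tau_eq mult.assoc)
  also have "W om' * y n = y (n - 1) * W om'"
    using W_y[OF om_permutes(2) in_range(2)] by (simp only: om_2[OF n2])
  finally show ?thesis by (simp only: mult.assoc)
qed

lemma tau_sq_W: "tau ^ 2 * W (transpose 1 2) = y n * y (n - 1) * (W (transpose (n - 1) n) * (W om' * W om'))"
  by (simp only: tau_sq mult.assoc W_om_r[OF n2] mult_left_assoc[OF W_om_r(4)[OF n2]])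

lemma W_tau_sq: "W (transpose (n - 1) n) * tau ^ 2 = y (n - 1) * y n * (W (transpose (n - 1) n) * (W om' * W om'))"
proof -
  have "W (transpose (n - 1) n) * (y n * y (n - 1)) = (y (n - 1) * y n) * W (transpose (n - 1) n)"
    using W_y[OF transpose_permutes[OF range2(2)[OF n2] in_range(2)]] in_range(2) range2(2)[OF n2]
    by (intro intertwine_mult) (simp_all only: transpose_apply_first transpose_apply_second)
  from mult_left_assoc[OF this, of "W om' * W om'"] show ?thesis by (simp only: tau_sq mult.assoc)
qed

text \<open>Writing both letters with the index n brings \<omega>^{-1} and \<omega> together. The
  common tail (n,1) with \<open>sigma_W_tau_eq\<close> reduces the last relation of A to the
  commutator of x_1 and y_n.\<close>

lemma tau_W_sigma_eq: "tau * W (transpose 1 2) * sigma = (y n * x 1) * W (transpose n 1)"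
proof -
  let ?t = "transpose n 1"
  have "tau * W (transpose 1 2) * sigma = y n * (W ?t * (W om' * W om) * x n)"
    by (simp only: tau_eq sigma_eq mult.assoc mult_left_assoc[OF W_om_r(3)[OF n2]])
  also have "\<dots> = y n * (W ?t * x n)"
    using in_range by (simp only: W_inverse om_permutes mult.assoc alg_unit(1)[OF alg_x[OF in_range(2)]])
  also have "W ?t * x n = x 1 * W ?t"
    using W_x[OF transpose_permutes[OF in_range(2,1)] in_range(2)] by (simp only: transpose_apply_first)
  finally show ?thesis by (simp only: mult.assoc)
qed

lemma sigma_W_tau_eq: "sigma * W (transpose (n - 1) n) * tau = (x 1 * y n) * W (transpose n 1)"
proof -
  let ?t = "transpose n 1"
  have "sigma * W (transpose (n - 1) n) * tau = x 1 * (W om * W (transpose (n - 1) n)) * W om' * y 1"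
    by (simp only: tau_def sigma_def mult.assoc)
  also have "\<dots> = x 1 * (W ?t * (W om * W om') * y 1)"
    by (simp only: W_om_r(1)[OF n2] mult.assoc)
  also have "\<dots> = x 1 * (W ?t * y 1)"
    by (simp only: W_inverse om_permutes mult.assoc alg_unit(1)[OF alg_y[OF in_range(1)]])
  also have "W ?t * y 1 = y n * W ?t"
    using W_y[OF transpose_permutes[OF in_range(2,1)] in_range(1)] by (simp only: transpose_apply_second)
  finally show ?thesis by (simp only: mult.assoc)
qed

end

end

section \<open>The remaining relations for sigma and tau\<close>

context cher_presented
begin

lemma x_W_r: "1 \<le> j \<Longrightarrow> j < n \<Longrightarrow> i \<in> {1..n} \<Longrightarrow>
    W (transpose j (Suc j)) * x i = x (transpose j (Suc j) i) * W (transpose j (Suc j))"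
  by (intro W_x transpose_permutes) auto

lemma sigma_W_r:
  assumes j: "1 \<le> j" "Suc j < n"
  shows "sigma * W (transpose j (Suc j)) = W (transpose (Suc j) (Suc (Suc j))) * sigma"
proof -
  have I: "j \<in> {1..n}" "Suc j \<in> {1..n}" "Suc (Suc j) \<in> {1..n}" using j by auto
  have 1: "W om * W (transpose j (Suc j)) = W (transpose (Suc j) (Suc (Suc j))) * W om"
    using W_transpose[OF om_permutes(1) I(1,2)] om_Suc[of j] om_Suc[of "Suc j"] j by simp
  have 2: "W (transpose (Suc j) (Suc (Suc j))) * x 1 = x 1 * W (transpose (Suc j) (Suc (Suc j)))"
    using x_W_r[of "Suc j" 1] in_range j by (simp add: transpose_def)
  show ?thesis
    by (simp only: sigma_def mult.assoc 1) (simp only: 2 flip: mult.assoc)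
qed

lemma tau_W_r:
  assumes j: "1 \<le> j" "Suc j < n"
  shows "tau * W (transpose (Suc j) (Suc (Suc j))) = W (transpose j (Suc j)) * tau"
proof -
  have I: "j \<in> {1..n}" "Suc j \<in> {1..n}" "Suc (Suc j) \<in> {1..n}" using j by auto
  have 1: "W om' * W (transpose (Suc j) (Suc (Suc j))) = W (transpose j (Suc j)) * W om'"
    using W_transpose[OF om_permutes(2) I(2,3)] om'_Suc[of j] om'_Suc[of "Suc j"] j by simp
  have 2: "W (transpose (Suc j) (Suc (Suc j))) * y 1 = y 1 * W (transpose (Suc j) (Suc (Suc j)))"
    using W_y[OF transpose_permutes[OF I(2,3)] in_range(1)] j by (simp add: transpose_def)
  show ?thesis
    by (simp only: tau_def mult.assoc 2[symmetric]) (simp only: 1 flip: mult.assoc)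
qed

lemma sigma_sq_W_r: "n \<ge> 2 \<Longrightarrow> sigma ^ 2 * W (transpose (n - 1) n) = W (transpose 1 2) * sigma ^ 2"
  by (simp only: sigma_sq_W W_sigma_sq x_comm[OF in_range(1) range2(1)])

lemma tau_sq_W_r: "n \<ge> 2 \<Longrightarrow> tau ^ 2 * W (transpose 1 2) = W (transpose (n - 1) n) * tau ^ 2"
  by (simp only: tau_sq_W W_tau_sq y_comm[OF in_range(2) range2(2)])

lemma tau_W_sigma:
  assumes n2: "n \<ge> 2"
  shows "tau * W (transpose 1 2) * sigma = sigma * W (transpose (n - 1) n) * tau + sc k * Pz 1 n"
proof -
  let ?t = "transpose n 1"
  have n1: "1 \<noteq> n" using n2 by simp
  have "y n * x 1 = x 1 * y n + sc k * (Pz 1 n * W ?t)"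
    using xy_diff[OF in_range n1, unfolded transpose_commute[of 1 n]] by (simp only: diff_eq_eq) simp
  then have "(y n * x 1) * W ?t = (x 1 * y n) * W ?t + sc k * (Pz 1 n * (W ?t * W ?t))"
    by (simp only: distrib_right mult.assoc)
  also have "Pz 1 n * (W ?t * W ?t) = Pz 1 n"
    by (simp only: W_transpose_square[OF in_range(2,1)] alg_unit(2)[OF alg_Pz[OF in_range]])
  finally show ?thesis by (simp only: tau_W_sigma_eq[OF n2] sigma_W_tau_eq[OF n2])
qed

lemma T_sigma:
  assumes i: "1 \<le> i" "i < n"
  shows "T (Suc i) * sigma = sigma * T i"
proof -
  have I: "i \<in> {1..n}" "Suc i \<in> {1..n}" "1 \<noteq> Suc i" using i by auto
  have "T (Suc i) * sigma = x 1 * (T (Suc i) * W om)"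
    using x_T(2)[OF in_range(1) I(2,3)] by (simp only: sigma_def flip: mult.assoc)
  also have "T (Suc i) * W om = W om * T i"
    using W_T[OF om_permutes(1) I(1)] by (simp only: om_Suc[OF i])
  finally show ?thesis by (simp only: sigma_def mult.assoc)
qed

lemma T_1_sigma: "T 1 * sigma = sc [:\<zeta>:] * (sigma * T n)"
proof -
  have "T 1 * sigma = sc [:\<zeta>:] * (x 1 * (T 1 * W om))"
    using T_x[OF in_range(1) in_range(1)] by (simp only: sigma_def if_True simp_thms flip: mult.assoc)
  also have "T 1 * W om = W om * T n"
    using W_T[OF om_permutes(1) in_range(2)] by (simp only: om_n)
  finally show ?thesis by (simp only: sigma_def mult.assoc)
qed

lemma T_tau:
  assumes i: "1 \<le> i" "i < n"
  shows "T i * tau = tau * T (Suc i)"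
proof -
  have I: "i \<in> {1..n}" "Suc i \<in> {1..n}" "1 \<noteq> Suc i" using i by auto
  have "W om' * T (Suc i) = T i * W om'"
    using W_T[OF om_permutes(2) I(2)] by (simp only: om'_Suc[OF i])
  then have "T i * tau = W om' * (T (Suc i) * y 1)" by (simp only: tau_def flip: mult.assoc)
  also have "T (Suc i) * y 1 = y 1 * T (Suc i)"
    using y_T(2)[OF in_range(1) I(2,3)] by simp
  finally show ?thesis by (simp only: tau_def mult.assoc)
qed

lemma tau_T_1: "tau * T 1 = sc [:\<zeta>:] * (T n * tau)"
proof -
  have "T 1 * y 1 = sc [:inverse \<zeta>:] * (y 1 * T 1)"
    using T_y[OF in_range(1) in_range(1)] by (simp only: if_True simp_thms mult.assoc)
  then have "sc [:\<zeta>:] * (T 1 * y 1) = sc ([:\<zeta>:] * [:inverse \<zeta>:]) * (y 1 * T 1)"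
    by (simp only: sc_mult mult.assoc)
  also have "[:\<zeta>:] * [:inverse \<zeta>:] = 1" using zeta_inverse by (simp add: one_pCons mult.commute)
  finally have 1: "sc [:\<zeta>:] * (T 1 * y 1) = y 1 * T 1"
    by (simp only: alg_unit(1)[OF alg_mult[OF alg_y[OF in_range(1)] alg_T[OF in_range(1)]]])
  have "T n * W om' = W om' * T 1"
    using W_T[OF om_permutes(2) in_range(1)] by (simp only: om'_1)
  then have "sc [:\<zeta>:] * (T n * tau) = sc [:\<zeta>:] * (W om' * (T 1 * y 1))"
    by (simp only: tau_def flip: mult.assoc)
  also have "\<dots> = W om' * (sc [:\<zeta>:] * (T 1 * y 1))"
    by (simp only: sc_left[OF alg_W[OF om_permutes(2)]])
  finally show ?thesis by (simp only: 1 tau_def mult.assoc)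
qed

end

section \<open>The relations of the Cherednik algebra in A\<close>

context wreath
begin

text \<open>Builds (a, b+1) from (a, b) by conjugation with the adjacent transposition (b, b+1),
  which stays inside the symmetric group of \<open>{2..n}\<close>.\<close>

lemma W_commute_transpose:
  assumes Z: "\<forall>j. 2 \<le> j \<and> j < n \<longrightarrow> W (transpose j (Suc j)) * z = z * W (transpose j (Suc j))"
    and ab: "2 \<le> a" "a < b" "b \<le> n"
  shows "W (transpose a b) * z = z * W (transpose a b)"
proof -
  have "Suc a \<le> b" using ab by simp
  then show ?thesis
    using \<open>b \<le> n\<close>
  proof (induction b rule: dec_induct)
    case base
    then show ?case using spec[OF Z, of a] ab by simp
  next
    case (step b)
    let ?r = "transpose b (Suc b)"
    have ne: "a \<noteq> b" "a \<noteq> Suc b" using step.hyps by auto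
    have I: "a \<in> {1..n}" "b \<in> {1..n}" "Suc b \<in> {1..n}" using step.hyps step.prems ab by auto
    have r: "z * W ?r = W ?r * z" using spec[OF Z, of b] step.hyps step.prems ab by simp
    have "transpose a (Suc b) = ?r \<circ> transpose a b \<circ> ?r"
      using ne by (auto simp: fun_eq_iff transpose_def)
    then have eq: "W (transpose a (Suc b)) = W ?r * W (transpose a b) * W ?r"
      by (simp only: W_comp transpose_permutes permutes_compose I)
    have IH: "z * W (transpose a b) = W (transpose a b) * z" using step.IH step.prems by simp
    show ?case
      unfolding eq by (rule intertwine_mult[OF intertwine_mult[OF r IH] r, symmetric])
  qed
qed

text \<open>The stabilizer of 1 is the symmetric group of \<open>{2..n}\<close>, which is generated
  by transpositions.\<close>

lemma W_commute_stabilizer: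
  assumes Z: "\<forall>j. 2 \<le> j \<and> j < n \<longrightarrow> W (transpose j (Suc j)) * z = z * W (transpose j (Suc j))"
    and z: "alg z" and w: "w permutes {1..n}" "w 1 = 1"
  shows "W w * z = z * W w"
proof -
  have "w permutes {2..n}"
  proof (rule permutes_superset[OF w(1)])
    fix m assume "m \<in> {1..n} - {2..n}"
    then have "m = 1" by auto
    with w(2) show "w m = m" by simp
  qed
  then show ?thesis
  proof (induction rule: permutes_induct[OF _ finite_atLeastAtMost, consumes 1, case_names id swap])
    case id
    show ?case by (simp only: W_id alg_comm[OF z])
  next
    case (swap a b p)
    have ab: "W (transpose a b) * z = z * W (transpose a b)"
    proof (cases "a < b")
      case True
      then show ?thesis using swap.hyps by (intro W_commute_transpose[OF Z]) auto
    next
      case False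
      then have "W (transpose b a) * z = z * W (transpose b a)"
        using swap.hyps by (intro W_commute_transpose[OF Z]) auto
      then show ?thesis by (simp only: transpose_commute[of a b])
    qed
    have "a \<in> {1..n}" "b \<in> {1..n}" using swap.hyps by auto
    moreover have "p permutes {1..n}" by (rule permutes_subset[OF \<open>p permutes {2..n}\<close>]) auto
    ultimately have eq: "W (transpose a b \<circ> p) = W (transpose a b) * W p"
      by (simp only: W_comp transpose_permutes)
    show ?case
      by (simp only: eq intertwine_mult[OF ab[symmetric] swap.IH[symmetric]])
  qed
qed

lemma chi_cycle_apply_1: "1 \<le> i \<Longrightarrow> chi_cycle i 1 = i"
proof (induction i rule: dec_induct)
  case base
  show ?case by (simp only: chi_cycle_1 id_apply)
next
  case (step i)
  then show ?case using chi_cycle_rec[of i] by simp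
qed

text \<open>\<chi>_i is the chosen permutation taking 1 to i, so equivariance forces this value at i
  once the value at 1 is \<open>z\<close>.\<close>

definition conj_chi :: "'b \<Rightarrow> nat \<Rightarrow> 'b"
  where "conj_chi z i = W (chi_cycle i) * z * W (Hilbert_Choice.inv (chi_cycle i))"

lemma chi_permutes: "i \<in> {1..n} \<Longrightarrow> chi_cycle i permutes {1..n}"
  by (rule chi_cycle_permutes) simp

lemma alg_conj_chi: "alg z \<Longrightarrow> i \<in> {1..n} \<Longrightarrow> alg (conj_chi z i)"
  unfolding conj_chi_def by (intro alg_mult alg_W chi_permutes permutes_inv)

lemma conj_chi_1: "alg z \<Longrightarrow> conj_chi z 1 = z"
  by (simp only: conj_chi_def chi_cycle_1 inv_id W_id alg_unit)

text \<open>Elements of the stabilizer of 1 commute with \<open>z\<close>, so the conjugates of \<open>z\<close> are indexed by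
  the cosets of the stabilizer, that is, by \<open>{1..n}\<close>.\<close>

lemma W_conj_chi:
  assumes Z: "\<forall>j. 2 \<le> j \<and> j < n \<longrightarrow> W (transpose j (Suc j)) * z = z * W (transpose j (Suc j))"
    and z: "alg z" and w: "w permutes {1..n}" and i: "i \<in> {1..n}"
  shows "W w * conj_chi z i = conj_chi z (w i) * W w"
proof -
  have wi: "w i \<in> {1..n}" using permutes_in_image[OF w] i by simp
  let ?c = "chi_cycle i" and ?d = "chi_cycle (w i)"
  let ?c' = "Hilbert_Choice.inv ?c" and ?d' = "Hilbert_Choice.inv ?d"
  note c = chi_permutes[OF i] and d = chi_permutes[OF wi]
  note c' = permutes_inv[OF c] and d' = permutes_inv[OF d]
  \<comment> \<open>\<open>?v\<close> measures how far \<open>w\<close> times \<chi>_i is from the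
    chosen representative for \<open>w i\<close>; it fixes 1 and therefore commutes with
    \<open>z\<close>.\<close>
  let ?v = "?d' \<circ> (w \<circ> ?c)"
  have v: "?v permutes {1..n}" by (intro permutes_compose c w d')
  have "?c 1 = i" "?d 1 = w i" using i wi by (simp_all only: chi_cycle_apply_1 atLeastAtMost_iff)
  then have "?v 1 = 1" using permutes_inv_eq[OF d] by simp
  note vz = W_commute_stabilizer[OF Z z v this]
  have "w \<circ> ?c = ?d \<circ> ?v" "?v \<circ> ?c' = ?d' \<circ> w"
    by (simp_all add: fun_eq_iff permutes_inverses[OF d] permutes_inverses[OF c])
  then have 1: "W w * W ?c = W ?d * W ?v" and 2: "W ?v * W ?c' = W ?d' * W w"
    by (simp_all only: W_comp w c d v c' d')
  show ?thesis
    by (simp only: conj_chi_def mult_left_assoc[OF 1] mult_left_assoc[OF vz] 2 mult.assoc)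
qed

text \<open>Carries an identity proved for one choice of indices to its conjugate by
  \<open>w\<close>.\<close>

lemma W_transfer:
  assumes "w permutes {1..n}" "alg a'" "alg b'" "W w * a = a' * W w" "W w * b = b' * W w" "a = b"
  shows "a' = b'"
  using assms by (intro W_cancel[OF assms(1-3)]) simp

text \<open>Double transitivity: with \<open>W_transfer\<close>, a relation for one pair of distinct
  indices yields it for all pairs.\<close>

lemma obtain_perm2:
  assumes "a \<in> {1..n}" "b \<in> {1..n}" "a \<noteq> b" "i \<in> {1..n}" "j \<in> {1..n}" "i \<noteq> j"
  obtains w where "w permutes {1..n}" "w a = i" "w b = j"
proof -
  let ?p = "transpose a i"
  have "?p b \<in> {1..n}" using assms by (auto simp: transpose_def)
  then have "transpose (?p b) j \<circ> ?p permutes {1..n}"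
    using assms by (intro permutes_compose transpose_permutes)
  moreover have "(transpose (?p b) j \<circ> ?p) a = i" using assms by (auto simp: transpose_def)
  moreover have "(transpose (?p b) j \<circ> ?p) b = j" by simp
  ultimately show ?thesis by (rule that)
qed

end

section \<open>The equivariant families X and Y in A\<close>

locale a_presented = wreath +
  fixes \<sigma> \<tau> :: 'b and V :: "nat \<Rightarrow> 'b"
  assumes alg_\<sigma> [simp]: "alg \<sigma>" and alg_\<tau> [simp]: "alg \<tau>"
    and alg_V [simp]: "i \<in> {1..n} \<Longrightarrow> alg (V i)"
    and V_W_r: "1 \<le> j \<Longrightarrow> j < n
      \<Longrightarrow> V j * W (transpose j (Suc j)) - W (transpose j (Suc j)) * V (Suc j) = sc k * Pi j (Suc j)"
    and \<sigma>_W_r: "1 \<le> j \<Longrightarrow> Suc j < n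
      \<Longrightarrow> \<sigma> * W (transpose j (Suc j)) = W (transpose (Suc j) (Suc (Suc j))) * \<sigma>"
    and \<tau>_W_r: "1 \<le> j \<Longrightarrow> Suc j < n
      \<Longrightarrow> \<tau> * W (transpose (Suc j) (Suc (Suc j))) = W (transpose j (Suc j)) * \<tau>"
    and \<sigma>_sq: "n \<ge> 2 \<Longrightarrow> \<sigma> ^ 2 * W (transpose (n - 1) n) = W (transpose 1 2) * \<sigma> ^ 2"
    and \<tau>_sq: "n \<ge> 2 \<Longrightarrow> \<tau> ^ 2 * W (transpose 1 2) = W (transpose (n - 1) n) * \<tau> ^ 2"
    and \<sigma>_\<tau>: "\<sigma> * \<tau> = V 1 - pe (sc [:inverse \<zeta>:] * T 1) + sc hbar"
    and \<tau>_\<sigma>: "\<tau> * \<sigma> = V n - pe (T n)"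
    and T_\<sigma>: "1 \<le> i \<Longrightarrow> i < n \<Longrightarrow> T (Suc i) * \<sigma> = \<sigma> * T i"
    and T_1_\<sigma>: "T 1 * \<sigma> = sc [:\<zeta>:] * (\<sigma> * T n)"
    and T_\<tau>: "1 \<le> i \<Longrightarrow> i < n \<Longrightarrow> T i * \<tau> = \<tau> * T (Suc i)"
    and \<tau>_T_1: "\<tau> * T 1 = sc [:\<zeta>:] * (T n * \<tau>)"
    and \<tau>_W_\<sigma>: "n \<ge> 2 \<Longrightarrow> \<tau> * W (transpose 1 2) * \<sigma>
      = \<sigma> * W (transpose (n - 1) n) * \<tau> + sc k * Pz 1 n"
begin

definition X :: "nat \<Rightarrow> 'b" where "X = conj_chi (\<sigma> * W om')"
definition Y :: "nat \<Rightarrow> 'b" where "Y = conj_chi (W om * \<tau>)"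

lemma alg_X_1: "alg (\<sigma> * W om')" and alg_Y_1: "alg (W om * \<tau>)"
  by (intro alg_mult alg_W alg_\<sigma> alg_\<tau> om_permutes)+

lemma X_1: "X 1 = \<sigma> * W om'" and Y_1: "Y 1 = W om * \<tau>"
  by (simp_all only: X_def Y_def conj_chi_1 alg_X_1 alg_Y_1)

text \<open>\<omega>^{-1} lowers the indices of the transposition by one and \<sigma> raises them
  again.\<close>

lemma X_1_W_r:
  assumes "2 \<le> j" "j < n"
  shows "W (transpose j (Suc j)) * (\<sigma> * W om') = (\<sigma> * W om') * W (transpose j (Suc j))"
proof -
  obtain i where j: "j = Suc i" "1 \<le> i" "Suc i < n" using assms by (cases j) auto
  then have I: "Suc i \<in> {1..n}" "Suc (Suc i) \<in> {1..n}" by auto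
  have om: "om' (Suc i) = i" "om' (Suc (Suc i)) = Suc i" using om'_Suc[of i] om'_Suc[of "Suc i"] j by auto
  have "W om' * W (transpose (Suc i) (Suc (Suc i))) = W (transpose i (Suc i)) * W om'"
    using W_transpose[OF om_permutes(2) I] by (simp only: om)
  then show ?thesis
    by (simp only: j(1) mult.assoc) (simp only: \<sigma>_W_r[OF j(2,3), symmetric] flip: mult.assoc)
qed

lemma Y_1_W_r:
  assumes "2 \<le> j" "j < n"
  shows "W (transpose j (Suc j)) * (W om * \<tau>) = (W om * \<tau>) * W (transpose j (Suc j))"
proof -
  obtain i where j: "j = Suc i" "1 \<le> i" "Suc i < n" using assms by (cases j) auto
  then have I: "i \<in> {1..n}" "Suc i \<in> {1..n}" by auto
  have om: "om i = Suc i" "om (Suc i) = Suc (Suc i)" using om_Suc[of i] om_Suc[of "Suc i"] j by auto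
  have "W om * W (transpose i (Suc i)) = W (transpose (Suc i) (Suc (Suc i))) * W om"
    using W_transpose[OF om_permutes(1) I] by (simp only: om)
  then show ?thesis
    by (simp only: j(1) mult.assoc \<tau>_W_r[OF j(2,3)]) (simp only: flip: mult.assoc)
qed

text \<open>With this interpretation the dictionary between words in sigma, tau and words in x, y
  applies to A. Its \<open>sigma\<close> and \<open>tau\<close> are then identified with the
  generators \<sigma> and \<tau>.\<close>

sublocale wreath_xy n l \<zeta> k h sc W T X Y
proof unfold_locales
  show "alg (X i)" "alg (Y i)" if "i \<in> {1..n}" for i
    using that by (simp_all only: X_def Y_def alg_conj_chi alg_X_1 alg_Y_1)
  show "W w * X i = X (w i) * W w" "W w * Y i = Y (w i) * W w" if "w permutes {1..n}" "i \<in> {1..n}" for w i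
    unfolding X_def Y_def
    by (rule W_conj_chi[OF _ alg_X_1 that], use X_1_W_r in blast,
        rule W_conj_chi[OF _ alg_Y_1 that], use Y_1_W_r in blast)
qed

lemma sigma_X: "sigma = \<sigma>"
  by (simp only: sigma_def X_1 mult.assoc W_inverse om_permutes alg_unit(2) alg_\<sigma>)

lemma tau_Y: "tau = \<tau>"
  by (simp only: tau_def Y_1 mult.assoc[symmetric] W_inverse om_permutes alg_unit(1) alg_\<tau>)

lemma X_eq:
  assumes "i \<in> {1..n}"
  shows "X i = W (chi_cycle i) * \<sigma> * W (Hilbert_Choice.inv (upsilon_cycle n i))"
proof -
  have c: "chi_cycle i permutes {1..n}" using assms by (rule chi_permutes)
  have "om' \<circ> Hilbert_Choice.inv (chi_cycle i) = Hilbert_Choice.inv (chi_cycle i \<circ> om)"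
    by (rule o_inv_distrib[symmetric]) (use c om_permutes(1) in \<open>auto intro: permutes_bij\<close>)
  also have "chi_cycle i \<circ> om = upsilon_cycle n i" using assms by (intro chi_upsilon) auto
  finally have "W om' * W (Hilbert_Choice.inv (chi_cycle i)) = W (Hilbert_Choice.inv (upsilon_cycle n i))"
    by (simp only: W_comp om_permutes permutes_inv[OF c])
  then show ?thesis by (simp only: X_def conj_chi_def mult.assoc)
qed

lemma Y_eq:
  assumes "i \<in> {1..n}"
  shows "Y i = W (upsilon_cycle n i) * \<tau> * W (Hilbert_Choice.inv (chi_cycle i))"
proof -
  have c: "chi_cycle i permutes {1..n}" using assms by (rule chi_permutes)
  have "chi_cycle i \<circ> om = upsilon_cycle n i" using assms by (intro chi_upsilon) auto
  then have "W (chi_cycle i) * W om = W (upsilon_cycle n i)"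
    by (simp only: W_comp om_permutes c)
  then show ?thesis by (simp only: Y_def conj_chi_def flip: mult.assoc)
qed

text \<open>The relation for \<sigma>^2 gives the pair (1, 2) after cancelling the common
  permutation; double transitivity gives all others. For Y the starting pair is (n, n - 1).\<close>

lemma X_comm:
  assumes "i \<in> {1..n}" "j \<in> {1..n}"
  shows "X i * X j = X j * X i"
proof (cases "i = j")
  case False
  then have n2: "n \<ge> 2" using assms by auto
  note r2 = range2(1)[OF n2]
  let ?c = "transpose 1 2 \<circ> (om \<circ> om)"
  have c: "?c permutes {1..n}"
    by (intro permutes_compose om_permutes transpose_permutes in_range r2)
  have "W (transpose 1 2) * (W om * W om) = W ?c"
    by (simp only: W_comp permutes_compose om_permutes transpose_permutes in_range r2)
  then have "(X 1 * X 2) * W ?c = (X 2 * X 1) * W ?c"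
    using sigma_sq_W[OF n2] W_sigma_sq[OF n2] \<sigma>_sq[OF n2] by (simp only: sigma_X)
  then have 12: "X 1 * X 2 = X 2 * X 1"
    by (rule W_cancel[OF c, rotated 2]) (intro alg_mult alg_x in_range r2)+
  obtain w where w: "w permutes {1..n}" "w 1 = i" "w 2 = j"
    using obtain_perm2[OF in_range(1) r2 _ assms False] by auto
  show ?thesis
    by (rule W_transfer[OF w(1) _ _ intertwine_mult intertwine_mult 12])
      (use W_x[OF w(1) in_range(1)] W_x[OF w(1) r2] w assms in \<open>simp_all only: alg_mult alg_x\<close>)
qed simp

lemma Y_comm:
  assumes "i \<in> {1..n}" "j \<in> {1..n}"
  shows "Y i * Y j = Y j * Y i"
proof (cases "i = j")
  case False
  then have n2: "n \<ge> 2" using assms by auto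
  note r2 = range2(2)[OF n2]
  let ?c = "transpose (n - 1) n \<circ> (om' \<circ> om')"
  have c: "?c permutes {1..n}"
    by (intro permutes_compose om_permutes transpose_permutes in_range r2)
  have "W (transpose (n - 1) n) * (W om' * W om') = W ?c"
    by (simp only: W_comp permutes_compose om_permutes transpose_permutes in_range r2)
  then have "(Y n * Y (n - 1)) * W ?c = (Y (n - 1) * Y n) * W ?c"
    using tau_sq_W[OF n2] W_tau_sq[OF n2] \<tau>_sq[OF n2] by (simp only: tau_Y)
  then have 12: "Y n * Y (n - 1) = Y (n - 1) * Y n"
    by (rule W_cancel[OF c, rotated 2]) (intro alg_mult alg_y in_range r2)+
  have "n \<noteq> n - 1" using n2 by simp
  then obtain w where w: "w permutes {1..n}" "w n = i" "w (n - 1) = j"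
    using obtain_perm2[OF in_range(2) r2 _ assms False] by blast
  show ?thesis
    by (rule W_transfer[OF w(1) _ _ intertwine_mult intertwine_mult 12])
      (use W_y[OF w(1) in_range(2)] W_y[OF w(1) r2] w assms in \<open>simp_all only: alg_mult alg_y\<close>)
qed simp

lemma T_X_1:
  assumes "i \<in> {1..n}"
  shows "T i * X 1 = sc [:if i = 1 then \<zeta> else 1:] * X 1 * T i"
proof (cases "i = 1")
  case True
  have "W om' * T 1 = T n * W om'" using W_T[OF om_permutes(2) in_range(1)] by (simp only: om'_1)
  then show ?thesis using True
    by (simp only: X_1 mult.assoc if_True simp_thms) (simp only: T_1_\<sigma> flip: mult.assoc)
next
  case False
  then obtain m where m: "i = Suc m" "1 \<le> m" "m < n" using assms by (cases i) auto
  have "W om' * T i = T m * W om'"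
    using W_T[OF om_permutes(2) assms] m(1) by (simp only: om'_Suc[OF m(2,3)])
  then have "T i * X 1 = X 1 * T i"
    by (simp only: X_1 mult.assoc) (simp only: m(1) T_\<sigma>[OF m(2,3)] flip: mult.assoc)
  then show ?thesis using False alg_unit(1)[OF alg_x[OF in_range(1)]]
    by (simp only: if_False one_pCons[symmetric])
qed

lemma T_Y_1:
  assumes "i \<in> {1..n}"
  shows "T i * Y 1 = sc [:if i = 1 then inverse \<zeta> else 1:] * Y 1 * T i"
proof (cases "i = 1")
  case True
  have 1: "T 1 * W om = W om * T n" using W_T[OF om_permutes(1) in_range(2)] by (simp only: om_n)
  have z: "[:inverse \<zeta>:] * [:\<zeta>:] = 1"
    using root_of_unity_nonzero[OF zeta l_pos] by (simp add: one_pCons)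
  have "sc [:inverse \<zeta>:] * (\<tau> * T 1) = sc ([:inverse \<zeta>:] * [:\<zeta>:]) * (T n * \<tau>)"
    by (simp only: \<tau>_T_1 sc_mult mult.assoc)
  also have "\<dots> = T n * \<tau>"
    by (simp only: z alg_unit(1)[OF alg_mult[OF alg_T[OF in_range(2)] alg_\<tau>]])
  finally have 2: "sc [:inverse \<zeta>:] * (\<tau> * T 1) = T n * \<tau>" .
  have "sc [:inverse \<zeta>:] * Y 1 * T 1 = W om * (sc [:inverse \<zeta>:] * (\<tau> * T 1))"
    by (simp only: Y_1 mult.assoc sc_left[OF alg_W[OF om_permutes(1)]])
  also have "\<dots> = T 1 * Y 1"
    by (simp only: 2 Y_1) (simp only: 1 flip: mult.assoc)
  finally show ?thesis using True by (simp only: if_True simp_thms)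
next
  case False
  then obtain m where m: "i = Suc m" "1 \<le> m" "m < n" using assms by (cases i) auto
  have I: "m \<in> {1..n}" using m by auto
  have "W om * T m = T i * W om"
    using W_T[OF om_permutes(1) I] m(1) by (simp only: om_Suc[OF m(2,3)])
  then have "T i * Y 1 = Y 1 * T i"
    by (simp only: Y_1 mult.assoc m(1) T_\<tau>[OF m(2,3), symmetric]) (simp only: flip: mult.assoc)
  then show ?thesis using False alg_unit(1)[OF alg_y[OF in_range(1)]]
    by (simp only: if_False one_pCons[symmetric])
qed

lemma T_conj:
  assumes z: "alg z" and Z: "\<And>i. i \<in> {1..n} \<Longrightarrow> alg (Z i)"
    and W_Z: "\<And>w i. w permutes {1..n} \<Longrightarrow> i \<in> {1..n} \<Longrightarrow> W w * Z i = Z (w i) * W w"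
    and T_Z: "\<And>i. i \<in> {1..n} \<Longrightarrow> T i * Z 1 = sc [:if i = 1 then c else 1:] * Z 1 * T i"
    and i: "i \<in> {1..n}" and j: "j \<in> {1..n}"
  shows "T i * Z j = sc [:if i = j then c else 1:] * Z j * T i"
proof -
  let ?w = "transpose 1 j"
  have w: "?w permutes {1..n}" by (intro transpose_permutes in_range j)
  have m: "?w i \<in> {1..n}" using permutes_in_image[OF w] i by simp
  \<comment> \<open>The transposition is its own inverse, so the index to start from is
    \<open>?w i\<close>.\<close>
  have TT: "W ?w * T (?w i) = T i * W ?w" using W_T[OF w m] by simp
  have ZZ: "W ?w * Z 1 = Z j * W ?w" using W_Z[OF w in_range(1)] by (simp only: transpose_apply_first)
  have c: "sc [:if ?w i = 1 then c else 1:] = sc [:if i = j then c else 1:]"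
    by (auto simp: transpose_def)
  show ?thesis
    by (rule W_transfer[OF w _ _ intertwine_mult[OF TT ZZ]
          intertwine_mult[OF intertwine_sc[OF alg_W[OF w] ZZ] TT] T_Z[OF m, unfolded c]])
      (intro alg_mult alg_T alg_sc Z i j)+
qed

lemma T_X: "i \<in> {1..n} \<Longrightarrow> j \<in> {1..n} \<Longrightarrow> T i * X j = sc [:if i = j then \<zeta> else 1:] * X j * T i"
  by (rule T_conj[OF alg_X_1 alg_x W_x T_X_1])

lemma T_Y: "i \<in> {1..n} \<Longrightarrow> j \<in> {1..n} \<Longrightarrow> T i * Y j = sc [:if i = j then inverse \<zeta> else 1:] * Y j * T i"
  by (rule T_conj[OF alg_X_1 alg_y W_y T_Y_1])

text \<open>Peeling off \<upsilon>_i = r_i \<upsilon>_{i+1}, each adjacent transposition contributes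
  the one reflection sum \<open>S i (Suc i)\<close> and moves the earlier ones along. Their total is
  the sum in the Dunkl-Opdam element.\<close>

lemma W_upsilon_V:
  assumes "1 \<le> i" "i \<le> n"
  shows "W (upsilon_cycle n i) * V n = (V i - sc k * (\<Sum>j\<in>{i<..n}. S i j)) * W (upsilon_cycle n i)"
  using assms(2,1)
proof (induction i rule: inc_induct)
  case base
  show ?case
    by (simp add: upsilon_cycle_n W_id[unfolded id_def] alg_comm[OF alg_V[OF in_range(2)]])
next
  case (step i)
  let ?r = "transpose i (Suc i)" and ?u = "upsilon_cycle n (Suc i)"
  have I: "i \<in> {1..n}" "Suc i \<in> {1..n}" using step by auto
  note r = transpose_permutes[OF I]
  have u: "?u permutes {1..n}" by (intro upsilon_cycle_permutes) simp
  have "upsilon_cycle n i = ?r \<circ> ?u" using upsilon_cycle_rec[of i n] step by simp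
  then have eq: "W (upsilon_cycle n i) = W ?r * W ?u" by (simp only: W_comp r u)
  have IH: "W ?u * V n = (V (Suc i) - sc k * (\<Sum>j\<in>{Suc i<..n}. S (Suc i) j)) * W ?u"
    using step by simp
  have "W ?r * (\<Sum>j\<in>{Suc i<..n}. S (Suc i) j) = (\<Sum>j\<in>{Suc i<..n}. S i j) * W ?r"
  proof (rule intertwine_sum)
    fix j assume j: "j \<in> {Suc i<..n}"
    then have "?r j = j" by (auto simp: transpose_def)
    then show "W ?r * S (Suc i) j = S i j * W ?r"
      using W_S[OF r I(2), of j] j I by simp
  qed
  note sum = intertwine_sc[OF alg_W[OF r] this]
  have "sc k * Pi i (Suc i) = sc k * S i (Suc i) * W ?r"
    by (simp only: S_def mult.assoc W_transpose_square[OF I] alg_unit(2)[OF alg_Pi[OF I]])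
  then have "W ?r * V (Suc i) = (V i - sc k * S i (Suc i)) * W ?r"
    using V_W_r[of i] step by (simp add: algebra_simps)
  then have 1: "W ?r * (V (Suc i) - sc k * (\<Sum>j\<in>{Suc i<..n}. S (Suc i) j))
      = (V i - sc k * S i (Suc i) - sc k * (\<Sum>j\<in>{Suc i<..n}. S i j)) * W ?r"
    using sum by (simp only: right_diff_distrib left_diff_distrib)
  have "{i<..n} = insert (Suc i) {Suc i<..n}" using step by auto
  then have 2: "V i - sc k * S i (Suc i) - sc k * (\<Sum>j\<in>{Suc i<..n}. S i j)
      = V i - sc k * (\<Sum>j\<in>{i<..n}. S i j)"
    by (simp add: distrib_left diff_diff_eq)
  show ?case
    by (simp only: eq mult.assoc IH) (simp only: mult_left_assoc[OF 1[unfolded 2]] mult.assoc)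
qed

text \<open>The two factors \<chi>_i cancel, so the product is the conjugate by \<upsilon>_i of
  \<tau> \<sigma> = u_n - p(t_n). This is what sends the Dunkl-Opdam element of H to u_i.\<close>

lemma Y_X:
  assumes i: "i \<in> {1..n}"
  shows "Y i * X i = V i - sc k * (\<Sum>j\<in>{i<..n}. S i j) - pe (T i)"
proof -
  let ?u = "upsilon_cycle n i" and ?c = "chi_cycle i"
  have u: "?u permutes {1..n}" and c: "?c permutes {1..n}"
    using i by (simp_all only: upsilon_cycle_permutes chi_permutes atLeastAtMost_iff)
  have un: "?u n = i" using i by (simp add: upsilon_cycle_apply)
  let ?s = "V i - sc k * (\<Sum>j\<in>{i<..n}. S i j) - pe (T i)"
  have s: "alg ?s"
    using i by (intro alg_diff alg_mult alg_sum alg_V alg_pe alg_T alg_sc alg_S) auto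
  have 1: "Y i * X i = W ?u * (\<tau> * (W (Hilbert_Choice.inv ?c) * W ?c) * \<sigma>) * W (Hilbert_Choice.inv ?u)"
    by (simp only: X_eq[OF i] Y_eq[OF i] mult.assoc)
  have "W ?u * pe (T n) = pe (T i) * W ?u" using W_pe[OF u in_range(2)] by (simp only: un)
  moreover have "W ?u * V n = (V i - sc k * (\<Sum>j\<in>{i<..n}. S i j)) * W ?u"
    using i by (intro W_upsilon_V) auto
  ultimately have 2: "W ?u * (V n - pe (T n)) = ?s * W ?u"
    by (simp only: right_diff_distrib left_diff_distrib)
  show ?thesis
    by (simp only: 1 W_inverse[OF c] alg_unit(2)[OF alg_\<tau>] \<tau>_\<sigma> 2)
      (simp only: mult.assoc W_inverse[OF u] alg_unit(2)[OF s])
qed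

text \<open>For i = 1, X_1 Y_1 is \<sigma> \<tau> and Y_1 X_1 is given by \<open>Y_X\<close>; u_1
  cancels in the difference. The transposition (1, i) carries this to every i.\<close>

lemma X_Y_same:
  assumes i: "i \<in> {1..n}"
  shows "X i * Y i - Y i * X i
    = sc hbar + sc k * (\<Sum>j\<in>{1..n}-{i}. S i j) + pe (T i) - pe (sc [:inverse \<zeta>:] * T i)"
proof -
  have "X 1 * Y 1 = \<sigma> * (W om' * W om) * \<tau>" by (simp only: X_1 Y_1 mult.assoc)
  also have "\<dots> = V 1 - pe (sc [:inverse \<zeta>:] * T 1) + sc hbar"
    by (simp only: W_inverse om_permutes alg_unit(2) alg_\<sigma> \<sigma>_\<tau>)
  moreover have "{1<..n} = {1..n} - {1}" by auto
  ultimately have 1: "X 1 * Y 1 - Y 1 * X 1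
      = sc hbar + sc k * (\<Sum>j\<in>{1..n}-{1}. S 1 j) + pe (T 1) - pe (sc [:inverse \<zeta>:] * T 1)"
    unfolding Y_X[OF in_range(1)] by simp
  let ?w = "transpose 1 i"
  have w: "?w permutes {1..n}" by (intro transpose_permutes in_range i)
  note wx = W_x[OF w in_range(1), unfolded transpose_apply_first]
  note wy = W_y[OF w in_range(1), unfolded transpose_apply_first]
  note wT = W_T[OF w in_range(1), unfolded transpose_apply_first]
  note w_alg = alg_W[OF w]
  have s1: "(\<Sum>j\<in>{1..n}-{1}. S i (?w j)) = (\<Sum>j\<in>{1..n}-{i}. S i j)"
    by (rule sum.reindex_bij_witness[of _ ?w ?w])
      (use i in \<open>auto simp: transpose_def split: if_splits\<close>)
  have "W ?w * (\<Sum>j\<in>{1..n}-{1}. S 1 j) = (\<Sum>j\<in>{1..n}-{1}. S i (?w j)) * W ?w"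
    using W_S[OF w in_range(1)] by (intro intertwine_sum) (simp only: transpose_apply_first Diff_iff)
  then have sum: "W ?w * (\<Sum>j\<in>{1..n}-{1}. S 1 j) = (\<Sum>j\<in>{1..n}-{i}. S i j) * W ?w"
    by (simp only: s1)
  have diff: "a * (u - v) = (u' - v') * a" if "a * u = u' * a" "a * v = v' * a" for a u v u' v' :: 'b
    using that by (simp add: left_diff_distrib right_diff_distrib)
  show ?thesis
  proof (rule W_transfer[OF w _ _ _ _ 1])
    show "W ?w * (X 1 * Y 1 - Y 1 * X 1) = (X i * Y i - Y i * X i) * W ?w"
      by (intro diff intertwine_mult wx wy)
    show "W ?w * (sc hbar + sc k * (\<Sum>j\<in>{1..n}-{1}. S 1 j) + pe (T 1) - pe (sc [:inverse \<zeta>:] * T 1))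
        = (sc hbar + sc k * (\<Sum>j\<in>{1..n}-{i}. S i j) + pe (T i) - pe (sc [:inverse \<zeta>:] * T i)) * W ?w"
      by (intro diff intertwine_add intertwine_sc sum pe_intertwine wT w_alg alg_comm[symmetric])
    show "alg (X i * Y i - Y i * X i)" by (intro alg_diff alg_mult alg_x alg_y i)
    show "alg (sc hbar + sc k * (\<Sum>j\<in>{1..n}-{i}. S i j) + pe (T i) - pe (sc [:inverse \<zeta>:] * T i))"
      using i by (intro alg_diff alg_add alg_mult alg_sum alg_S alg_sc alg_pe alg_T) auto
  qed
qed

text \<open>The relation for \<tau> r_1 \<sigma> is the case (1, n); double transitivity gives the
  others.\<close>

lemma X_Y_diff:
  assumes "i \<in> {1..n}" "j \<in> {1..n}" "i \<noteq> j"
  shows "X i * Y j - Y j * X i = - (sc k * (Pz i j * W (transpose i j)))"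
proof -
  have n2: "n \<ge> 2" using assms by auto
  then have n1: "1 \<noteq> n" by simp
  let ?t = "transpose n 1"
  have "(Y n * X 1) * W ?t = (X 1 * Y n) * W ?t + sc k * Pz 1 n"
    using \<tau>_W_\<sigma>[OF n2] tau_W_sigma_eq[OF n2] sigma_W_tau_eq[OF n2] by (simp only: sigma_X tau_Y)
  \<comment> \<open>A square of the transposition is inserted so that all terms end in the same
    factor, which can then be cancelled.\<close>
  also have "sc k * Pz 1 n = sc k * (Pz 1 n * W ?t) * W ?t"
    by (simp only: mult.assoc W_transpose_square[OF in_range(2,1)] alg_unit(2)[OF alg_Pz[OF in_range]])
  finally have "(Y n * X 1) * W ?t = (X 1 * Y n + sc k * (Pz 1 n * W ?t)) * W ?t"
    by (simp only: distrib_right)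
  then have "Y n * X 1 = X 1 * Y n + sc k * (Pz 1 n * W ?t)"
    by (rule W_cancel[OF transpose_permutes[OF in_range(2,1)], rotated 2])
      (intro alg_add alg_mult alg_x alg_y alg_sc alg_Pz alg_W transpose_permutes in_range)+
  then have 1: "Y n * X 1 - X 1 * Y n = sc k * (Pz 1 n * W (transpose 1 n))"
    by (simp only: transpose_commute[of 1 n] diff_eq_eq add.commute)
  obtain w where w: "w permutes {1..n}" "w 1 = i" "w n = j"
    using obtain_perm2[OF in_range n1 assms] by blast
  have wx: "W w * X 1 = X i * W w" and wy: "W w * Y n = Y j * W w"
    using W_x[OF w(1) in_range(1)] W_y[OF w(1) in_range(2)] by (simp_all only: w(2,3))
  have "Y j * X i - X i * Y j = sc k * (Pz i j * W (transpose i j))"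
  proof (rule W_transfer[OF w(1) _ _ _ _ 1])
    show "W w * (Y n * X 1 - X 1 * Y n) = (Y j * X i - X i * Y j) * W w"
      using intertwine_mult[OF wx wy] intertwine_mult[OF wy wx]
      by (simp only: right_diff_distrib left_diff_distrib)
    show "W w * (sc k * (Pz 1 n * W (transpose 1 n))) = (sc k * (Pz i j * W (transpose i j))) * W w"
      using W_Pz[OF w(1) in_range] W_transpose[OF w(1) in_range]
      by (intro intertwine_sc intertwine_mult alg_W w(1)) (simp_all only: w)
    show "alg (Y j * X i - X i * Y j)" by (intro alg_diff alg_mult alg_x alg_y assms)
    show "alg (sc k * (Pz i j * W (transpose i j)))"
      by (intro alg_mult alg_sc alg_Pz alg_W transpose_permutes assms)
  qed
  then show ?thesis by (simp add: algebra_simps)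
qed

end

section \<open>The isomorphism\<close>

lemma (in presentation) proj_gen_power:
  assumes G: "group G" and rels: "group_rels G e \<subseteq> S" and g: "g \<in> carrier G" and m: "m \<ge> 1"
  shows "proj (full_ideal X S) (gen (e g)) ^ m = proj (full_ideal X S) (gen (e (g [^]\<^bsub>G\<^esub> m)))"
  using m
proof (induction m rule: dec_induct)
  case base
  interpret G: group G by fact
  show ?case using g by simp
next
  case (step m)
  let ?p = "proj (full_ideal X S)"
  have "(gen (e (g [^]\<^bsub>G\<^esub> m)) * gen (e g), gen (e (g [^]\<^bsub>G\<^esub> m \<otimes>\<^bsub>G\<^esub> g))) \<in> S"
    using rels g monoid.nat_pow_closed[OF group.is_monoid[OF G] g] by (auto simp: group_rels_def)
  from proj_rel[OF this] show ?case
    using step.IH by (simp add: power_Suc2 del: power_Suc)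
qed

text \<open>A presentation that contains the multiplication table of \<Gamma> under an embedding
  \<open>e\<close> of matrices into the generators; used with \<open>HG\<close> for H and with
  \<open>AG\<close> for A.\<close>

locale wreath_presentation = presentation X R
  for X :: "'x set" and R :: "(('x, 'k::field poly) ncpoly \<times> ('x, 'k poly) ncpoly) set" +
  fixes n l :: nat and \<zeta> :: 'k and k :: "'k poly" and h :: "nat \<Rightarrow> 'k poly" and e :: "'k mat \<Rightarrow> 'x"
  assumes pos: "n \<ge> 1" "l \<ge> 1" and root: "\<zeta> ^ l = 1"
    and group_rels: "group_rels (monomial_group n l) e \<subseteq> R"
begin

abbreviation G :: "'k mat monoid" where "G \<equiv> monomial_group n l"
abbreviation p :: "('x, 'k poly) ncpoly \<Rightarrow> ('x, 'k poly) ncpoly quotients"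
  where "p \<equiv> proj (full_ideal X R)"

lemma p_mult: "g \<in> carrier G \<Longrightarrow> g' \<in> carrier G \<Longrightarrow> p (gen (e g)) * p (gen (e g')) = p (gen (e (g * g')))"
  using proj_rel[of "gen (e g) * gen (e g')" "gen (e (g * g'))"] group_rels
  by (force simp: group_rels_def)

lemma p_one: "p (gen (e (1\<^sub>m n))) = p (scal 1)"
  using proj_rel[of "gen (e (1\<^sub>m n))" 1] group_rels by (force simp: group_rels_def)

sublocale wreath n l \<zeta> k h "\<lambda>c. p (scal c)" "\<lambda>w. p (gen (e (perm_mat n w)))"
  "\<lambda>i. p (gen (e (t_mat n \<zeta> i)))"
proof unfold_locales
  show "p (scal (c + d)) = p (scal c) + p (scal d)" "p (scal (c * d)) = p (scal c) * p (scal d)" for c d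
    by (simp_all add: scal_add scal_mult)
  show "p (gen (e (perm_mat n id))) = p (scal 1)"
    by (simp only: perm_mat_id p_one)
  show "p (gen (e (perm_mat n w))) * p (gen (e (perm_mat n w'))) = p (gen (e (perm_mat n (w \<circ> w'))))"
    if "w permutes {1..n}" "w' permutes {1..n}" for w w'
    using that pos by (simp only: p_mult perm_mat_in perm_mat_mult)
  show "p (gen (e (perm_mat n w))) * p (gen (e (t_mat n \<zeta> i)))
      = p (gen (e (t_mat n \<zeta> (w i)))) * p (gen (e (perm_mat n w)))"
    if "w permutes {1..n}" "i \<in> {1..n}" for w i
    using that pos root by (simp only: p_mult perm_mat_in t_mat_in perm_mat_t_mat)
  show "p (gen (e (t_mat n \<zeta> i))) * p (gen (e (t_mat n \<zeta> j)))
      = p (gen (e (t_mat n \<zeta> j))) * p (gen (e (t_mat n \<zeta> i)))" for i j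
    using pos root by (simp only: p_mult t_mat_in t_mat_commute[of n \<zeta> i j])
  show "p (gen (e (t_mat n \<zeta> i))) ^ l = p (scal 1)" for i
    using proj_gen_power[OF group_monomial_group[OF pos(2)] group_rels t_mat_in[OF pos(2) root] pos(2)]
    by (simp only: t_mat_pow_l[OF root] p_one)
qed (use pos root in \<open>simp_all add: scal_commute flip: proj_mult\<close>)

lemma p_tt:
  assumes "a < l"
  shows "p (gen (e (tt_mat n l \<zeta> i j a))) = p (gen (e (t_mat n \<zeta> i))) ^ a * p (gen (e (t_mat n \<zeta> j))) ^ (l - a)"
proof -
  interpret G: group G using pos(2) by (rule group_monomial_group)
  note t = t_mat_in[OF pos(2) root]
  note pow = proj_gen_power[OF group_monomial_group[OF pos(2)] group_rels t]
  have tt: "tt_mat n l \<zeta> i j a = t_mat n \<zeta> i [^]\<^bsub>G\<^esub> a * t_mat n \<zeta> j [^]\<^bsub>G\<^esub> (l - a)"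
    using pos root assms by (intro tt_mat_eq) auto
  show ?thesis
  \<comment> \<open>At \<open>a = 0\<close> the first power is the ambient unit, to which
    \<open>proj_gen_power\<close> does not apply.\<close>
  proof (cases "a = 0")
    case True
    have "t_mat n \<zeta> j [^]\<^bsub>G\<^esub> l \<in> carrier_mat n n" by (simp add: t_mat_pow)
    then show ?thesis using tt True pow[of l j] pos by simp
  next
    case False
    then show ?thesis
      using assms pow[of a i] pow[of "l - a" j] p_mult[of "t_mat n \<zeta> i [^]\<^bsub>G\<^esub> a" "t_mat n \<zeta> j [^]\<^bsub>G\<^esub> (l - a)"]
      by (simp add: tt G.nat_pow_closed[OF t])
  qed
qed

lemma p_sum_tt: "(\<Sum>a=0..l-1. p (gen (e (tt_mat n l \<zeta> i j a)))) = Pi i j"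
  unfolding Pi_def using pos by (intro sum.cong refl p_tt) auto

lemma p_S: "(\<Sum>a=0..l-1. p (gen (e (tt_mat n l \<zeta> i j a))) * p (gen (e (perm_mat n (transpose i j))))) = S i j"
  by (simp only: S_def p_sum_tt flip: sum_distrib_right)

lemma p_p_eval: "p (p_eval l \<zeta> h f) = pe (p f)"
  unfolding p_eval_def pe_def by (simp add: proj_power)

lemma p_inv_perm_mat:
  "w permutes {1..n} \<Longrightarrow> p (gen (e (inv\<^bsub>G\<^esub> (perm_mat n w)))) = p (gen (e (perm_mat n (Hilbert_Choice.inv w))))"
  using pos by (simp only: inv_perm_mat)

lemma alg_p [simp]: "alg (p f)"
  by (simp add: alg_def scal_commute flip: proj_mult)

lemma p_Pz: "(\<Sum>a=0..l-1. p (scal [:inverse \<zeta> ^ a:]) * p (gen (e (tt_mat n l \<zeta> i j a))) * z) = Pz i j * z"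
  unfolding Pz_def sum_distrib_right using pos by (intro sum.cong refl) (simp add: p_tt)

end

section \<open>Both sets of relations lie in the free algebras\<close>

context
  fixes n l :: nat and \<zeta> :: "'k::field" and k :: "'k poly" and h :: "nat \<Rightarrow> 'k poly"
  assumes pos: "n \<ge> 1" "l \<ge> 1" and root: "\<zeta> ^ l = 1"
begin

lemma tt_mat_closed: "tt_mat n l \<zeta> i j a \<in> carrier (monomial_group n l)"
proof -
  interpret G: group "monomial_group n l :: 'k mat monoid" using pos(2) by (rule group_monomial_group)
  show ?thesis
    unfolding tt_mat_def using t_mat_in[OF pos(2) root] by (intro G.m_closed G.int_pow_closed)
qed

lemma cher_gens_in [simp]:
  "g \<in> carrier (monomial_group n l) \<Longrightarrow> gen (HG g) \<in> poly_in (cher_gens n l)"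
  "i \<in> {1..n} \<Longrightarrow> h_x i \<in> poly_in (cher_gens n l)"
  "i \<in> {1..n} \<Longrightarrow> h_y i \<in> poly_in (cher_gens n l)"
  "w permutes {1..n} \<Longrightarrow> h_w n w \<in> poly_in (cher_gens n l)"
  "h_t n \<zeta> i \<in> poly_in (cher_gens n l)"
  "h_tt n l \<zeta> i j a \<in> poly_in (cher_gens n l)"
  using pos root perm_mat_in[of l w n] t_mat_in[of l \<zeta> n i] tt_mat_closed[of i j a]
  by (auto simp: cher_gens_def h_x_def h_y_def h_w_def h_t_def h_tt_def intro!: poly_in_gen)

lemma a_gens_in [simp]:
  "g \<in> carrier (monomial_group n l) \<Longrightarrow> gen (AG g) \<in> poly_in (a_gens n l)"
  "a_sigma \<in> poly_in (a_gens n l)" "a_tau \<in> poly_in (a_gens n l)"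
  "w permutes {1..n} \<Longrightarrow> a_w n w \<in> poly_in (a_gens n l)"
  "a_tt n l \<zeta> i j a \<in> poly_in (a_gens n l)"
  "a_u n m \<in> poly_in (a_gens n l)" "a_t n \<zeta> m \<in> poly_in (a_gens n l)"
proof -
  have "(m - 1) mod int n < int n" "0 \<le> (m - 1) mod int n" using pos by simp_all
  then have "res_ix n m \<in> {1..n}" by (simp add: res_ix_def nat_less_iff Suc_le_eq)
  then show "a_u n m \<in> poly_in (a_gens n l)"
    by (auto simp: a_u_def a_gens_def intro!: poly_in_add poly_in_gen)
qed (use pos root perm_mat_in[of l w n] t_mat_in[of l \<zeta> n "res_ix n m"] tt_mat_closed[of i j a] in
  \<open>auto simp: a_gens_def a_sigma_def a_tau_def a_w_def a_tt_def a_t_def intro!: poly_in_gen poly_in_mult\<close>)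

lemma group_rels_in:
  assumes "\<And>g. g \<in> carrier (monomial_group n l) \<Longrightarrow> e g \<in> X"
  shows "group_rels (monomial_group n l :: 'k mat monoid) e \<subseteq> poly_in X \<times> poly_in X"
proof -
  interpret G: group "monomial_group n l :: 'k mat monoid" using pos(2) by (rule group_monomial_group)
  show ?thesis
    using assms G.m_closed G.one_closed by (auto simp: group_rels_def intro!: poly_in_gen poly_in_mult)
qed

lemma r_permutes: "i \<in> {1..n} \<Longrightarrow> j \<in> {1..n} \<Longrightarrow> transpose i j permutes {1..n}"
  by (rule transpose_permutes)

lemma presentation_cher: "presentation (cher_gens n l) (cher_rels n l \<zeta> k h)"
proof
  have w: "Suc 0 \<le> w i \<and> w i \<le> n" if "w permutes {Suc 0..n}" "Suc 0 \<le> i" "i \<le> n" for w i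
    using permutes_in_image[OF that(1), of i] that by simp
  have sum: "(\<Sum>j\<in>{1..n}-{i}. \<Sum>a=0..l-1. h_tt n l \<zeta> i j a * h_w n (transpose i j))
      \<in> poly_in (cher_gens n l)" if "i \<in> {1..n}" for i
    using that by (intro poly_in_sum poly_in_mult cher_gens_in r_permutes) auto
  show "cher_rels n l \<zeta> k h \<subseteq> poly_in (cher_gens n l) \<times> poly_in (cher_gens n l)"
    unfolding cher_rels_def
    by (intro Un_least group_rels_in)
      (auto simp: w r_permutes[unfolded One_nat_def] sum[unfolded One_nat_def], auto simp: cher_gens_def)
qed

lemma presentation_a: "presentation (a_gens n l) (a_rels n l \<zeta> k h)"
proof
  have r: "a_r n j \<in> poly_in (a_gens n l)" if "Suc 0 \<le> j" "j \<le> n - Suc 0" for j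
    unfolding a_r_def using that pos by (intro a_gens_in r_permutes) auto
  have pi: "a_pi n l \<zeta> j \<in> poly_in (a_gens n l)" for j
    unfolding a_pi_def by (intro poly_in_mult poly_in_sum poly_in_scal a_gens_in)
  have w: "a_w n (transpose 1 2) \<in> poly_in (a_gens n l)" "a_w n (transpose (n - 1) n) \<in> poly_in (a_gens n l)"
    if "n \<ge> 2" using that by (intro a_gens_in r_permutes; simp)+
  show "a_rels n l \<zeta> k h \<subseteq> poly_in (a_gens n l) \<times> poly_in (a_gens n l)"
    unfolding a_rels_def
    by (intro Un_least group_rels_in) (auto simp: r pi w[unfolded One_nat_def], auto simp: a_gens_def)
qed

end

fun cher_to_a :: "nat \<Rightarrow> nat \<Rightarrow> 'k::field mat cher_gen \<Rightarrow> ('k mat a_gen, 'k poly) ncpoly"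
  where
    "cher_to_a n l (HG g) = gen (AG g)"
  | "cher_to_a n l (HX i) = a_w n (chi_cycle i) * a_sigma
      * gen (AG (inv\<^bsub>monomial_group n l\<^esub> (perm_mat n (upsilon_cycle n i))))"
  | "cher_to_a n l (HY i) = a_w n (upsilon_cycle n i) * a_tau
      * gen (AG (inv\<^bsub>monomial_group n l\<^esub> (perm_mat n (chi_cycle i))))"

fun a_to_cher :: "nat \<Rightarrow> nat \<Rightarrow> 'k::field \<Rightarrow> 'k poly \<Rightarrow> (nat \<Rightarrow> 'k poly) \<Rightarrow> 'k mat a_gen
    \<Rightarrow> ('k mat cher_gen, 'k poly) ncpoly"
  where
    "a_to_cher n l \<zeta> k h (AG g) = gen (HG g)"
  | "a_to_cher n l \<zeta> k h ASigma = h_x 1 * h_w n (upsilon_cycle n 1)"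
  | "a_to_cher n l \<zeta> k h ATau = h_w n (Hilbert_Choice.inv (upsilon_cycle n 1)) * h_y 1"
  | "a_to_cher n l \<zeta> k h (AU i) = dunkl_opdam n l \<zeta> k h i"

section \<open>The two algebras as instances of the abstract settings\<close>

locale cherednik =
  fixes n l :: nat and \<zeta> :: "'k::field" and k :: "'k poly" and h :: "nat \<Rightarrow> 'k poly"
  assumes n_pos: "n \<ge> 1" and l_pos: "l \<ge> 1" and zeta: "\<zeta> ^ l = 1" and l_nonzero: "of_nat l \<noteq> (0 :: 'k)"
begin

lemma wreath_H: "wreath_presentation (cher_gens n l) (cher_rels n l \<zeta> k h) n l \<zeta> HG"
  by (intro wreath_presentation.intro wreath_presentation_axioms.intro
      presentation_cher n_pos l_pos zeta) (auto simp: cher_rels_def)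

lemma wreath_A: "wreath_presentation (a_gens n l) (a_rels n l \<zeta> k h) n l \<zeta> AG"
  by (intro wreath_presentation.intro wreath_presentation_axioms.intro
      presentation_a n_pos l_pos zeta) (auto simp: a_rels_def)

sublocale H: wreath_presentation "cher_gens n l" "cher_rels n l \<zeta> k h" n l \<zeta> k h HG
  by (rule wreath_H)

sublocale A: wreath_presentation "a_gens n l" "a_rels n l \<zeta> k h" n l \<zeta> k h AG
  by (rule wreath_A)

lemma H_dunkl: "H.p (dunkl_opdam n l \<zeta> k h i)
    = H.p (h_y i) * H.p (h_x i) + H.p (scal k) * (\<Sum>j\<in>{i<..n}. H.S i j) + H.pe (H.p (gen (HG (t_mat n \<zeta> i))))"
  by (simp only: dunkl_opdam_def h_tt_def h_w_def h_t_def proj_add proj_mult proj_sum H.p_S H.p_p_eval)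

lemma H_rels:
  "i \<in> {1..n} \<Longrightarrow> j \<in> {1..n} \<Longrightarrow> H.p (h_x i) * H.p (h_x j) = H.p (h_x j) * H.p (h_x i)"
  "i \<in> {1..n} \<Longrightarrow> j \<in> {1..n} \<Longrightarrow> H.p (h_y i) * H.p (h_y j) = H.p (h_y j) * H.p (h_y i)"
  "w permutes {1..n} \<Longrightarrow> i \<in> {1..n}
    \<Longrightarrow> H.p (gen (HG (perm_mat n w))) * H.p (h_x i) = H.p (h_x (w i)) * H.p (gen (HG (perm_mat n w)))"
  "w permutes {1..n} \<Longrightarrow> i \<in> {1..n}
    \<Longrightarrow> H.p (gen (HG (perm_mat n w))) * H.p (h_y i) = H.p (h_y (w i)) * H.p (gen (HG (perm_mat n w)))"
  "i \<in> {1..n} \<Longrightarrow> j \<in> {1..n} \<Longrightarrow> H.p (gen (HG (t_mat n \<zeta> i))) * H.p (h_x j)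
    = H.p (scal [:if i = j then \<zeta> else 1:]) * H.p (h_x j) * H.p (gen (HG (t_mat n \<zeta> i)))"
  "i \<in> {1..n} \<Longrightarrow> j \<in> {1..n} \<Longrightarrow> H.p (gen (HG (t_mat n \<zeta> i))) * H.p (h_y j)
    = H.p (scal [:if i = j then inverse \<zeta> else 1:]) * H.p (h_y j) * H.p (gen (HG (t_mat n \<zeta> i)))"
  "i \<in> {1..n} \<Longrightarrow> H.p (h_x i) * H.p (h_y i) - H.p (h_y i) * H.p (h_x i)
    = H.p (scal hbar) + H.p (scal k) * (\<Sum>j\<in>{1..n}-{i}. H.S i j)
      + H.pe (H.p (gen (HG (t_mat n \<zeta> i)))) - H.pe (H.p (scal [:inverse \<zeta>:]) * H.p (gen (HG (t_mat n \<zeta> i))))"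
  "i \<in> {1..n} \<Longrightarrow> j \<in> {1..n} \<Longrightarrow> i \<noteq> j \<Longrightarrow> H.p (h_x i) * H.p (h_y j) - H.p (h_y j) * H.p (h_x i)
    = - (H.p (scal k) * (H.Pz i j * H.p (gen (HG (perm_mat n (transpose i j))))))"
proof -
  note c = cher_rels_def[of n l \<zeta> k h]
  note ps = proj_add proj_mult proj_diff proj_uminus proj_sum h_w_def h_t_def h_tt_def H.p_S H.p_p_eval H.p_Pz
  assume i: "i \<in> {1..n}"
  have "(h_x i * h_y i - h_y i * h_x i,
          scal hbar
          + scal k * (\<Sum>j\<in>{1..n}-{i}. \<Sum>a=0..l-1. h_tt n l \<zeta> i j a * h_w n (transpose i j))
          + p_eval l \<zeta> h (h_t n \<zeta> i) - p_eval l \<zeta> h (scal [:inverse \<zeta>:] * h_t n \<zeta> i)) \<in> cher_rels n l \<zeta> k h"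
    unfolding c using i by blast
  from H.proj_rel[OF this] show "H.p (h_x i) * H.p (h_y i) - H.p (h_y i) * H.p (h_x i)
    = H.p (scal hbar) + H.p (scal k) * (\<Sum>j\<in>{1..n}-{i}. H.S i j)
      + H.pe (H.p (gen (HG (t_mat n \<zeta> i)))) - H.pe (H.p (scal [:inverse \<zeta>:]) * H.p (gen (HG (t_mat n \<zeta> i))))"
    by (simp only: ps)
  {
    assume w: "w permutes {1..n}"
    have "(h_w n w * h_x i, h_x (w i) * h_w n w) \<in> cher_rels n l \<zeta> k h"
      "(h_w n w * h_y i, h_y (w i) * h_w n w) \<in> cher_rels n l \<zeta> k h"
      unfolding c using i w by blast+
    from this[THEN H.proj_rel]
    show "H.p (gen (HG (perm_mat n w))) * H.p (h_x i) = H.p (h_x (w i)) * H.p (gen (HG (perm_mat n w)))"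
      "H.p (gen (HG (perm_mat n w))) * H.p (h_y i) = H.p (h_y (w i)) * H.p (gen (HG (perm_mat n w)))"
      by (simp_all only: ps)
  }
  assume j: "j \<in> {1..n}"
  have "(h_x i * h_x j, h_x j * h_x i) \<in> cher_rels n l \<zeta> k h"
    "(h_y i * h_y j, h_y j * h_y i) \<in> cher_rels n l \<zeta> k h"
    "(h_t n \<zeta> i * h_x j, scal [:if i = j then \<zeta> else 1:] * h_x j * h_t n \<zeta> i) \<in> cher_rels n l \<zeta> k h"
    "(h_t n \<zeta> i * h_y j, scal [:if i = j then inverse \<zeta> else 1:] * h_y j * h_t n \<zeta> i) \<in> cher_rels n l \<zeta> k h"
    unfolding c using i j by blast+
  from this[THEN H.proj_rel]
  show "H.p (h_x i) * H.p (h_x j) = H.p (h_x j) * H.p (h_x i)"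
    "H.p (h_y i) * H.p (h_y j) = H.p (h_y j) * H.p (h_y i)"
    "H.p (gen (HG (t_mat n \<zeta> i))) * H.p (h_x j)
      = H.p (scal [:if i = j then \<zeta> else 1:]) * H.p (h_x j) * H.p (gen (HG (t_mat n \<zeta> i)))"
    "H.p (gen (HG (t_mat n \<zeta> i))) * H.p (h_y j)
      = H.p (scal [:if i = j then inverse \<zeta> else 1:]) * H.p (h_y j) * H.p (gen (HG (t_mat n \<zeta> i)))"
    by (simp_all only: ps)
  assume "i \<noteq> j"
  have "(h_x i * h_y j - h_y j * h_x i,
      - (scal k * (\<Sum>a=0..l-1. scal [:inverse \<zeta> ^ a:] * h_tt n l \<zeta> i j a * h_w n (transpose i j))))
      \<in> cher_rels n l \<zeta> k h"
    unfolding c using i j \<open>i \<noteq> j\<close> by blast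
  from H.proj_rel[OF this] show "H.p (h_x i) * H.p (h_y j) - H.p (h_y j) * H.p (h_x i)
    = - (H.p (scal k) * (H.Pz i j * H.p (gen (HG (perm_mat n (transpose i j))))))"
    by (simp only: ps)
qed

sublocale HC: cher_presented n l \<zeta> k h "\<lambda>c. H.p (scal c)" "\<lambda>w. H.p (gen (HG (perm_mat n w)))"
  "\<lambda>i. H.p (gen (HG (t_mat n \<zeta> i)))" "\<lambda>i. H.p (h_x i)" "\<lambda>i. H.p (h_y i)"
proof unfold_locales
  show "H.alg (H.p (h_x i))" "H.alg (H.p (h_y i))" for i by simp_all
qed (rule H_rels; assumption)+

text \<open>Clears the denominator of \<open>a_pi\<close>, so that k l \<pi>_{j,j+1} becomes k times
  the plain sum \<open>Pi\<close>; the invertibility of l in the field enters here.\<close>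

lemma l_inverse: "k * of_nat l * [:inverse (of_nat l):] = k"
proof -
  have "of_nat l * [:inverse (of_nat l):] = (1 :: 'k poly)"
    using l_nonzero by (simp add: of_nat_poly one_pCons)
  then show ?thesis by (simp only: mult.assoc mult_1_right)
qed

lemma A_pi: "A.p (scal (k * of_nat l) * a_pi n l \<zeta> j) = A.p (scal k) * A.Pi j (Suc j)"
proof -
  have "scal (k * of_nat l) * a_pi n l \<zeta> j = scal (k * of_nat l * [:inverse (of_nat l):]) * (\<Sum>a=0..l-1. a_tt n l \<zeta> j (j + 1) a)"
    by (simp only: a_pi_def scal_mult mult.assoc)
  then show ?thesis
    by (simp only: l_inverse a_tt_def proj_mult proj_sum A.p_sum_tt Suc_eq_plus1)
qed

text \<open>The two indices adjacent to \<open>{1..n}\<close>; they turn the integer-indexed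
  relations into the wrap-around relations between t_1 and t_n.\<close>

lemma a_t_wrap:
  "a_t n \<zeta> 0 = scal [:\<zeta>:] * gen (AG (t_mat n \<zeta> n))"
  "a_t n \<zeta> (int n + 1) = scal [:inverse \<zeta>:] * gen (AG (t_mat n \<zeta> 1))"
proof -
  have "res_ix n 0 = n" "quot_ix n 0 = -1"
    using ix_shift[OF n_pos, of "int n"] ix_in_range[of n n] n_pos by simp_all
  then show "a_t n \<zeta> 0 = scal [:\<zeta>:] * gen (AG (t_mat n \<zeta> n))" by (simp add: a_t_def)
  have "res_ix n (int n + 1) = 1" "quot_ix n (int n + 1) = 1"
    using ix_shift[OF n_pos, of "int n + 1"] ix_in_range[of 1 n] n_pos by simp_all
  then show "a_t n \<zeta> (int n + 1) = scal [:inverse \<zeta>:] * gen (AG (t_mat n \<zeta> 1))"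
    by (simp add: a_t_def power_int_minus)
qed

sublocale AC: a_presented n l \<zeta> k h "\<lambda>c. A.p (scal c)" "\<lambda>w. A.p (gen (AG (perm_mat n w)))"
  "\<lambda>i. A.p (gen (AG (t_mat n \<zeta> i)))" "A.p a_sigma" "A.p a_tau" "\<lambda>i. A.p (gen (AU i))"
proof unfold_locales
  note a = a_rels_def[of n l \<zeta> k h]
  note ps = proj_add proj_mult proj_diff proj_uminus proj_sum a_r_def a_w_def a_tt_def A.p_S A.p_p_eval Suc_eq_plus1
  have bases: "a_u n (int i) = gen (AU i)" "a_t n \<zeta> (int i) = gen (AG (t_mat n \<zeta> i))" if "i \<in> {1..n}" for i
    using that by (rule a_u_base a_t_base)+
  show "A.alg (A.p a_sigma)" "A.alg (A.p a_tau)" "A.alg (A.p (gen (AU i)))" for i by simp_all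
  {
    fix j assume j: "1 \<le> j" "j < n"
    then have j': "1 \<le> j \<and> j \<le> n - 1" and I: "j \<in> {1..n}" "j + 1 \<in> {1..n}" by auto
    have "(a_u n (int j) * a_r n j - a_r n j * a_u n (int j + 1), scal (k * of_nat l) * a_pi n l \<zeta> j) \<in> a_rels n l \<zeta> k h"
      unfolding a
      \<comment> \<open>Twelve families follow this one in the left-nested union.\<close>
      by (rule UnI1, rule UnI1, rule UnI1, rule UnI1, rule UnI1, rule UnI1, rule UnI1, rule UnI1,
          rule UnI1, rule UnI1, rule UnI1, rule UnI1, rule UnI2, rule CollectI, rule exI[of _ j],
          rule conjI[OF refl j'])
    note rel = A.proj_rel[OF this]
    have next_u: "a_u n (int j + 1) = gen (AU (j + 1))" using bases(1)[OF I(2)] by (simp add: add.commute)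
    from rel have "A.p (gen (AU j) * a_r n j - a_r n j * gen (AU (j + 1))) = A.p (scal k) * A.Pi j (Suc j)"
      by (simp only: next_u bases(1)[OF I(1)] A_pi)
    then show "A.p (gen (AU j)) * A.p (gen (AG (perm_mat n (transpose j (Suc j)))))
        - A.p (gen (AG (perm_mat n (transpose j (Suc j))))) * A.p (gen (AU (Suc j))) = A.p (scal k) * A.Pi j (Suc j)"
      by (simp only: ps)
    have "(a_t n \<zeta> (int (j + 1)) * a_sigma, a_sigma * a_t n \<zeta> (int (j + 1) - 1)) \<in> a_rels n l \<zeta> k h"
      "(a_t n \<zeta> (int j) * a_tau, a_tau * a_t n \<zeta> (int j + 1)) \<in> a_rels n l \<zeta> k h"
      unfolding a by blast+
    moreover have "int (j + 1) - 1 = int j" "int j + 1 = int (j + 1)" by simp_all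
    ultimately have "(gen (AG (t_mat n \<zeta> (j + 1))) * a_sigma, a_sigma * gen (AG (t_mat n \<zeta> j))) \<in> a_rels n l \<zeta> k h"
      "(gen (AG (t_mat n \<zeta> j)) * a_tau, a_tau * gen (AG (t_mat n \<zeta> (j + 1)))) \<in> a_rels n l \<zeta> k h"
      by (simp_all only: bases I)
    from this[THEN A.proj_rel]
    show "A.p (gen (AG (t_mat n \<zeta> (Suc j)))) * A.p a_sigma = A.p a_sigma * A.p (gen (AG (t_mat n \<zeta> j)))"
      "A.p (gen (AG (t_mat n \<zeta> j))) * A.p a_tau = A.p a_tau * A.p (gen (AG (t_mat n \<zeta> (Suc j))))"
      by (simp_all only: ps)
  }
  {
    fix j assume "1 \<le> j" "Suc j < n"
    then have j': "2 \<le> j + 1 \<and> j + 1 \<le> n - 1" by auto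
    have "(a_sigma * a_r n (j + 1 - 1), a_r n (j + 1) * a_sigma) \<in> a_rels n l \<zeta> k h"
      "(a_tau * a_r n (j + 1), a_r n (j + 1 - 1) * a_tau) \<in> a_rels n l \<zeta> k h"
      unfolding a using j' by blast+
    from this[THEN A.proj_rel]
    show "A.p a_sigma * A.p (gen (AG (perm_mat n (transpose j (Suc j)))))
        = A.p (gen (AG (perm_mat n (transpose (Suc j) (Suc (Suc j)))))) * A.p a_sigma"
      "A.p a_tau * A.p (gen (AG (perm_mat n (transpose (Suc j) (Suc (Suc j))))))
        = A.p (gen (AG (perm_mat n (transpose j (Suc j))))) * A.p a_tau"
      by (simp_all only: ps add_diff_cancel_right')
  }
  {
    assume n2: "n \<ge> 2"
    have eqs: "n - 1 + 1 = n" "(1::nat) + 1 = 2" using n2 by auto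
    have "(a_sigma ^ 2 * a_r n (n - 1), a_r n 1 * a_sigma ^ 2) \<in> a_rels n l \<zeta> k h"
      "(a_tau ^ 2 * a_r n 1, a_r n (n - 1) * a_tau ^ 2) \<in> a_rels n l \<zeta> k h"
      "(a_tau * a_w n (transpose 1 2) * a_sigma, a_sigma * a_w n (transpose (n - 1) n) * a_tau
           + scal k * (\<Sum>a=0..l-1. scal [:\<zeta> ^ a:] * a_tt n l \<zeta> n 1 a)) \<in> a_rels n l \<zeta> k h"
      unfolding a if_P[OF n2] by blast+
    note rels = this[THEN A.proj_rel]
    show "A.p a_sigma ^ 2 * A.p (gen (AG (perm_mat n (transpose (n - 1) n))))
        = A.p (gen (AG (perm_mat n (transpose 1 2)))) * A.p a_sigma ^ 2"
      "A.p a_tau ^ 2 * A.p (gen (AG (perm_mat n (transpose 1 2))))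
        = A.p (gen (AG (perm_mat n (transpose (n - 1) n)))) * A.p a_tau ^ 2"
      using rels(1,2) by (simp_all only: power2_eq_square a_r_def a_w_def proj_mult eqs)
    have "(\<Sum>a=0..l-1. A.p (scal [:\<zeta> ^ a:]) * A.p (gen (AG (tt_mat n l \<zeta> n 1 a)))) = A.Pz 1 n"
      unfolding A.Pz_sym[OF A.in_range] using l_pos by (intro sum.cong refl) (simp add: A.p_tt)
    with rels(3) show "A.p a_tau * A.p (gen (AG (perm_mat n (transpose 1 2)))) * A.p a_sigma
        = A.p a_sigma * A.p (gen (AG (perm_mat n (transpose (n - 1) n)))) * A.p a_tau + A.p (scal k) * A.Pz 1 n"
      by (simp only: ps)
  }
  have "(a_sigma * a_tau, a_u n 1 - p_eval l \<zeta> h (scal [:inverse \<zeta>:] * a_t n \<zeta> 1) + scal hbar) \<in> a_rels n l \<zeta> k h"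
    "(a_tau * a_sigma, a_u n (int n) - p_eval l \<zeta> h (a_t n \<zeta> (int n))) \<in> a_rels n l \<zeta> k h"
    "(a_t n \<zeta> 1 * a_sigma, a_sigma * a_t n \<zeta> (1 - 1)) \<in> a_rels n l \<zeta> k h"
    "(a_t n \<zeta> (int n) * a_tau, a_tau * a_t n \<zeta> (int n + 1)) \<in> a_rels n l \<zeta> k h"
    unfolding a by blast+
  note rels = this[THEN A.proj_rel]
  have one: "a_u n 1 = gen (AU 1)" "a_t n \<zeta> 1 = gen (AG (t_mat n \<zeta> 1))"
    using bases[OF A.in_range(1)] by simp_all
  show "A.p a_sigma * A.p a_tau = A.p (gen (AU 1))
      - A.pe (A.p (scal [:inverse \<zeta>:]) * A.p (gen (AG (t_mat n \<zeta> 1)))) + A.p (scal hbar)"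
    using rels(1) by (simp only: one ps)
  show "A.p a_tau * A.p a_sigma = A.p (gen (AU n)) - A.pe (A.p (gen (AG (t_mat n \<zeta> n))))"
    using rels(2) by (simp only: bases[OF A.in_range(2)] ps)
  have "A.p (gen (AG (t_mat n \<zeta> 1))) * A.p a_sigma = A.p a_sigma * (A.p (scal [:\<zeta>:]) * A.p (gen (AG (t_mat n \<zeta> n))))"
    using rels(3) by (simp only: one diff_self a_t_wrap proj_mult)
  then show "A.p (gen (AG (t_mat n \<zeta> 1))) * A.p a_sigma = A.p (scal [:\<zeta>:]) * (A.p a_sigma * A.p (gen (AG (t_mat n \<zeta> n))))"
    by (simp only: A.sc_left[OF A.alg_p[of a_sigma]])
  have z: "[:\<zeta>:] * [:inverse \<zeta>:] = 1"
    using root_of_unity_nonzero[OF zeta l_pos] by (simp add: one_pCons)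
  \<comment> \<open>The relation at index n carries t_{n+1} = \<zeta>^{-1} t_1; multiplying it by
    \<zeta> frees t_1 of the scalar.\<close>
  have "A.p (scal [:\<zeta>:]) * (A.p (gen (AG (t_mat n \<zeta> n))) * A.p a_tau)
      = A.p (scal [:\<zeta>:]) * (A.p a_tau * (A.p (scal [:inverse \<zeta>:]) * A.p (gen (AG (t_mat n \<zeta> 1)))))"
    using rels(4) by (simp only: bases[OF A.in_range(2)] a_t_wrap proj_mult)
  also have "\<dots> = A.p (scal ([:\<zeta>:] * [:inverse \<zeta>:])) * (A.p a_tau * A.p (gen (AG (t_mat n \<zeta> 1))))"
    by (simp only: A.sc_left[OF A.alg_p[of a_tau]] scal_mult proj_mult mult.assoc)
  finally show "A.p a_tau * A.p (gen (AG (t_mat n \<zeta> 1))) = A.p (scal [:\<zeta>:]) * (A.p (gen (AG (t_mat n \<zeta> n))) * A.p a_tau)"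
    by (simp only: z A.alg_unit(1)[OF A.alg_mult] A.alg_p)
qed

section \<open>Images in H of the relations of A\<close>

abbreviation to_cher :: "('k mat a_gen, 'k poly) ncpoly \<Rightarrow> ('k mat cher_gen, 'k poly) ncpoly quotients"
  where "to_cher f \<equiv> H.p (subst (a_to_cher n l \<zeta> k h) f)"

lemma to_cher_ring: "to_cher (f + g) = to_cher f + to_cher g" "to_cher (f - g) = to_cher f - to_cher g" "to_cher (f * g) = to_cher f * to_cher g" "to_cher (- f) = - to_cher f"
  "to_cher (sum F A) = (\<Sum>a\<in>A. to_cher (F a))" "to_cher (scal c) = H.p (scal c)" "to_cher (p_eval l \<zeta> h f) = H.pe (to_cher f)"
  by (simp_all add: H.p_p_eval)

lemma to_cher_group: "to_cher (gen (AG g)) = H.p (gen (HG g))"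
  "to_cher (a_w n w) = H.p (gen (HG (perm_mat n w)))"
  "to_cher (a_r n j) = H.p (gen (HG (perm_mat n (transpose j (Suc j)))))"
  "to_cher (a_tt n l \<zeta> i j a) = H.p (gen (HG (tt_mat n l \<zeta> i j a)))"
  "to_cher (a_t n \<zeta> m) = H.tt m"
  by (simp_all add: a_r_def a_w_def a_tt_def a_t_def H.tt_def)

lemma to_cher_sigma: "to_cher a_sigma = HC.sigma"
  by (simp add: a_sigma_def HC.sigma_def h_w_def del: One_nat_def)

lemma to_cher_tau: "to_cher a_tau = HC.tau"
  by (simp add: a_tau_def HC.tau_def h_w_def del: One_nat_def)

lemma to_cher_AU: "to_cher (gen (AU i)) = HC.U i"
  by (simp only: subst_gen a_to_cher.simps H_dunkl HC.U_def)

lemma to_cher_u: "to_cher (a_u n m) = H.uu HC.U m"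
  by (simp only: a_u_def to_cher_ring to_cher_AU H.uu_def)

lemma to_cher_pi: "to_cher (scal (k * of_nat l) * a_pi n l \<zeta> j) = H.p (scal k) * H.Pi j (Suc j)"
proof -
  have "scal (k * of_nat l) * a_pi n l \<zeta> j = scal (k * of_nat l * [:inverse (of_nat l):]) * (\<Sum>a=0..l-1. a_tt n l \<zeta> j (j + 1) a)"
    by (simp only: a_pi_def scal_mult mult.assoc)
  then show ?thesis
    by (simp only: l_inverse to_cher_ring to_cher_group H.p_sum_tt Suc_eq_plus1)
qed

lemma uu_base: "i \<in> {1..n} \<Longrightarrow> H.uu HC.U (int i) = HC.U i"
  by (simp add: H.uu_def ix_in_range)

lemma tt_base: "i \<in> {1..n} \<Longrightarrow> H.tt (int i) = H.p (gen (HG (t_mat n \<zeta> i)))"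
  using H.alg_unit(1)[OF H.alg_T] by (simp add: H.tt_def ix_in_range flip: one_pCons)

lemma uu_Suc: "1 \<le> j \<Longrightarrow> j \<le> n - 1 \<Longrightarrow> H.uu HC.U (int j + 1) = HC.U (Suc j)"
  using uu_base[of "Suc j"] by (simp add: add.commute)

lemmas to_cher_simps = to_cher_ring to_cher_group to_cher_sigma to_cher_tau to_cher_u to_cher_pi

lemma H_power2: "to_cher (a_sigma ^ 2) = HC.sigma ^ 2" "to_cher (a_tau ^ 2) = HC.tau ^ 2"
  by (simp_all only: power2_eq_square to_cher_simps)

lemma to_cher_group_rels:
  "g \<in> carrier (monomial_group n l) \<Longrightarrow> g' \<in> carrier (monomial_group n l)
    \<Longrightarrow> to_cher (gen (AG g) * gen (AG g')) = to_cher (gen (AG (g \<otimes>\<^bsub>monomial_group n l\<^esub> g')))"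
  "to_cher (gen (AG (\<one>\<^bsub>monomial_group n l\<^esub>))) = to_cher 1"
  using H.p_one by (simp_all only: to_cher_simps H.p_mult monomial_group_simps scal_1 subst_1)

lemma to_cher_rels:
  "1 \<le> j \<and> j \<le> n - 1 \<Longrightarrow> to_cher (a_u n (int j + 1) * a_r n j - a_r n j * a_u n (int j))
    = to_cher (- (scal (k * of_nat l) * a_pi n l \<zeta> j))"
  "1 \<le> j \<and> j \<le> n - 1 \<Longrightarrow> to_cher (a_u n (int j) * a_r n j - a_r n j * a_u n (int j + 1))
    = to_cher (scal (k * of_nat l) * a_pi n l \<zeta> j)"
  "1 \<le> j \<and> j \<le> n - 1 \<and> i \<in> {1..n} - {j, j + 1} \<Longrightarrow> to_cher (a_u n (int i) * a_r n j) = to_cher (a_r n j * a_u n (int i))"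
  "2 \<le> j \<and> j \<le> n - 1 \<Longrightarrow> to_cher (a_sigma * a_r n (j - 1)) = to_cher (a_r n j * a_sigma)"
  "2 \<le> j \<and> j \<le> n - 1 \<Longrightarrow> to_cher (a_tau * a_r n j) = to_cher (a_r n (j - 1) * a_tau)"
proof -
  show "to_cher (a_u n (int j + 1) * a_r n j - a_r n j * a_u n (int j)) = to_cher (- (scal (k * of_nat l) * a_pi n l \<zeta> j))"
    "to_cher (a_u n (int j) * a_r n j - a_r n j * a_u n (int j + 1)) = to_cher (scal (k * of_nat l) * a_pi n l \<zeta> j)"
    if "1 \<le> j \<and> j \<le> n - 1"
  proof -
    have j: "1 \<le> j" "j < n" "j \<in> {1..n}" "j \<le> n - 1" using that n_pos by auto
    show "to_cher (a_u n (int j + 1) * a_r n j - a_r n j * a_u n (int j)) = to_cher (- (scal (k * of_nat l) * a_pi n l \<zeta> j))"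
      "to_cher (a_u n (int j) * a_r n j - a_r n j * a_u n (int j + 1)) = to_cher (scal (k * of_nat l) * a_pi n l \<zeta> j)"
      unfolding to_cher_ring(2,4) to_cher_pi unfolding to_cher_simps uu_base[OF j(3)] uu_Suc[OF j(1,4)]
        HC.W_r_U[OF j(1,2)] HC.U_W_r[OF j(1,2)] by simp_all
  qed
  show "to_cher (a_u n (int i) * a_r n j) = to_cher (a_r n j * a_u n (int i))"
    if "1 \<le> j \<and> j \<le> n - 1 \<and> i \<in> {1..n} - {j, j + 1}"
  proof -
    have j: "1 \<le> j" "j < n" "i \<in> {1..n}" "i \<noteq> j" "i \<noteq> Suc j" using that n_pos by auto
    show ?thesis unfolding to_cher_simps uu_base[OF j(3)] by (rule HC.U_W_r_other[OF j, symmetric])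
  qed
  show "to_cher (a_sigma * a_r n (j - 1)) = to_cher (a_r n j * a_sigma)"
    "to_cher (a_tau * a_r n j) = to_cher (a_r n (j - 1) * a_tau)" if "2 \<le> j \<and> j \<le> n - 1"
  proof -
    have j: "1 \<le> j - 1" "Suc (j - 1) < n" "Suc (j - 1) = j" using that n_pos by auto
    show "to_cher (a_sigma * a_r n (j - 1)) = to_cher (a_r n j * a_sigma)" "to_cher (a_tau * a_r n j) = to_cher (a_r n (j - 1) * a_tau)"
      unfolding to_cher_simps using HC.sigma_W_r[OF j(1,2)] HC.tau_W_r[OF j(1,2)] by (simp_all only: j(3))
  qed
qed

lemma to_cher_rels_comm: "to_cher (a_u n i * a_t n \<zeta> j) = to_cher (a_t n \<zeta> j * a_u n i)" "to_cher (a_u n i * a_u n j) = to_cher (a_u n j * a_u n i)"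
proof -
  note r = H.res_ix_in[of i] H.res_ix_in[of j]
  show "to_cher (a_u n i * a_t n \<zeta> j) = to_cher (a_t n \<zeta> j * a_u n i)"
    unfolding to_cher_simps
    by (rule H.uu_comm) (use r in \<open>auto intro!: H.tt_intertwine H.alg_tt HC.alg_U HC.U_T simp del: One_nat_def\<close>)
  \<comment> \<open>\<open>uu_comm\<close> treats one index at a time, so it is applied once for
    each of the two integer indices.\<close>
  have "H.uu HC.U j * HC.U m = HC.U m * H.uu HC.U j" if "m \<in> {1..n}" for m
    by (rule H.uu_comm) (use that in \<open>auto intro!: HC.alg_U HC.U_U simp del: One_nat_def\<close>)
  then show "to_cher (a_u n i * a_u n j) = to_cher (a_u n j * a_u n i)"
    unfolding to_cher_simps
    by (intro H.uu_comm) (auto intro!: HC.alg_U H.alg_uu simp del: One_nat_def)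
qed

lemma to_cher_rels_shift:
  "to_cher (a_u n i * a_sigma) = to_cher (a_sigma * a_u n (i - 1))" "to_cher (a_u n i * a_tau) = to_cher (a_tau * a_u n (i + 1))"
  "to_cher (a_t n \<zeta> i * a_sigma) = to_cher (a_sigma * a_t n \<zeta> (i - 1))" "to_cher (a_t n \<zeta> i * a_tau) = to_cher (a_tau * a_t n \<zeta> (i + 1))"
  unfolding to_cher_simps
  by (rule H.uu_right[OF HC.alg_sigma HC.U_sigma HC.U_1_sigma], assumption+,
      rule H.uu_left[OF HC.alg_tau HC.U_tau HC.U_n_tau], assumption+,
      rule H.tt_right[OF HC.alg_sigma HC.T_sigma HC.T_1_sigma], assumption+,
      rule H.tt_left[OF HC.alg_tau HC.T_tau HC.tau_T_1])

lemma to_cher_rels_product: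
  "to_cher (a_sigma * a_tau) = to_cher (a_u n 1 - p_eval l \<zeta> h (scal [:inverse \<zeta>:] * a_t n \<zeta> 1) + scal hbar)"
  "to_cher (a_tau * a_sigma) = to_cher (a_u n (int n) - p_eval l \<zeta> h (a_t n \<zeta> (int n)))"
  using uu_base[OF H.in_range(1)] tt_base[OF H.in_range(1)]
  by (simp_all only: to_cher_simps HC.sigma_tau HC.tau_sigma uu_base[OF H.in_range(2)] tt_base[OF H.in_range(2)] of_nat_1)

lemma to_cher_rels_2:
  assumes "n \<ge> 2"
  shows "to_cher (a_sigma ^ 2 * a_r n (n - 1)) = to_cher (a_r n 1 * a_sigma ^ 2)"
    "to_cher (a_tau ^ 2 * a_r n 1) = to_cher (a_r n (n - 1) * a_tau ^ 2)"
    "to_cher (a_tau * a_w n (transpose 1 2) * a_sigma) = to_cher (a_sigma * a_w n (transpose (n - 1) n) * a_tau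
           + scal k * (\<Sum>a=0..l-1. scal [:\<zeta> ^ a:] * a_tt n l \<zeta> n 1 a))"
proof -
  have n: "Suc (n - 1) = n" "Suc 1 = 2" using assms by auto
  show "to_cher (a_sigma ^ 2 * a_r n (n - 1)) = to_cher (a_r n 1 * a_sigma ^ 2)"
    "to_cher (a_tau ^ 2 * a_r n 1) = to_cher (a_r n (n - 1) * a_tau ^ 2)"
    unfolding to_cher_ring(3) H_power2 to_cher_group n by (rule HC.sigma_sq_W_r HC.tau_sq_W_r, rule assms)+
  have "(\<Sum>a=0..l-1. H.p (scal [:\<zeta> ^ a:]) * H.p (gen (HG (tt_mat n l \<zeta> n 1 a)))) = H.Pz 1 n"
    unfolding H.Pz_sym[OF H.in_range] using l_pos by (intro sum.cong refl) (simp add: H.p_tt)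
  then show "to_cher (a_tau * a_w n (transpose 1 2) * a_sigma) = to_cher (a_sigma * a_w n (transpose (n - 1) n) * a_tau
           + scal k * (\<Sum>a=0..l-1. scal [:\<zeta> ^ a:] * a_tt n l \<zeta> n 1 a))"
    by (simp only: to_cher_simps HC.tau_W_sigma[OF assms])
qed

section \<open>Images in A of the relations of H\<close>

abbreviation to_a :: "('k mat cher_gen, 'k poly) ncpoly \<Rightarrow> ('k mat a_gen, 'k poly) ncpoly quotients"
  where "to_a f \<equiv> A.p (subst (cher_to_a n l) f)"

lemma to_a_ring: "to_a (f + g) = to_a f + to_a g" "to_a (f - g) = to_a f - to_a g" "to_a (f * g) = to_a f * to_a g" "to_a (- f) = - to_a f"
  "to_a (sum F B) = (\<Sum>a\<in>B. to_a (F a))" "to_a (scal c) = A.p (scal c)" "to_a (p_eval l \<zeta> h f) = A.pe (to_a f)"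
  by (simp_all add: A.p_p_eval)

lemma to_a_group: "to_a (gen (HG g)) = A.p (gen (AG g))"
  "to_a (h_w n w) = A.p (gen (AG (perm_mat n w)))"
  "to_a (h_tt n l \<zeta> i j a) = A.p (gen (AG (tt_mat n l \<zeta> i j a)))"
  "to_a (h_t n \<zeta> i) = A.p (gen (AG (t_mat n \<zeta> i)))"
  by (simp_all add: h_w_def h_tt_def h_t_def)

lemma cycles_permute: "i \<in> {1..n} \<Longrightarrow> upsilon_cycle n i permutes {1..n}" "i \<in> {1..n} \<Longrightarrow> chi_cycle i permutes {1..n}"
  by (intro upsilon_cycle_permutes chi_cycle_permutes; simp)+

lemma to_a_x: "i \<in> {1..n} \<Longrightarrow> to_a (h_x i) = AC.X i"
  by (simp only: h_x_def subst_gen cher_to_a.simps a_w_def proj_mult A.p_inv_perm_mat cycles_permute AC.X_eq)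

lemma to_a_y: "i \<in> {1..n} \<Longrightarrow> to_a (h_y i) = AC.Y i"
  by (simp only: h_y_def subst_gen cher_to_a.simps a_w_def proj_mult A.p_inv_perm_mat cycles_permute AC.Y_eq)

lemmas to_a_simps = to_a_ring to_a_group to_a_x to_a_y

lemma to_a_group_rels:
  "g \<in> carrier (monomial_group n l) \<Longrightarrow> g' \<in> carrier (monomial_group n l)
    \<Longrightarrow> to_a (gen (HG g) * gen (HG g')) = to_a (gen (HG (g \<otimes>\<^bsub>monomial_group n l\<^esub> g')))"
  "to_a (gen (HG (\<one>\<^bsub>monomial_group n l\<^esub>))) = to_a 1"
  using A.p_one by (simp_all only: to_a_simps A.p_mult monomial_group_simps scal_1 subst_1)

lemma to_a_rels:
  "i \<in> {1..n} \<Longrightarrow> j \<in> {1..n} \<Longrightarrow> to_a (h_x i * h_x j) = to_a (h_x j * h_x i)"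
  "i \<in> {1..n} \<Longrightarrow> j \<in> {1..n} \<Longrightarrow> to_a (h_y i * h_y j) = to_a (h_y j * h_y i)"
  "i \<in> {1..n} \<Longrightarrow> j \<in> {1..n}
    \<Longrightarrow> to_a (h_t n \<zeta> i * h_x j) = to_a (scal [:if i = j then \<zeta> else 1:] * h_x j * h_t n \<zeta> i)"
  "i \<in> {1..n} \<Longrightarrow> j \<in> {1..n}
    \<Longrightarrow> to_a (h_t n \<zeta> i * h_y j) = to_a (scal [:if i = j then inverse \<zeta> else 1:] * h_y j * h_t n \<zeta> i)"
  "i \<in> {1..n} \<Longrightarrow> to_a (h_x i * h_y i - h_y i * h_x i)
    = to_a (scal hbar
          + scal k * (\<Sum>j\<in>{1..n}-{i}. \<Sum>a=0..l-1. h_tt n l \<zeta> i j a * h_w n (transpose i j))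
          + p_eval l \<zeta> h (h_t n \<zeta> i) - p_eval l \<zeta> h (scal [:inverse \<zeta>:] * h_t n \<zeta> i))"
  "i \<in> {1..n} \<Longrightarrow> j \<in> {1..n} \<Longrightarrow> i \<noteq> j \<Longrightarrow> to_a (h_x i * h_y j - h_y j * h_x i)
    = to_a (- (scal k * (\<Sum>a=0..l-1. scal [:inverse \<zeta> ^ a:] * h_tt n l \<zeta> i j a * h_w n (transpose i j))))"
  by (simp_all only: to_a_simps A.p_S A.p_Pz AC.X_Y_same AC.X_Y_diff AC.T_X AC.T_Y AC.X_comm[of i j] AC.Y_comm[of i j]
      not_False_eq_True)

lemma to_a_rels_w:
  assumes "w permutes {1..n}" "i \<in> {1..n}"
  shows "to_a (h_w n w * h_x i) = to_a (h_x (w i) * h_w n w)" "to_a (h_w n w * h_y i) = to_a (h_y (w i) * h_w n w)"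
proof -
  have "w i \<in> {1..n}" using permutes_in_image[OF assms(1)] assms(2) by simp
  with assms show "to_a (h_w n w * h_x i) = to_a (h_x (w i) * h_w n w)" "to_a (h_w n w * h_y i) = to_a (h_y (w i) * h_w n w)"
    by (simp_all only: to_a_simps AC.W_x AC.W_y)
qed

end

section \<open>The two assignments are mutually inverse\<close>

context wreath_xy
begin

text \<open>\<chi>_i moves x_1 to x_i, and \<chi>_i \<omega> = \<upsilon>_i leaves a permutation
  that its inverse cancels.\<close>

lemma W_chi_sigma:
  assumes i: "i \<in> {1..n}"
  shows "W (chi_cycle i) * sigma * W (Hilbert_Choice.inv (upsilon_cycle n i)) = x i"
proof -
  have c: "chi_cycle i permutes {1..n}" and u: "upsilon_cycle n i permutes {1..n}"
    using i by (intro chi_permutes upsilon_cycle_permutes; simp)+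
  have x: "W (chi_cycle i) * x 1 = x i * W (chi_cycle i)"
    using W_x[OF c in_range(1)] i by (simp only: chi_cycle_apply_1 atLeastAtMost_iff)
  have "W (chi_cycle i) * W om = W (upsilon_cycle n i)"
    using i by (simp only: W_comp c om_permutes chi_upsilon atLeastAtMost_iff)
  then have "W (chi_cycle i) * sigma = x i * W (upsilon_cycle n i)"
    by (simp only: sigma_def mult_left_assoc[OF x] mult.assoc)
  then show ?thesis by (simp only: mult.assoc W_inverse[OF u] alg_unit(2)[OF alg_x[OF i]])
qed

lemma W_upsilon_tau:
  assumes i: "i \<in> {1..n}"
  shows "W (upsilon_cycle n i) * tau * W (Hilbert_Choice.inv (chi_cycle i)) = y i"
proof -
  have c: "chi_cycle i permutes {1..n}" using i by (rule chi_permutes)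
  have y: "W (chi_cycle i) * y 1 = y i * W (chi_cycle i)"
    using W_y[OF c in_range(1)] i by (simp only: chi_cycle_apply_1 atLeastAtMost_iff)
  have "W (upsilon_cycle n i) = W (chi_cycle i) * W om"
    using i by (simp only: W_comp c om_permutes chi_upsilon atLeastAtMost_iff)
  then have "W (upsilon_cycle n i) * W om' = W (chi_cycle i)"
    by (simp only: mult.assoc W_inverse om_permutes alg_unit(2)[OF alg_W[OF c]])
  then have "W (upsilon_cycle n i) * tau = y i * W (chi_cycle i)"
    by (simp only: tau_def y flip: mult.assoc)
  then show ?thesis by (simp only: mult.assoc W_inverse[OF c] alg_unit(2)[OF alg_y[OF i]])
qed

end

context cherednik
begin

text \<open>Splitting on \<open>n \<ge> 2\<close> decides the conditional families, after which each
  family matches one of the preceding lemmas.\<close>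

lemma a_rels_hold:
  assumes "(a, b) \<in> a_rels n l \<zeta> k h"
  shows "to_cher a = to_cher b"
proof (cases "n \<ge> 2")
  case True
  from assms show ?thesis
    unfolding a_rels_def group_rels_def if_P[OF True]
    by (elim UnE CollectE exE conjE insertE emptyE Pair_inject)
      (hypsubst, (rule to_cher_group_rels to_cher_rels to_cher_rels_comm to_cher_rels_shift to_cher_rels_product to_cher_rels_2[OF True]; (intro conjI)?; assumption))+
next
  case False
  from assms show ?thesis
    unfolding a_rels_def group_rels_def if_not_P[OF False]
    by (elim UnE CollectE exE conjE insertE emptyE Pair_inject)
      (hypsubst, (rule to_cher_group_rels to_cher_rels to_cher_rels_comm to_cher_rels_shift to_cher_rels_product; (intro conjI)?; assumption))+
qed

lemma cher_rels_hold:
  assumes "(a, b) \<in> cher_rels n l \<zeta> k h"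
  shows "to_a a = to_a b"
  using assms unfolding cher_rels_def group_rels_def
  by (elim UnE CollectE exE conjE insertE emptyE Pair_inject)
    (hypsubst, (rule to_a_group_rels to_a_rels to_a_rels_w; assumption))+

lemma to_a_dunkl: "i \<in> {1..n} \<Longrightarrow> to_a (dunkl_opdam n l \<zeta> k h i) = A.p (gen (AU i))"
  by (simp only: dunkl_opdam_def to_a_simps A.p_S AC.Y_X) simp

lemma to_cher_cher_to_a:
  assumes "z \<in> cher_gens n l"
  shows "to_cher (cher_to_a n l z) = H.p (gen z)"
proof (cases z)
  case (HG g)
  then show ?thesis by (simp only: cher_to_a.simps to_cher_group)
next
  case (HX i)
  with assms have i: "i \<in> {1..n}" by (auto simp: cher_gens_def)
  then show ?thesis
    using HC.W_chi_sigma[OF i]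
    by (simp only: HX cher_to_a.simps to_cher_simps H.p_inv_perm_mat cycles_permute h_x_def)
next
  case (HY i)
  with assms have i: "i \<in> {1..n}" by (auto simp: cher_gens_def)
  then show ?thesis
    using HC.W_upsilon_tau[OF i]
    by (simp only: HY cher_to_a.simps to_cher_simps H.p_inv_perm_mat cycles_permute h_y_def)
qed

lemma to_a_a_to_cher:
  assumes "z \<in> a_gens n l"
  shows "to_a (a_to_cher n l \<zeta> k h z) = A.p (gen z)"
proof (cases z)
  case (AG g)
  then show ?thesis by (simp only: a_to_cher.simps to_a_group)
next
  case ASigma
  have "to_a (a_to_cher n l \<zeta> k h z) = A.p a_sigma"
    by (simp only: ASigma a_to_cher.simps to_a_simps A.in_range AC.sigma_X[unfolded AC.sigma_def])
  then show ?thesis by (simp only: ASigma a_sigma_def)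
next
  case ATau
  have "to_a (a_to_cher n l \<zeta> k h z) = A.p a_tau"
    by (simp only: ATau a_to_cher.simps to_a_simps A.in_range AC.tau_Y[unfolded AC.tau_def])
  then show ?thesis by (simp only: ATau a_tau_def)
next
  case (AU i)
  with assms have "i \<in> {1..n}" by (auto simp: a_gens_def)
  then show ?thesis by (simp only: AU a_to_cher.simps to_a_dunkl)
qed

lemma dunkl_opdam_in: "i \<in> {1..n} \<Longrightarrow> dunkl_opdam n l \<zeta> k h i \<in> poly_in (cher_gens n l)"
  unfolding dunkl_opdam_def
  by (intro poly_in_add poly_in_mult poly_in_sum poly_in_scal poly_in_p_eval
      cher_gens_in[OF n_pos l_pos zeta] transpose_permutes) auto

lemma inv_perm_mat_in:
  "w permutes {1..n} \<Longrightarrow> inv\<^bsub>monomial_group n l\<^esub> (perm_mat n w) \<in> carrier (monomial_group n l :: 'k mat monoid)"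
  by (simp only: inv_perm_mat[OF l_pos] perm_mat_in[OF l_pos] permutes_inv)

lemma cher_to_a_in: "\<forall>z\<in>(cher_gens n l :: 'k mat cher_gen set). cher_to_a n l z \<in> poly_in (a_gens n l)"
proof
  fix z :: "'k mat cher_gen" assume "z \<in> cher_gens n l"
  then show "cher_to_a n l z \<in> poly_in (a_gens n l)"
  proof (cases z)
    case (HG g)
    with \<open>z \<in> cher_gens n l\<close> have "g \<in> carrier (monomial_group n l)" by (auto simp: cher_gens_def)
    then show ?thesis unfolding HG cher_to_a.simps by (rule a_gens_in[OF n_pos l_pos zeta])
  next
    case (HX i)
    with \<open>z \<in> cher_gens n l\<close> have "i \<in> {1..n}" by (auto simp: cher_gens_def)
    then show ?thesis
      unfolding HX cher_to_a.simps
      by (intro poly_in_mult a_gens_in[OF n_pos l_pos zeta] inv_perm_mat_in cycles_permute)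
  next
    case (HY i)
    with \<open>z \<in> cher_gens n l\<close> have "i \<in> {1..n}" by (auto simp: cher_gens_def)
    then show ?thesis
      unfolding HY cher_to_a.simps
      by (intro poly_in_mult a_gens_in[OF n_pos l_pos zeta] inv_perm_mat_in cycles_permute)
  qed
qed

lemma a_to_cher_in: "\<forall>z\<in>a_gens n l. a_to_cher n l \<zeta> k h z \<in> poly_in (cher_gens n l)"
proof
  fix z :: "'k mat a_gen" assume "z \<in> a_gens n l"
  note h_in = cher_gens_in[OF n_pos l_pos zeta]
  show "a_to_cher n l \<zeta> k h z \<in> poly_in (cher_gens n l)"
    using \<open>z \<in> a_gens n l\<close> unfolding a_gens_def
    by (elim UnE imageE insertE emptyE; simp only: a_to_cher.simps;
        (intro poly_in_mult h_in H.om_permutes H.in_range dunkl_opdam_in; assumption?))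
qed

lemma isomorphism:
  "\<exists>\<phi> \<in> pres_alg_iso (cher_gens n l) (cher_rels n l \<zeta> k h)
                           (a_gens n l) (a_rels n l \<zeta> k h).
    (\<forall>f. \<phi> (cher_class n l \<zeta> k h (group_alg_elem (monomial_group n l) HG f))
         = a_class n l \<zeta> k h (group_alg_elem (monomial_group n l) AG f)) \<and>
    (\<forall>i\<in>{1..n}.
       \<phi> (cher_class n l \<zeta> k h (h_x i))
         = a_class n l \<zeta> k h (a_w n (chi_cycle i) * a_sigma
             * gen (AG (inv\<^bsub>monomial_group n l\<^esub> (perm_mat n (upsilon_cycle n i))))) \<and>
       \<phi> (cher_class n l \<zeta> k h (h_y i))
         = a_class n l \<zeta> k h (a_w n (upsilon_cycle n i) * a_tau
             * gen (AG (inv\<^bsub>monomial_group n l\<^esub> (perm_mat n (chi_cycle i))))) \<and>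
       \<phi> (cher_class n l \<zeta> k h (dunkl_opdam n l \<zeta> k h i))
         = a_class n l \<zeta> k h (a_u n (int i)))"
proof -
  let ?v = "cher_to_a n l" and ?v' = "a_to_cher n l \<zeta> k h"
  let ?X = "cher_gens n l :: 'k mat cher_gen set" and ?Y = "a_gens n l :: 'k mat a_gen set"
  have v: "subst ?v f \<in> poly_in ?Y" if "f \<in> poly_in ?X" for f
    by (rule poly_in_subst[OF that cher_to_a_in])
  have v': "subst ?v' f \<in> poly_in ?X" if "f \<in> poly_in ?Y" for f
    by (rule poly_in_subst[OF that a_to_cher_in])
  have rel: "\<forall>(a, b)\<in>cher_rels n l \<zeta> k h. pres_class ?Y (a_rels n l \<zeta> k h) (subst ?v a)
      = pres_class ?Y (a_rels n l \<zeta> k h) (subst ?v b)"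
  proof clarify
    fix a b assume ab: "(a, b) \<in> cher_rels n l \<zeta> k h"
    then have "a \<in> poly_in ?X" "b \<in> poly_in ?X" using H.rels_in by auto
    then show "pres_class ?Y (a_rels n l \<zeta> k h) (subst ?v a) = pres_class ?Y (a_rels n l \<zeta> k h) (subst ?v b)"
      by (simp only: A.pres_class_eq_proj v cher_rels_hold[OF ab])
  qed
  have rel': "\<forall>(a, b)\<in>a_rels n l \<zeta> k h. pres_class ?X (cher_rels n l \<zeta> k h) (subst ?v' a)
      = pres_class ?X (cher_rels n l \<zeta> k h) (subst ?v' b)"
  proof clarify
    fix a b assume ab: "(a, b) \<in> a_rels n l \<zeta> k h"
    then have "a \<in> poly_in ?Y" "b \<in> poly_in ?Y" using A.rels_in by auto
    then show "pres_class ?X (cher_rels n l \<zeta> k h) (subst ?v' a) = pres_class ?X (cher_rels n l \<zeta> k h) (subst ?v' b)"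
      by (simp only: H.pres_class_eq_proj v' a_rels_hold[OF ab])
  qed
  have inv: "\<forall>z\<in>?X. pres_class ?X (cher_rels n l \<zeta> k h) (subst ?v' (?v z))
      = pres_class ?X (cher_rels n l \<zeta> k h) (gen z)"
  proof
    fix z assume z: "z \<in> ?X"
    from v'[OF bspec[OF cher_to_a_in z]] z
    show "pres_class ?X (cher_rels n l \<zeta> k h) (subst ?v' (?v z)) = pres_class ?X (cher_rels n l \<zeta> k h) (gen z)"
      by (simp only: H.pres_class_eq_proj poly_in_gen to_cher_cher_to_a)
  qed
  have inv': "\<forall>z\<in>?Y. pres_class ?Y (a_rels n l \<zeta> k h) (subst ?v (?v' z))
      = pres_class ?Y (a_rels n l \<zeta> k h) (gen z)"
  proof
    fix z assume z: "z \<in> ?Y"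
    from v[OF bspec[OF a_to_cher_in z]] z
    show "pres_class ?Y (a_rels n l \<zeta> k h) (subst ?v (?v' z)) = pres_class ?Y (a_rels n l \<zeta> k h) (gen z)"
      by (simp only: A.pres_class_eq_proj poly_in_gen to_a_a_to_cher)
  qed
  obtain \<phi> where \<phi>: "\<phi> \<in> pres_alg_iso ?X (cher_rels n l \<zeta> k h) ?Y (a_rels n l \<zeta> k h)"
    and "\<forall>f\<in>poly_in ?X.
      \<phi> (pres_class ?X (cher_rels n l \<zeta> k h) f) = pres_class ?Y (a_rels n l \<zeta> k h) (subst ?v f)"
    using pres_alg_iso_subst[OF presentation_cher[OF n_pos l_pos zeta] presentation_a[OF n_pos l_pos zeta]
        cher_to_a_in a_to_cher_in rel rel' inv inv'] by (elim bexE)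
  note \<phi>_class = bspec[OF this(2)]
  show ?thesis
  proof (rule bexI[OF _ \<phi>], intro conjI allI ballI)
    fix f :: "'k mat \<Rightarrow> 'k poly"
    have "group_alg_elem (monomial_group n l) HG f \<in> poly_in ?X"
      unfolding group_alg_elem_def by (intro poly_in_sum poly_in_mult poly_in_scal cher_gens_in[OF n_pos l_pos zeta])
    then show "\<phi> (cher_class n l \<zeta> k h (group_alg_elem (monomial_group n l) HG f))
        = a_class n l \<zeta> k h (group_alg_elem (monomial_group n l) AG f)"
      by (simp add: cher_class_def a_class_def \<phi>_class) (simp add: group_alg_elem_def)
  next
    fix i assume i: "i \<in> {1..n}"
    note h_in = cher_gens_in[OF n_pos l_pos zeta]
    show "\<phi> (cher_class n l \<zeta> k h (h_x i))
         = a_class n l \<zeta> k h (a_w n (chi_cycle i) * a_sigma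
             * gen (AG (inv\<^bsub>monomial_group n l\<^esub> (perm_mat n (upsilon_cycle n i)))))"
      unfolding cher_class_def a_class_def \<phi>_class[OF h_in(2)[OF i]]
      by (simp only: h_x_def subst_gen cher_to_a.simps)
    show "\<phi> (cher_class n l \<zeta> k h (h_y i))
         = a_class n l \<zeta> k h (a_w n (upsilon_cycle n i) * a_tau
             * gen (AG (inv\<^bsub>monomial_group n l\<^esub> (perm_mat n (chi_cycle i)))))"
      unfolding cher_class_def a_class_def \<phi>_class[OF h_in(3)[OF i]]
      by (simp only: h_y_def subst_gen cher_to_a.simps)
    have "(gen (AU i) :: ('k mat a_gen, 'k poly) ncpoly) \<in> poly_in ?Y" using i by (intro poly_in_gen) (auto simp: a_gens_def)
    then show "\<phi> (cher_class n l \<zeta> k h (dunkl_opdam n l \<zeta> k h i)) = a_class n l \<zeta> k h (a_u n (int i))"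
      unfolding cher_class_def a_class_def \<phi>_class[OF dunkl_opdam_in[OF i]] a_u_base[OF i]
      by (simp only: A.pres_class_eq_proj v dunkl_opdam_in[OF i] to_a_dunkl[OF i])
  qed
qed

end

theorem theorem2p3:
  fixes n l :: nat and \<zeta> :: "'k::field" and k :: "'k poly" and h :: "nat \<Rightarrow> 'k poly"
  assumes "l \<ge> 1" and "n \<ge> 1"
    and "CHAR('k) = 0 \<or> coprime CHAR('k) l"
    and "primitive_root_of_unity l \<zeta>"
  shows "\<exists>\<phi> \<in> pres_alg_iso (cher_gens n l) (cher_rels n l \<zeta> k h)
                           (a_gens n l) (a_rels n l \<zeta> k h).
    (\<forall>f. \<phi> (cher_class n l \<zeta> k h (group_alg_elem (monomial_group n l) HG f))
         = a_class n l \<zeta> k h (group_alg_elem (monomial_group n l) AG f)) \<and>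
    (\<forall>i\<in>{1..n}.
       \<phi> (cher_class n l \<zeta> k h (h_x i))
         = a_class n l \<zeta> k h (a_w n (chi_cycle i) * a_sigma
             * gen (AG (inv\<^bsub>monomial_group n l\<^esub> (perm_mat n (upsilon_cycle n i))))) \<and>
       \<phi> (cher_class n l \<zeta> k h (h_y i))
         = a_class n l \<zeta> k h (a_w n (upsilon_cycle n i) * a_tau
             * gen (AG (inv\<^bsub>monomial_group n l\<^esub> (perm_mat n (chi_cycle i))))) \<and>
       \<phi> (cher_class n l \<zeta> k h (dunkl_opdam n l \<zeta> k h i))
         = a_class n l \<zeta> k h (a_u n (int i)))"
proof -
  have "\<zeta> ^ l = 1" using assms(4) by (simp add: primitive_root_of_unity_def)
  moreover have "of_nat l \<noteq> (0 :: 'k)"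
  proof
    assume "of_nat l = (0 :: 'k)"
    then have dvd: "CHAR('k) dvd l" by (simp add: of_nat_eq_0_iff_char_dvd)
    \<comment> \<open>Characteristic 0 is ruled out here, since 0 does not divide a positive
      l.\<close>
    with assms(1,3) have "coprime CHAR('k) l" by auto
    with dvd have "CHAR('k) = 1" by (simp add: coprime_absorb_left)
    then show False using of_nat_CHAR[where 'a = 'k] by simp
  qed
  ultimately have "cherednik n l \<zeta>" using assms(1,2) by unfold_locales
  then show ?thesis by (rule cherednik.isomorphism)
qed

end
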